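(* Let $\mathfrak{A}=\{\Gamma_i\}_{i=1}^{|\mathfrak{A}|}$ be any family of valid access structures for parties $\bm{B}=B_1,\ldots,B_n$, let $Q$ be an arbitrary system, and let $\bm{E}=E_1,\ldots,E_{|\mathfrak{A}|}$. First layer. Choose any blind QSS helper code that encodes $Q$ into $A\bm{E}$, with helper $A$ and other parties $E_1,\ldots,E_{|\mathfrak{A}|}$, and in which the helper provides assistance through classical communication alone. That is, for each $i$ there is a POVM $\{M_{a|i}\}_a$ on $A$ such that, given the announced outcome $a$, the secret can be recovered on $E_i$. Such a code can always be found. Since the code is blind, there exist an entangled state $|\psi\rangle_{AD}$ and an isometry $U_{DQ\to\bm{E}}$ such that the encoding of the basis states of $Q$ has the form $|m\rangle_Q\mapsto(\mathbb{I}_A\otimes U_{DQ\to\bm{E}})|\psi\rangle_{AD}|m\rangle_Q$. Second layer. For each $i$, let $W_i:\mathcal{H}_{E_i}\to\mathcal{H}_{B_{1,i}}\otimes\cdots\otimes\mathcal{H}_{B_{n,i}}$ be the encoding map of any QSS code for $n$ parties with access structure $\Gamma_i$ (such a code always exists). The share $B_{k,i}$ is delivered to party $B_k$, so that each party receives $|\mathfrak{A}|$ subsystems and $\mathcal{H}_{\bm{B}}=\bigotimes_{k=1}^{n}\bigotimes_{i=1}^{|\mathfrak{A}|}\mathcal{H}_{B_{k,i}}$. Let $U_{\mathrm{tot}}=\big(\bigotimes_{i=1}^{|\mathfrak{A}|}W_i\big)U_{DQ\to\bm{E}}$ and let $\mathcal{E}_{DQ\to\bm{B}}(\cdot)=U_{\mathrm{tot}}(\cdot)U_{\mathrm{tot}}^\dagger$.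 Then $(\mathfrak{A},\,|\psi\rangle\langle\psi|_{AD},\,\mathcal{E}_{DQ\to\bm{B}},\,\{M_{a|i}\}_{a,i})$ is a programmable access structure (PAS) for $Q$ and $\bm{B}$, i.e. it realizes a programming of $\mathfrak{A}$. In particular, when the measurement $\{M_{a|i}\}_a$ is performed and its outcome is announced, any $S\in\Gamma_i$ can recover the information in $E_i$, and therefore the original information in $Q$. The shares of the systems $E_j$, $j\neq i$, contain no information about $Q$, so even when all of these shares are accounted for, the access structure for recovering $Q$ is $\Gamma_i$.
   Context: QSS code. A quantum secret sharing (QSS) code for a state space $\mathcal{H}_Q$ and parties $P_1,\ldots,P_r$ is a subspace $\mathcal{V}\subset\mathcal{H}_{P_1}\otimes\cdots\otimes\mathcal{H}_{P_r}$, used with an isometric encoding map $\mathcal{H}_Q\to\mathcal{V}$. It is characterized by its access structure $\Gamma\subset 2^{\{P_1,\ldots,P_r\}}$, whose elements are called authorized sets: for every $S\in\Gamma$ there is a quantum channel $\mathcal{R}_S$ with $\mathcal{R}_S\circ\mathrm{Tr}_{\overline{S}}\circ\Pi_{\mathcal{V}}=\Pi_{\mathcal{V}}$. Here $\overline{S}$ is the complement of $S$ and $\Pi_{\mathcal{V}}(\cdot)=P_{\mathcal{V}}(\cdot)P_{\mathcal{V}}$, with $P_{\mathcal{V}}$ the projector onto $\mathcal{V}$. "Valid" access structures are those that can be realized by a QSS code; it is known that QSS schemes exist for any access structure that satisfies the no-cloning principle (two disjoint subsets cannot both recover the secret) and is monotonic (adding parties never harms recovery). Blind helper code. A QSS code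 for parties $A,E_1,\ldots,E_N$ with access structure $\Gamma$ is a helper code with helper $A$ if (i) every set containing $A$ and at least one $E_j$ is in $\Gamma$ (equivalently, $\{A,E_j\}\in\Gamma$ for all $j$), and (ii) $\{A\}\notin\Gamma$. It is blind if in addition (iii) $\{E_1,\ldots,E_N\}\in\Gamma$. PAS. A programmable access structure for input system $Q$ and parties $\bm{B}$ is a tuple $(\mathfrak{A},\psi_{AD},\mathcal{E}_{DQ\to\bm{B}},\{M_{a|i}\}_{a,i})$, where $\mathfrak{A}=\{\Gamma_i\}_i$ is a family of access structures $\Gamma_i\subset2^{\{B_1,\ldots,B_n\}}$; $\psi_{AD}$ is a (pure or mixed) state shared by a programmer (holding $A$) and a dealer (holding $D$); $\mathcal{E}_{DQ\to\bm{B}}$ is a completely positive trace-preserving map from operators on $\mathcal{H}_D\otimes\mathcal{H}_Q$ to operators on $\mathcal{H}_{\bm{B}}$; and for each $i$, $\{M_{a|i}\}_a$ is a POVM on $A$ ($M_{a|i}\ge0$, $\sum_aM_{a|i}=\mathbb{I}_A$), such that: (i) for every outcome $a$ and every $\Gamma_i\in\mathfrak{A}$, $\mathcal{V}_{a|i}=\mathrm{supp}\{\mathrm{Tr}_A[(M_{a|i}\otimes\mathbb{I}_{\bm{B}})(\mathrm{id}_A\otimes\mathcal{E}_{DQ\to\bm{B}})(\psi_{AD}\otimes\mathbb{I}_Q)]\}$ is a QSS code for $Q$ with access structure $\Gamma_i$; (ii) $\mathcal{V}=\mathrm{supp}\{(\mathrm{id}_A\otimes\mathcal{E}_{DQ\to\bm{B}})(\psi_{AD}\otimes\mathbb{I}_Q)\}$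 is a code for $Q$ that can correct the erasure of $A$, i.e. there is a channel $\mathcal{R}$ from $\bm{B}$ to $A\bm{B}$ with $\mathcal{R}\circ\mathrm{Tr}_A\circ\Pi_{\mathcal{V}}=\Pi_{\mathcal{V}}$. Such a tuple is said to realize a programming of $\mathfrak{A}$. Here $\mathrm{supp}$ denotes the support of a positive operator.
   Formalization: Exactness of Γ_i needs an added condition: from W_i no unauthorized set extracts a Q-sized secret, even with an uninformative side system. Also required: each post-measurement support is a code for Q that E_i recovers; outcomes possible; dim Q≥2. ψ is claimed entangled only if |𝔄|≥2. *)

theory Defs
  imports "HOL-Analysis.Analysis"
begin

section \<open>Finite-dimensional Hilbert spaces with a labelled orthonormal basis\<close>

text \<open>
  Every Hilbert space is given by a finite set \<open>X\<close> of basis labels. Kets, linear maps and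
  operators are their coordinate functions, and vanish outside the label sets. Tensor products
  are products of label sets; the joint space of a family of parties with local label
  sets \<open>L p\<close> has the label set \<open>PiE S L\<close>, for \<open>S\<close> the set of parties. The dimension of a space
  is the cardinality of its label set and may vary inside a formula.
\<close>

type_synonym 'x ket = "'x \<Rightarrow> complex"
type_synonym ('y, 'x) lin = "'y \<Rightarrow> 'x \<Rightarrow> complex"
type_synonym 'x oper = "('x, 'x) lin"

definition kets :: "'x set \<Rightarrow> 'x ket set" where
  "kets X = {v. \<forall>x. x \<notin> X \<longrightarrow> v x = 0}"

definition opers :: "'x set \<Rightarrow> 'x oper set" where
  "opers X = {\<rho>. \<forall>x y. x \<notin> X \<or> y \<notin> X \<longrightarrow> \<rho> x y = 0}"

definition inner_on :: "'x set \<Rightarrow> 'x ket \<Rightarrow> 'x ket \<Rightarrow> complex" where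
  "inner_on X v w = (\<Sum>x\<in>X. cnj (v x) * w x)"

definition app :: "'x set \<Rightarrow> ('y, 'x) lin \<Rightarrow> 'x ket \<Rightarrow> 'y ket" where
  "app X K v = (\<lambda>y. \<Sum>x\<in>X. K y x * v x)"

definition lin_range :: "'x set \<Rightarrow> ('y, 'x) lin \<Rightarrow> 'y ket set" where
  "lin_range X K = app X K ` kets X"

definition isometry :: "'x set \<Rightarrow> 'y set \<Rightarrow> ('y, 'x) lin \<Rightarrow> bool" where
  "isometry X Y K \<longleftrightarrow>
     (\<forall>y x. y \<notin> Y \<or> x \<notin> X \<longrightarrow> K y x = 0) \<and>
     (\<forall>x\<in>X. \<forall>x'\<in>X. (\<Sum>y\<in>Y. cnj (K y x) * K y x') = (if x = x' then 1 else 0))"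

text \<open>\<open>conj_by X K \<rho>\<close> is \<open>K \<rho> K\<dagger>\<close>, where \<open>X\<close> is the domain of \<open>K\<close>.\<close>

definition conj_by :: "'x set \<Rightarrow> ('y, 'x) lin \<Rightarrow> 'x oper \<Rightarrow> 'y oper" where
  "conj_by X K \<rho> = (\<lambda>y y'. \<Sum>x\<in>X. \<Sum>x'\<in>X. K y x * \<rho> x x' * cnj (K y' x'))"

definition id_op :: "'x set \<Rightarrow> 'x oper" where
  "id_op X = (\<lambda>x y. if x = y \<and> x \<in> X then 1 else 0)"

definition ket_bra :: "'x ket \<Rightarrow> 'x oper" where
  "ket_bra v = (\<lambda>x y. v x * cnj (v y))"

definition trace_on :: "'x set \<Rightarrow> 'x oper \<Rightarrow> complex" where
  "trace_on X \<rho> = (\<Sum>x\<in>X. \<rho> x x)"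

definition positive_op :: "'x set \<Rightarrow> 'x oper \<Rightarrow> bool" where
  "positive_op X \<rho> \<longleftrightarrow> \<rho> \<in> opers X \<and>
     (\<forall>v\<in>kets X. inner_on X v (app X \<rho> v) \<in> \<real> \<and> 0 \<le> Re (inner_on X v (app X \<rho> v)))"

definition state :: "'x set \<Rightarrow> 'x oper \<Rightarrow> bool" where
  "state X \<rho> \<longleftrightarrow> positive_op X \<rho> \<and> trace_on X \<rho> = 1"

definition support_of :: "'x set \<Rightarrow> 'x oper \<Rightarrow> 'x ket set" where
  "support_of X \<rho> =
     {v \<in> kets X. \<forall>w\<in>kets X. app X \<rho> w = (\<lambda>_. 0) \<longrightarrow> inner_on X w v = 0}"

definition projector :: "'x set \<Rightarrow> 'x ket set \<Rightarrow> 'x oper" where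
  "projector X V = (THE P. P \<in> opers X \<and> (\<forall>v\<in>V. app X P v = v) \<and>
     (\<forall>w\<in>kets X. (\<forall>v\<in>V. inner_on X v w = 0) \<longrightarrow> app X P w = (\<lambda>_. 0)))"

definition povm :: "'x set \<Rightarrow> 'o set \<Rightarrow> ('o \<Rightarrow> 'x oper) \<Rightarrow> bool" where
  "povm X Oc M \<longleftrightarrow> finite Oc \<and> (\<forall>a\<in>Oc. positive_op X (M a)) \<and>
     (\<lambda>x y. \<Sum>a\<in>Oc. M a x y) = id_op X"

definition entangled :: "'a set \<Rightarrow> 'd set \<Rightarrow> ('a \<times> 'd) ket \<Rightarrow> bool" where
  "entangled A D \<psi> \<longleftrightarrow> \<not> (\<exists>\<alpha>\<in>kets A. \<exists>\<beta>\<in>kets D. \<forall>a\<in>A. \<forall>d\<in>D. \<psi> (a, d) = \<alpha> a * \<beta> d)"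


section \<open>Channels and partial traces\<close>

definition tensor_op :: "'x oper \<Rightarrow> 'y oper \<Rightarrow> ('x \<times> 'y) oper" where
  "tensor_op \<rho> \<sigma> = (\<lambda>(x, y) (x', y'). \<rho> x x' * \<sigma> y y')"

text \<open>The map \<open>id \<otimes> \<Phi>\<close>.\<close>

definition id_tensor ::
  "('x oper \<Rightarrow> 'y oper) \<Rightarrow> ('r \<times> 'x) oper \<Rightarrow> ('r \<times> 'y) oper" where
  "id_tensor \<Phi> \<rho> = (\<lambda>(s, y) (s', y'). \<Phi> (\<lambda>x x'. \<rho> (s, x) (s', x')) y y')"

definition channel :: "'x set \<Rightarrow> 'y set \<Rightarrow> ('x oper \<Rightarrow> 'y oper) \<Rightarrow> bool" where
  "channel X Y \<Phi> \<longleftrightarrow>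
     (\<forall>\<rho>\<in>opers X. \<Phi> \<rho> \<in> opers Y) \<and>
     (\<forall>\<rho>\<in>opers X. \<forall>\<sigma>\<in>opers X. \<forall>c. \<Phi> (\<lambda>x y. c * \<rho> x y + \<sigma> x y) = (\<lambda>x y. c * \<Phi> \<rho> x y + \<Phi> \<sigma> x y)) \<and>
     (\<forall>(k::nat) \<rho>. positive_op ({..<k} \<times> X) \<rho> \<longrightarrow> positive_op ({..<k} \<times> Y) (id_tensor \<Phi> \<rho>)) \<and>
     (\<forall>\<rho>\<in>opers X. trace_on Y (\<Phi> \<rho>) = trace_on X \<rho>)"

definition trace_fst :: "'a set \<Rightarrow> ('a \<times> 'y) oper \<Rightarrow> 'y oper" where
  "trace_fst A \<tau> = (\<lambda>y y'. \<Sum>a\<in>A. \<tau> (a, y) (a, y'))"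

definition trace_snd :: "'y set \<Rightarrow> ('a \<times> 'y) oper \<Rightarrow> 'a oper" where
  "trace_snd Y \<tau> = (\<lambda>a a'. \<Sum>y\<in>Y. \<tau> (a, y) (a', y))"

text \<open>\<open>Tr\<^sub>A [(M \<otimes> I) \<tau>]\<close>: the unnormalised post-measurement operator after outcome \<open>M\<close> on \<open>A\<close>.\<close>

definition measured :: "'a set \<Rightarrow> 'a oper \<Rightarrow> ('a \<times> 'y) oper \<Rightarrow> 'y oper" where
  "measured A M \<tau> = (\<lambda>y y'. \<Sum>a\<in>A. \<Sum>a'\<in>A. M a a' * \<tau> (a', y) (a, y'))"

text \<open>
  \<open>reduce L S \<rho>\<close> traces out the parties outside \<open>S\<close> and leaves an operator on the space
  of the parties in \<open>S\<close>.
\<close>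

definition reduce :: "('p \<Rightarrow> 'l set) \<Rightarrow> 'p set \<Rightarrow> ('p \<Rightarrow> 'l) oper \<Rightarrow> ('p \<Rightarrow> 'l) oper" where
  "reduce L S \<rho> = (\<lambda>f g. if f \<in> PiE S L \<and> g \<in> PiE S L
      then \<Sum>h\<in>PiE (- S) L. \<rho> (override_on h f S) (override_on h g S) else 0)"

text \<open>
  In the next two definitions \<open>\<Phi>\<close> is a linear map from operators on the secret system \<open>Q\<close> to
  operators on \<open>Y\<close>. It may be trace-decreasing (the branch of a measurement outcome); the trace
  of \<open>\<Phi> \<rho>\<close> is then the probability of the branch.
\<close>

definition secret_recoverable :: "'q set \<Rightarrow> 'y set \<Rightarrow> ('q oper \<Rightarrow> 'y oper) \<Rightarrow> bool" where
  "secret_recoverable Q Y \<Phi> \<longleftrightarrow> (\<exists>R. channel Y Q R \<and>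
     (\<forall>\<rho>. state Q \<rho> \<longrightarrow> R (\<Phi> \<rho>) = (\<lambda>m m'. trace_on Y (\<Phi> \<rho>) * \<rho> m m')))"

definition no_information :: "'q set \<Rightarrow> ('q oper \<Rightarrow> 'y oper) \<Rightarrow> bool" where
  "no_information Q \<Phi> \<longleftrightarrow> (\<forall>\<rho> \<rho>'. state Q \<rho> \<and> state Q \<rho>' \<longrightarrow> \<Phi> \<rho> = \<Phi> \<rho>')"


section \<open>Quantum secret sharing\<close>

text \<open>The set of all parties is the whole (finite) type \<open>'p\<close>.\<close>

definition code_for :: "'q set \<Rightarrow> 'y set \<Rightarrow> 'y ket set \<Rightarrow> bool" where
  "code_for Q Y V \<longleftrightarrow> (\<exists>J. isometry Q Y J \<and> lin_range Q J = V)"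

definition recovers :: "('p::finite \<Rightarrow> 'l set) \<Rightarrow> ('p \<Rightarrow> 'l) ket set \<Rightarrow> 'p set \<Rightarrow> bool" where
  "recovers L V S \<longleftrightarrow> (\<exists>R. channel (PiE S L) (PiE UNIV L) R \<and>
     (\<forall>\<rho>\<in>opers (PiE UNIV L).
        let \<pi> = conj_by (PiE UNIV L) (projector (PiE UNIV L) V) \<rho> in R (reduce L S \<pi>) = \<pi>))"

text \<open>
  \<open>authorizing_code\<close> asks that the sets in \<open>\<Gamma>\<close> recover; \<open>qss_code\<close> that they
  are exactly the sets that do.
\<close>

definition authorizing_code ::
  "'q set \<Rightarrow> ('p::finite \<Rightarrow> 'l set) \<Rightarrow> ('p \<Rightarrow> 'l) ket set \<Rightarrow> 'p set set \<Rightarrow> bool" where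
  "authorizing_code Q L V \<Gamma> \<longleftrightarrow> code_for Q (PiE UNIV L) V \<and> (\<forall>S\<in>\<Gamma>. recovers L V S)"

definition qss_code ::
  "'q set \<Rightarrow> ('p::finite \<Rightarrow> 'l set) \<Rightarrow> ('p \<Rightarrow> 'l) ket set \<Rightarrow> 'p set set \<Rightarrow> bool" where
  "qss_code Q L V \<Gamma> \<longleftrightarrow> code_for Q (PiE UNIV L) V \<and> (\<forall>S. S \<in> \<Gamma> \<longleftrightarrow> recovers L V S)"

text \<open>
  The secret must have dimension at least 2: from a one-dimensional code every
  set of parties, even the empty one, recovers.
\<close>

definition valid_access_structure :: "'p::finite set set \<Rightarrow> bool" where
  "valid_access_structure \<Gamma> \<longleftrightarrow> (\<exists>(q::nat) (d :: 'p \<Rightarrow> nat) V.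
     2 \<le> q \<and> qss_code {..<q} (\<lambda>p. {..<d p}) V \<Gamma>)"

text \<open>Party \<open>None\<close> is the helper \<open>A\<close>, party \<open>Some j\<close> is \<open>E\<^sub>j\<close>.\<close>

definition helper_code ::
  "'q set \<Rightarrow> ('i::finite option \<Rightarrow> 'l set) \<Rightarrow> ('i option \<Rightarrow> 'l) ket set \<Rightarrow> 'i option set set \<Rightarrow> bool" where
  "helper_code Q L V \<Gamma> \<longleftrightarrow> qss_code Q L V \<Gamma> \<and>
     (\<forall>S. None \<in> S \<and> (\<exists>j. Some j \<in> S) \<longrightarrow> S \<in> \<Gamma>) \<and> {None} \<notin> \<Gamma>"

definition blind_helper_code ::
  "'q set \<Rightarrow> ('i::finite option \<Rightarrow> 'l set) \<Rightarrow> ('i option \<Rightarrow> 'l) ket set \<Rightarrow> 'i option set set \<Rightarrow> bool" where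
  "blind_helper_code Q L V \<Gamma> \<longleftrightarrow> helper_code Q L V \<Gamma> \<and> range Some \<in> \<Gamma>"


section \<open>Programmable access structures\<close>

text \<open>
  \<open>Oc i\<close> is the set of outcomes of the \<open>i\<close>-th measurement. An outcome of probability zero leaves
  the zero operator, whose support encodes nothing, so condition (i) ranges over the outcomes
  that can occur. The argument \<open>code\<close> says what it means for a subspace to be a code
  with a given access structure: \<open>qss_code\<close> or \<open>authorizing_code\<close>.
\<close>

definition programmable ::
  "('q set \<Rightarrow> ('b::finite \<Rightarrow> 'l set) \<Rightarrow> ('b \<Rightarrow> 'l) ket set \<Rightarrow> 'b set set \<Rightarrow> bool) \<Rightarrow>
   'q set \<Rightarrow> ('b \<Rightarrow> 'l set) \<Rightarrow> 'a set \<Rightarrow> 'd set \<Rightarrow> ('i \<Rightarrow> 'b set set) \<Rightarrow> ('a \<times> 'd) oper \<Rightarrow>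
   (('d \<times> 'q) oper \<Rightarrow> ('b \<Rightarrow> 'l) oper) \<Rightarrow> ('i \<Rightarrow> 'o set) \<Rightarrow> ('i \<Rightarrow> 'o \<Rightarrow> 'a oper) \<Rightarrow> bool" where
  "programmable code Q L A D \<Gamma> \<psi> \<E> Oc M \<longleftrightarrow>
     state (A \<times> D) \<psi> \<and>
     channel (D \<times> Q) (PiE UNIV L) \<E> \<and>
     (\<forall>i. povm A (Oc i) (M i)) \<and>
     (let \<tau> = id_tensor \<E> (\<lambda>(a, d, m) (a', d', m'). \<psi> (a, d) (a', d') * id_op Q m m');
          V = support_of (A \<times> PiE UNIV L) \<tau>
      in (\<forall>i. \<forall>a\<in>Oc i. measured A (M i a) \<tau> \<noteq> (\<lambda>_ _. 0) \<longrightarrow>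
             code Q L (support_of (PiE UNIV L) (measured A (M i a) \<tau>)) (\<Gamma> i)) \<and>
         code_for Q (A \<times> PiE UNIV L) V \<and>
         (\<exists>R. channel (PiE UNIV L) (A \<times> PiE UNIV L) R \<and>
            (\<forall>\<rho>\<in>opers (A \<times> PiE UNIV L).
               let \<pi> = conj_by (A \<times> PiE UNIV L) (projector (A \<times> PiE UNIV L) V) \<rho>
               in R (trace_fst A \<pi>) = \<pi>)))"

abbreviation "programmable_access_structure \<equiv> programmable qss_code"


section \<open>The two-layer construction\<close>

abbreviation cfg :: "('p \<Rightarrow> nat) \<Rightarrow> ('p \<Rightarrow> nat) set" where
  "cfg d \<equiv> PiE UNIV (\<lambda>p. {..<d p})"

text \<open>The basis label of \<open>A E\<^sub>1 \<dots> E\<^sub>N\<close> with \<open>a\<close> on \<open>A\<close> and \<open>e\<close> on the \<open>E\<^sub>j\<close>.\<close>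

abbreviation join :: "nat \<Rightarrow> ('i \<Rightarrow> nat) \<Rightarrow> ('i option \<Rightarrow> nat)" where
  "join a e \<equiv> case_option a e"

text \<open>
  The branch of outcome \<open>M\<close> of a measurement of \<open>A\<close>, as a map from the secret to the
  \<open>E\<^sub>j\<close>: \<open>\<rho> \<mapsto> Tr\<^sub>A [(M \<otimes> I) V \<rho> V\<dagger>]\<close>.
\<close>

definition helper_branch ::
  "nat \<Rightarrow> nat \<Rightarrow> ('i option \<Rightarrow> nat, nat) lin \<Rightarrow> nat oper \<Rightarrow> nat oper \<Rightarrow> ('i \<Rightarrow> nat) oper" where
  "helper_branch q dA V M \<rho> = measured {..<dA} M
     (\<lambda>(a, e) (a', e'). conj_by {..<q} V \<rho> (join a e) (join a' e'))"

text \<open>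
  Assistance by classical communication alone. For every outcome that can occur, the
  post-measurement subspace is a code for the secret system that is recovered from \<open>E\<^sub>i\<close>, and
  the secret carried by the post-measurement state is recovered from \<open>E\<^sub>i\<close>. Neither condition
  implies the other for a measurement with operators of rank greater than 1: a coarse-grained
  outcome may enlarge the subspace, or dephase the secret inside an unchanged subspace.
\<close>

definition classically_assisted ::
  "nat \<Rightarrow> nat \<Rightarrow> ('i::finite \<Rightarrow> nat) \<Rightarrow> ('i option \<Rightarrow> nat, nat) lin \<Rightarrow>
   nat set \<Rightarrow> (nat \<Rightarrow> nat oper) \<Rightarrow> 'i \<Rightarrow> bool" where
  "classically_assisted q dA dE V Oc M i \<longleftrightarrow>
     povm {..<dA} Oc M \<and>
     (\<forall>a\<in>Oc.
        let B = helper_branch q dA V (M a); L = (\<lambda>j. {..<dE j})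
        in B (id_op {..<q}) \<noteq> (\<lambda>_ _. 0) \<longrightarrow>
           authorizing_code {..<q} L (support_of (cfg dE) (B (id_op {..<q}))) {{i}} \<and>
           secret_recoverable {..<q} (PiE {i} L) (\<lambda>\<rho>. reduce L {i} (B \<rho>)))"

definition first_layer ::
  "nat \<Rightarrow> nat \<Rightarrow> ('i::finite \<Rightarrow> nat) \<Rightarrow> ('i option \<Rightarrow> nat, nat) lin \<Rightarrow>
   ('i \<Rightarrow> nat set) \<Rightarrow> ('i \<Rightarrow> nat \<Rightarrow> nat oper) \<Rightarrow> bool" where
  "first_layer q dA dE V Oc M \<longleftrightarrow>
     isometry {..<q} (cfg (case_option dA dE)) V \<and>
     (\<exists>\<Gamma>. blind_helper_code {..<q} (\<lambda>p. {..<case_option dA dE p}) (lin_range {..<q} V) \<Gamma>) \<and>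
     (\<forall>i. classically_assisted q dA dE V (Oc i) (M i) i)"

text \<open>\<open>V |m\<rangle> = (I \<otimes> U) |\<psi>\<rangle> |m\<rangle>\<close> for a unit vector \<open>\<psi>\<close> and an isometry \<open>U\<close>.\<close>

definition dealer_form ::
  "nat \<Rightarrow> nat \<Rightarrow> ('i::finite \<Rightarrow> nat) \<Rightarrow> nat \<Rightarrow> ('i option \<Rightarrow> nat, nat) lin \<Rightarrow>
   (nat \<times> nat) ket \<Rightarrow> ('i \<Rightarrow> nat, nat \<times> nat) lin \<Rightarrow> bool" where
  "dealer_form q dA dE dD V \<psi> U \<longleftrightarrow>
     \<psi> \<in> kets ({..<dA} \<times> {..<dD}) \<and> inner_on ({..<dA} \<times> {..<dD}) \<psi> \<psi> = 1 \<and>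
     isometry ({..<dD} \<times> {..<q}) (cfg dE) U \<and>
     (\<forall>a<dA. \<forall>e\<in>cfg dE. \<forall>m<q. V (join a e) m = (\<Sum>x<dD. \<psi> (a, x) * U e (x, m)))"

text \<open>\<open>dB k i\<close> is the dimension of the share of \<open>E\<^sub>i\<close> that is delivered to \<open>B\<^sub>k\<close>.\<close>

definition second_layer ::
  "('i \<Rightarrow> nat) \<Rightarrow> ('b::finite \<Rightarrow> 'i \<Rightarrow> nat) \<Rightarrow> ('i \<Rightarrow> ('b \<Rightarrow> nat, nat) lin) \<Rightarrow>
   ('i \<Rightarrow> 'b set set) \<Rightarrow> bool" where
  "second_layer dE dB W \<Gamma> \<longleftrightarrow> (\<forall>i.
     isometry {..<dE i} (cfg (\<lambda>k. dB k i)) (W i) \<and>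
     qss_code {..<dE i} (\<lambda>k. {..<dB k i}) (lin_range {..<dE i} (W i)) (\<Gamma> i))"

text \<open>
  \<open>W\<close> encodes \<open>E\<close> into shares. The set \<open>S\<close> can extract a \<open>Q\<close>-dimensional secret if some
  encoding of \<open>Q\<close> into \<open>R E\<close>, in which the side system \<open>R\<close> carries no information about the
  secret, becomes recoverable from \<open>R\<close> and the shares held by \<open>S\<close>. Even if \<open>S\<close> cannot recover all
  of \<open>E\<close>, it may be able to extract secrets that occupy only a subspace or a
  subsystem of \<open>E\<close>.
\<close>

definition can_extract ::
  "'q set \<Rightarrow> 'e set \<Rightarrow> ('b::finite \<Rightarrow> 'l set) \<Rightarrow> ('b \<Rightarrow> 'l, 'e) lin \<Rightarrow> 'b set \<Rightarrow> bool" where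
  "can_extract Q E L W S \<longleftrightarrow> (\<exists>(r::nat) J.
     isometry Q ({..<r} \<times> E) J \<and>
     no_information Q (\<lambda>\<rho>. trace_snd E (conj_by Q J \<rho>)) \<and>
     secret_recoverable Q ({..<r} \<times> PiE S L)
       (\<lambda>\<rho>. id_tensor (\<lambda>\<sigma>. reduce L S (conj_by E W \<sigma>)) (conj_by Q J \<rho>)))"

definition tight ::
  "nat \<Rightarrow> ('i \<Rightarrow> nat) \<Rightarrow> ('b::finite \<Rightarrow> 'i \<Rightarrow> nat) \<Rightarrow> ('i \<Rightarrow> ('b \<Rightarrow> nat, nat) lin) \<Rightarrow>
   ('i \<Rightarrow> 'b set set) \<Rightarrow> bool" where
  "tight q dE dB W \<Gamma> \<longleftrightarrow> (\<forall>i S. S \<notin> \<Gamma> i \<longrightarrow>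
     \<not> can_extract {..<q} {..<dE i} (\<lambda>k. {..<dB k i}) (W i) S)"

text \<open>A basis label of \<open>\<^bold>B\<close> maps \<open>k\<close> and \<open>i\<close> to the basis label of the share \<open>B\<^sub>k\<^sub>,\<^sub>i\<close>.\<close>

definition W_tot ::
  "('i::finite \<Rightarrow> ('b \<Rightarrow> nat, nat) lin) \<Rightarrow> ('b \<Rightarrow> 'i \<Rightarrow> nat, 'i \<Rightarrow> nat) lin" where
  "W_tot W = (\<lambda>b e. \<Prod>i\<in>UNIV. W i (\<lambda>k. b k i) (e i))"

definition U_tot ::
  "('i::finite \<Rightarrow> nat) \<Rightarrow> ('i \<Rightarrow> ('b \<Rightarrow> nat, nat) lin) \<Rightarrow> ('i \<Rightarrow> nat, nat \<times> nat) lin \<Rightarrow>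
   ('b \<Rightarrow> 'i \<Rightarrow> nat, nat \<times> nat) lin" where
  "U_tot dE W U = (\<lambda>b dm. \<Sum>e\<in>cfg dE. W_tot W b e * U e dm)"

text \<open>The same operator on \<open>\<^bold>B\<close>, with the shares grouped by \<open>i\<close> instead of by party.\<close>

definition group_by_system :: "('b \<Rightarrow> 'i \<Rightarrow> nat) oper \<Rightarrow> ('i \<Rightarrow> 'b \<Rightarrow> nat) oper" where
  "group_by_system \<rho> = (\<lambda>f g. \<rho> (\<lambda>k i. f i k) (\<lambda>k i. g i k))"

end

theory Submission
  imports Defs
begin

text \<open>
  A set of parties recovers a code if and only if the reduced state of the other parties does not
  depend on the secret. If it recovers, the decoder, applied to one half of an encoded maximally entangled state,
  leaves reference and secret in a pure state, from which the other parties are decoupled. Conversely,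
  a Cholesky factor \<open>\<psi>\<close> of the reduced state of the other parties splits the code as
  \<open>(I \<otimes> U) |\<psi>\<rangle> |m\<rangle>\<close> with an isometry \<open>U\<close>, and inverting \<open>U\<close> recovers the secret. For a blind helper code this
  factorisation is the dealer form.

  The codes are uniform superpositions over additive secret sharings. For the second layer the
  superposition has one branch for each unauthorized set \<open>t\<close>, and in that branch the complement of \<open>t\<close> is
  authorized too, so that \<open>t\<close> learns nothing; extraction without error would have to succeed
  in this branch as well.

  A set in \<open>\<Gamma> i\<close> restores \<open>E\<^sub>i\<close> from its shares and discards the rest. In the other direction, a
  purification of the measured branch, together with the shares of all \<open>E\<^sub>j\<close> with \<open>j \<noteq> i\<close>, is a side system without
  information on \<open>Q\<close>, so a set that recovers \<open>Q\<close> extracts a secret from the code \<open>W\<^sub>i\<close>.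
\<close>

section \<open>Positive operators and channels\<close>

text \<open>The obstacle is the negative half of an access structure. The structure of
  \<open>W i\<close> only decides which sets restore all of E_i, whereas the secret may occupy a
  part of E_i and be correlated with other systems; a set outside \<Gamma> \<open>i\<close> might
  extract such a part. Arbitrary second layers are therefore only shown to be authorizing, exact
  structures are tied to \<open>tight\<close>, and tight codes have to be constructed. In a pure
  code a set is wholly ignorant only if its complement recovers, so a single pure sharing would need
  \<Gamma> to contain one of each complementary pair. The superposition avoids this: each
  unauthorized set has a branch to which its complement was added as a group. Monotonicity and
  no-cloning keep the groups of a branch pairwise intersecting, without which the secret of a branch
  could not be shifted by one group alone. The flag is copied to every party, so that branches stay
  orthogonal on whatever shares are traced out. Measurement operators of higher rank are split into
  Kraus operators, and the Kraus index is treated as one more environment system.\<close>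

definition sesq :: "'x set \<Rightarrow> 'x oper \<Rightarrow> 'x ket \<Rightarrow> 'x ket \<Rightarrow> complex" where
  "sesq X \<rho> v w = (\<Sum>x\<in>X. \<Sum>y\<in>X. cnj (v x) * \<rho> x y * w y)"

lemma inner_on_app: "inner_on X v (app X \<rho> w) = sesq X \<rho> v w"
  by (simp add: inner_on_def app_def sesq_def sum_distrib_left mult.assoc)

lemma nonneg_Reals_sum: "(\<And>x. x \<in> A \<Longrightarrow> f x \<in> \<real>\<^sub>\<ge>\<^sub>0) \<Longrightarrow> sum f A \<in> (\<real>\<^sub>\<ge>\<^sub>0 :: complex set)"
  by (induction A rule: infinite_finite_induct) auto

lemma nonneg_Reals_sum_0:
  assumes "finite A" "\<And>x. x \<in> A \<Longrightarrow> f x \<in> (\<real>\<^sub>\<ge>\<^sub>0 :: complex set)" "sum f A = 0" "x \<in> A"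
  shows "f x = 0"
proof -
  have "(\<Sum>x\<in>A. Re (f x)) = 0"
    using assms(3) by (metis Re_sum zero_complex.simps(1))
  then have "Re (f x) = 0"
    using assms by (subst (asm) sum_nonneg_eq_0_iff) (auto simp: complex_nonneg_Reals_iff)
  then show ?thesis
    using assms(2)[OF assms(4)] by (simp add: complex_nonneg_Reals_iff complex_eq_iff)
qed

lemma cnj_mult_self_nonneg: "cnj z * z \<in> \<real>\<^sub>\<ge>\<^sub>0" "z * cnj z \<in> \<real>\<^sub>\<ge>\<^sub>0"
  by (auto simp: complex_nonneg_Reals_iff)

lemma opersI: "(\<And>x y. x \<notin> X \<or> y \<notin> X \<Longrightarrow> \<rho> x y = 0) \<Longrightarrow> \<rho> \<in> opers X"
  by (auto simp: opers_def)

lemma opers_outside: "\<rho> \<in> opers X \<Longrightarrow> x \<notin> X \<or> y \<notin> X \<Longrightarrow> \<rho> x y = 0"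
  by (auto simp: opers_def)

lemma opers_eqI:
  assumes "\<rho> \<in> opers X" "\<sigma> \<in> opers X" "\<And>x y. x \<in> X \<Longrightarrow> y \<in> X \<Longrightarrow> \<rho> x y = \<sigma> x y"
  shows "\<rho> = \<sigma>"
  using assms by (intro ext) (metis opers_outside)

lemma opers_sum: "(\<And>k. k \<in> I \<Longrightarrow> \<rho> k \<in> opers X) \<Longrightarrow> (\<lambda>x y. \<Sum>k\<in>I. \<rho> k x y) \<in> opers X"
  by (auto simp: opers_def intro!: sum.neutral)

text \<open>The form only reads its vectors on \<open>X\<close>, so truncation to
  \<open>kets X\<close> changes nothing. Membership in the nonnegative complex numbers then replaces
  the pair of a reality and a sign condition.\<close>

lemma positive_op_iff: "positive_op X \<rho> \<longleftrightarrow> \<rho> \<in> opers X \<and> (\<forall>v. sesq X \<rho> v v \<in> \<real>\<^sub>\<ge>\<^sub>0)"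
proof -
  have "(\<forall>v\<in>kets X. sesq X \<rho> v v \<in> \<real>\<^sub>\<ge>\<^sub>0) \<longleftrightarrow> (\<forall>v. sesq X \<rho> v v \<in> \<real>\<^sub>\<ge>\<^sub>0)"
  proof (intro iffI ballI allI)
    fix v assume *: "\<forall>v\<in>kets X. sesq X \<rho> v v \<in> \<real>\<^sub>\<ge>\<^sub>0"
    have "sesq X \<rho> v v = sesq X \<rho> (\<lambda>x. if x \<in> X then v x else 0) (\<lambda>x. if x \<in> X then v x else 0)"
      by (simp add: sesq_def)
    then show "sesq X \<rho> v v \<in> \<real>\<^sub>\<ge>\<^sub>0" using * by (auto simp: kets_def)
  qed auto
  then show ?thesis
    by (auto simp: positive_op_def inner_on_app complex_nonneg_Reals_iff complex_is_Real_iff)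
qed

lemma positive_opD: "positive_op X \<rho> \<Longrightarrow> sesq X \<rho> v v \<in> \<real>\<^sub>\<ge>\<^sub>0"
  by (simp add: positive_op_iff)

lemma positive_op_opers: "positive_op X \<rho> \<Longrightarrow> \<rho> \<in> opers X"
  by (simp add: positive_op_iff)

lemma sesq_add_left: "sesq X \<rho> (\<lambda>x. c * u x + v x) w = cnj c * sesq X \<rho> u w + sesq X \<rho> v w"
  by (simp add: sesq_def sum.distrib sum_distrib_left algebra_simps)

lemma sesq_add_right: "sesq X \<rho> v (\<lambda>x. c * u x + w x) = c * sesq X \<rho> v u + sesq X \<rho> v w"
  by (simp add: sesq_def sum.distrib sum_distrib_left algebra_simps)

definition basis_ket :: "'x \<Rightarrow> 'x ket" where "basis_ket x = (\<lambda>y. if y = x then 1 else 0)"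

lemma sesq_basis_left:
  assumes "finite X" "x \<in> X"
  shows "sesq X \<rho> (basis_ket x) w = (\<Sum>y\<in>X. \<rho> x y * w y)"
proof -
  have "sesq X \<rho> (basis_ket x) w = (\<Sum>x'\<in>X. if x' = x then (\<Sum>y\<in>X. \<rho> x' y * w y) else 0)"
    by (auto simp: sesq_def basis_ket_def intro!: sum.cong)
  then show ?thesis using assms by simp
qed

lemma sum_basis_ket:
  assumes "finite X" "x \<in> X"
  shows "(\<Sum>y\<in>X. f y * basis_ket x y) = f x"
proof -
  have "(\<Sum>y\<in>X. f y * basis_ket x y) = (\<Sum>y\<in>X. if y = x then f y else 0)"
    by (intro sum.cong) (auto simp: basis_ket_def)
  then show ?thesis using assms by simp
qed

lemma sesq_basis_basis:
  assumes "finite X" "x \<in> X" "y \<in> X"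
  shows "sesq X \<rho> (basis_ket x) (basis_ket y) = \<rho> x y"
  using assms by (simp add: sesq_basis_left sum_basis_ket)

lemma positive_op_diag: "finite X \<Longrightarrow> positive_op X \<rho> \<Longrightarrow> \<rho> x x \<in> \<real>\<^sub>\<ge>\<^sub>0"
  using positive_opD[of X \<rho> "basis_ket x"]
  by (cases "x \<in> X") (auto simp: sesq_basis_basis opers_outside[OF positive_op_opers])

text \<open>Polarisation: the form is real at \<open>v + w\<close> and at
  \<open>\<i> * v + w\<close>, which settles the imaginary and the real part of the claim.\<close>

lemma sesq_hermitian:
  assumes "positive_op X \<rho>"
  shows "sesq X \<rho> w v = cnj (sesq X \<rho> v w)"
proof -
  let ?f = "sesq X \<rho>"
  have exp: "?f (\<lambda>x. c * v x + w x) (\<lambda>x. c * v x + w x)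
     = cnj c * c * ?f v v + c * ?f w v + cnj c * ?f v w + ?f w w" for c
    by (simp only: sesq_add_left sesq_add_right) (simp add: algebra_simps)
  have pos: "Im (?f u u) = 0" for u
    using positive_opD[OF assms, of u] by (simp add: complex_nonneg_Reals_iff)
  have "Im (cnj 1 * 1 * ?f v v + 1 * ?f w v + cnj 1 * ?f v w + ?f w w) = 0"
    unfolding exp[symmetric] by (rule pos)
  moreover have "Im (cnj \<i> * \<i> * ?f v v + \<i> * ?f w v + cnj \<i> * ?f v w + ?f w w) = 0"
    unfolding exp[symmetric] by (rule pos)
  ultimately show ?thesis
    using pos[of v] pos[of w] by (simp add: complex_eq_iff)
qed

lemma positive_op_hermitian:
  assumes "finite X" "positive_op X \<rho>"
  shows "\<rho> y x = cnj (\<rho> x y)"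
proof (cases "x \<in> X \<and> y \<in> X")
  case True
  then show ?thesis
    using sesq_hermitian[OF assms(2), of "basis_ket y" "basis_ket x"] assms(1)
    by (simp add: sesq_basis_basis)
next
  case False
  then have "\<rho> x y = 0" "\<rho> y x = 0"
    using opers_outside[OF positive_op_opers[OF assms(2)]] by auto
  then show ?thesis by simp
qed

text \<open>Otherwise a small move away from the null vector \<open>v\<close> along \<open>w\<close>
  would make the form negative: the gain is linear in the step, the positive correction only
  quadratic.\<close>

lemma positive_op_null:
  assumes pos: "positive_op X \<rho>" and null: "sesq X \<rho> v v = 0"
  shows "sesq X \<rho> w v = 0"
proof -
  let ?f = "sesq X \<rho>" and ?z = "sesq X \<rho> w v"
  define r where "r = Re (?f w w)"
  \<comment> \<open>Any positive \<open>t\<close> with \<open>t * r < 2\<close> would do; the added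
    1 keeps the denominator nonzero when \<open>r = 0\<close>.\<close>
  define t where "t = 1 / (r + 1)"
  have r: "?f w w = of_real r" "0 \<le> r"
    using positive_opD[OF pos, of w] by (auto simp: complex_nonneg_Reals_iff r_def complex_eq_iff)
  have herm: "?f v w = cnj ?z" by (rule sesq_hermitian[OF pos])
  let ?c = "- of_real t * ?z"
  have "?f (\<lambda>x. ?c * w x + v x) (\<lambda>x. ?c * w x + v x)
     = of_real ((t\<^sup>2 * r - 2 * t) * (cmod ?z)\<^sup>2)"
    unfolding of_real_mult complex_norm_square
    by (simp only: sesq_add_left sesq_add_right null herm r(1))
      (simp add: algebra_simps power2_eq_square)
  then have "0 \<le> (t\<^sup>2 * r - 2 * t) * (cmod ?z)\<^sup>2"
    using positive_opD[OF pos, of "\<lambda>x. ?c * w x + v x"] by (simp add: complex_nonneg_Reals_iff)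
  moreover have "t\<^sup>2 * r - 2 * t < 0"
  proof -
    have "t > 0" "t * r \<le> 1" using r(2) by (auto simp: t_def)
    then have "t * (t * r) \<le> t * 1" by (intro mult_left_mono) auto
    then show ?thesis using \<open>t > 0\<close> by (simp add: power2_eq_square mult.assoc)
  qed
  ultimately have "(cmod ?z)\<^sup>2 \<le> 0"
    by (simp add: zero_le_mult_iff)
  then show ?thesis by simp
qed

lemma positive_op_null_column:
  assumes "finite X" "positive_op X \<rho>" "sesq X \<rho> v v = 0"
  shows "(\<Sum>y\<in>X. \<rho> x y * v y) = 0"
proof (cases "x \<in> X")
  case True
  then show ?thesis
    using positive_op_null[OF assms(2,3), of "basis_ket x"] assms(1) by (simp add: sesq_basis_left)
next
  case False
  then show ?thesis by (simp add: opers_outside[OF positive_op_opers[OF assms(2)]])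
qed

lemma positive_op_zero_diag:
  assumes "finite X" "positive_op X \<rho>" "\<rho> x x = 0"
  shows "\<rho> y x = 0" "\<rho> x y = 0"
proof -
  show "\<rho> y x = 0"
  proof (cases "x \<in> X")
    case True
    then have "(\<Sum>z\<in>X. \<rho> y z * basis_ket x z) = 0"
      using assms by (intro positive_op_null_column) (simp_all add: sesq_basis_basis)
    then show ?thesis using True assms(1) by (simp add: sum_basis_ket)
  qed (simp add: opers_outside[OF positive_op_opers[OF assms(2)]])
  then show "\<rho> x y = 0" using positive_op_hermitian[OF assms(1,2), of x y] by simp
qed

lemma ket_bra_positive:
  assumes "v \<in> kets X" shows "positive_op X (ket_bra v)"
proof -
  have "sesq X (ket_bra v) w w = cnj (\<Sum>x\<in>X. cnj (v x) * w x) * (\<Sum>x\<in>X. cnj (v x) * w x)" for w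
    by (simp add: sesq_def ket_bra_def sum_product cnj_sum algebra_simps)
  moreover have "ket_bra v \<in> opers X" using assms by (auto simp: kets_def opers_def ket_bra_def)
  ultimately show ?thesis by (simp only: positive_op_iff cnj_mult_self_nonneg simp_thms)
qed

lemma positive_op_sum:
  assumes "\<And>k. k \<in> I \<Longrightarrow> positive_op X (\<rho> k)"
  shows "positive_op X (\<lambda>x y. \<Sum>k\<in>I. \<rho> k x y)"
proof -
  have "sesq X (\<lambda>x y. \<Sum>k\<in>I. \<rho> k x y) v v = (\<Sum>k\<in>I. sesq X (\<rho> k) v v)" for v
  proof -
    have "(\<Sum>k\<in>I. sesq X (\<rho> k) v v) = (\<Sum>x\<in>X. \<Sum>y\<in>X. \<Sum>k\<in>I. cnj (v x) * \<rho> k x y * v y)"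
      unfolding sesq_def by (subst sum.swap, intro sum.cong refl, rule sum.swap)
    then show ?thesis by (simp add: sesq_def sum_distrib_left sum_distrib_right)
  qed
  then show ?thesis
    using assms by (auto simp: positive_op_iff intro!: nonneg_Reals_sum opers_sum)
qed

lemma conj_by_opers: "(\<And>y x. y \<notin> Y \<Longrightarrow> K y x = 0) \<Longrightarrow> conj_by X K \<rho> \<in> opers Y"
  by (auto simp: conj_by_def opers_def)

lemma conj_by_linear:
  "conj_by X K (\<lambda>x y. c * \<rho> x y + \<sigma> x y) = (\<lambda>x y. c * conj_by X K \<rho> x y + conj_by X K \<sigma> x y)"
  by (simp add: conj_by_def sum.distrib sum_distrib_left algebra_simps)

lemma sum_swap_pairs:
  "(\<Sum>a\<in>A. \<Sum>b\<in>B. \<Sum>c\<in>C. \<Sum>d\<in>D. f a b c d) = (\<Sum>c\<in>C. \<Sum>d\<in>D. \<Sum>a\<in>A. \<Sum>b\<in>B. f a b c d)"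
proof -
  have "(\<Sum>a\<in>A. \<Sum>b\<in>B. \<Sum>c\<in>C. \<Sum>d\<in>D. f a b c d) = (\<Sum>a\<in>A. \<Sum>c\<in>C. \<Sum>d\<in>D. \<Sum>b\<in>B. f a b c d)"
    by (intro sum.cong refl) (subst sum.swap, intro sum.cong refl, rule sum.swap)
  also have "\<dots> = (\<Sum>c\<in>C. \<Sum>d\<in>D. \<Sum>a\<in>A. \<Sum>b\<in>B. f a b c d)"
    by (subst sum.swap, intro sum.cong refl, rule sum.swap)
  finally show ?thesis .
qed

lemma sesq_conj_by:
  "sesq Y (conj_by X K \<rho>) v w =
   sesq X \<rho> (\<lambda>x. \<Sum>y\<in>Y. cnj (K y x) * v y) (\<lambda>x. \<Sum>y\<in>Y. cnj (K y x) * w y)"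
proof -
  have "sesq Y (conj_by X K \<rho>) v w
     = (\<Sum>y\<in>Y. \<Sum>y'\<in>Y. \<Sum>x\<in>X. \<Sum>x'\<in>X. cnj (v y) * (K y x * \<rho> x x' * cnj (K y' x')) * w y')"
    by (simp add: sesq_def conj_by_def sum_distrib_left sum_distrib_right)
  also have "\<dots> = (\<Sum>x\<in>X. \<Sum>x'\<in>X. \<Sum>y\<in>Y. \<Sum>y'\<in>Y. cnj (v y) * (K y x * \<rho> x x' * cnj (K y' x')) * w y')"
    by (rule sum_swap_pairs)
  also have "\<dots> = sesq X \<rho> (\<lambda>x. \<Sum>y\<in>Y. cnj (K y x) * v y) (\<lambda>x. \<Sum>y\<in>Y. cnj (K y x) * w y)"
    by (simp add: sesq_def cnj_sum sum_distrib_left sum_distrib_right algebra_simps)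
  finally show ?thesis .
qed

lemma conj_by_positive:
  assumes "positive_op X \<rho>" "\<And>y x. y \<notin> Y \<Longrightarrow> K y x = 0"
  shows "positive_op Y (conj_by X K \<rho>)"
  using assms by (simp add: positive_op_iff sesq_conj_by conj_by_opers)

lemma sesq_Times:
  "sesq (Z \<times> X) \<rho> v w =
   (\<Sum>z\<in>Z. \<Sum>z'\<in>Z. sesq X (\<lambda>x x'. \<rho> (z, x) (z', x')) (\<lambda>x. v (z, x)) (\<lambda>x. w (z', x)))"
  unfolding sesq_def sum.cartesian_product'
  by (intro sum.cong refl) (rule sum.swap)

lemma id_tensor_conj_by_positive:
  assumes pos: "positive_op (Z \<times> X) \<rho>" and K: "\<And>y x. y \<notin> Y \<Longrightarrow> K y x = 0"
  shows "positive_op (Z \<times> Y) (id_tensor (conj_by X K) \<rho>)"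
proof -
  have "sesq (Z \<times> Y) (id_tensor (conj_by X K) \<rho>) v v =
     sesq (Z \<times> X) \<rho> (\<lambda>(z, x). \<Sum>y\<in>Y. cnj (K y x) * v (z, y)) (\<lambda>(z, x). \<Sum>y\<in>Y. cnj (K y x) * v (z, y))" for v
    by (simp add: sesq_Times id_tensor_def sesq_conj_by)
  moreover have "id_tensor (conj_by X K) \<rho> \<in> opers (Z \<times> Y)"
  proof (rule opersI, clarify)
    fix z y z' y' assume out: "(z, y) \<notin> Z \<times> Y \<or> (z', y') \<notin> Z \<times> Y"
    have "z \<notin> Z \<or> z' \<notin> Z \<Longrightarrow> \<rho> (z, x) (z', x') = 0" for x x'
      by (rule opers_outside[OF positive_op_opers[OF pos]]) auto
    then show "id_tensor (conj_by X K) \<rho> (z, y) (z', y') = 0"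
      using out K by (auto simp: id_tensor_def conj_by_def intro!: sum.neutral)
  qed
  ultimately show ?thesis using positive_opD[OF pos] by (simp add: positive_op_iff)
qed

lemma trace_conj_by:
  assumes "finite X"
  shows "trace_on Y (conj_by X K \<rho>) = (\<Sum>x\<in>X. \<Sum>x'\<in>X. (\<Sum>y\<in>Y. cnj (K y x') * K y x) * \<rho> x x')"
proof -
  have "trace_on Y (conj_by X K \<rho>) = (\<Sum>x\<in>X. \<Sum>x'\<in>X. \<Sum>y\<in>Y. K y x * \<rho> x x' * cnj (K y x'))"
    unfolding trace_on_def conj_by_def
    by (subst sum.swap, intro sum.cong refl, rule sum.swap)
  then show ?thesis by (simp add: sum_distrib_left sum_distrib_right mult_ac)
qed

section \<open>Kraus representations and the linear calculus of channels\<close>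

definition kraus :: "'k set \<Rightarrow> 'x set \<Rightarrow> ('k \<Rightarrow> ('y, 'x) lin) \<Rightarrow> 'x oper \<Rightarrow> 'y oper" where
  "kraus I X K \<rho> = (\<lambda>y y'. \<Sum>k\<in>I. conj_by X (K k) \<rho> y y')"

text \<open>The concrete channels below, apart from the identity and compositions, come from here:
  positivity holds for each Kraus operator separately, and completeness preserves the trace.\<close>

lemma channel_kraus:
  assumes fin: "finite X" and K: "\<And>k y x. k \<in> I \<Longrightarrow> y \<notin> Y \<Longrightarrow> K k y x = 0"
    and complete: "\<And>x x'. x \<in> X \<Longrightarrow> x' \<in> X \<Longrightarrow>
      (\<Sum>k\<in>I. \<Sum>y\<in>Y. cnj (K k y x) * K k y x') = (if x = x' then 1 else 0)"
  shows "channel X Y (kraus I X K)"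
proof -
  have "trace_on Y (kraus I X K \<rho>) = trace_on X \<rho>" for \<rho>
  proof -
    have "trace_on Y (kraus I X K \<rho>) = (\<Sum>k\<in>I. trace_on Y (conj_by X (K k) \<rho>))"
      unfolding trace_on_def kraus_def by (rule sum.swap)
    also have "\<dots> = (\<Sum>x\<in>X. \<Sum>x'\<in>X. (\<Sum>k\<in>I. \<Sum>y\<in>Y. cnj (K k y x') * K k y x) * \<rho> x x')"
      using fin by (simp add: trace_conj_by sum_distrib_right)
        (subst sum.swap, intro sum.cong refl, rule sum.swap)
    also have "\<dots> = (\<Sum>x\<in>X. \<Sum>x'\<in>X. if x' = x then \<rho> x x' else 0)"
      by (intro sum.cong refl) (simp add: complete)
    finally show ?thesis using fin by (simp add: trace_on_def)
  qed
  moreover have "positive_op (Z \<times> Y) (id_tensor (kraus I X K) \<rho>)"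
    if "positive_op (Z \<times> X) \<rho>" for Z :: "nat set" and \<rho>
  proof -
    have "positive_op (Z \<times> Y) (\<lambda>p p'. \<Sum>k\<in>I. id_tensor (conj_by X (K k)) \<rho> p p')"
      using that K by (intro positive_op_sum id_tensor_conj_by_positive) auto
    then show ?thesis by (simp add: id_tensor_def kraus_def split_def)
  qed
  ultimately show ?thesis
    unfolding channel_def
    using K by (auto simp: kraus_def conj_by_linear sum.distrib sum_distrib_left
        intro!: opers_sum conj_by_opers)
qed

lemma channel_opers: "channel X Y \<Phi> \<Longrightarrow> \<rho> \<in> opers X \<Longrightarrow> \<Phi> \<rho> \<in> opers Y"
  by (simp add: channel_def)

lemma channel_linear: "channel X Y \<Phi> \<Longrightarrow> \<rho> \<in> opers X \<Longrightarrow> \<sigma> \<in> opers X \<Longrightarrow>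
   \<Phi> (\<lambda>x y. c * \<rho> x y + \<sigma> x y) = (\<lambda>x y. c * \<Phi> \<rho> x y + \<Phi> \<sigma> x y)"
  by (simp add: channel_def)

lemma channel_trace: "channel X Y \<Phi> \<Longrightarrow> \<rho> \<in> opers X \<Longrightarrow> trace_on Y (\<Phi> \<rho>) = trace_on X \<rho>"
  by (simp add: channel_def)

lemma zero_opers: "(\<lambda>_ _. 0) \<in> opers X" by (simp add: opers_def)

lemma channel_zero: "channel X Y \<Phi> \<Longrightarrow> \<Phi> (\<lambda>_ _. 0) = (\<lambda>_ _. 0)"
  using channel_linear[OF _ zero_opers zero_opers, of X Y \<Phi> "- 1"] by (simp add: fun_eq_iff)

lemma channel_scale: "channel X Y \<Phi> \<Longrightarrow> \<rho> \<in> opers X \<Longrightarrow> \<Phi> (\<lambda>x y. c * \<rho> x y) = (\<lambda>x y. c * \<Phi> \<rho> x y)"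
  using channel_linear[OF _ _ zero_opers, of X Y \<Phi> \<rho> c] channel_zero[of X Y \<Phi>] by simp

lemma channel_add: "channel X Y \<Phi> \<Longrightarrow> \<rho> \<in> opers X \<Longrightarrow> \<sigma> \<in> opers X \<Longrightarrow>
   \<Phi> (\<lambda>x y. \<rho> x y + \<sigma> x y) = (\<lambda>x y. \<Phi> \<rho> x y + \<Phi> \<sigma> x y)"
  using channel_linear[of X Y \<Phi> \<rho> \<sigma> 1] by simp

lemma channel_sum:
  assumes "channel X Y \<Phi>" "\<And>k. k \<in> I \<Longrightarrow> \<rho> k \<in> opers X"
  shows "\<Phi> (\<lambda>x y. \<Sum>k\<in>I. \<rho> k x y) = (\<lambda>x y. \<Sum>k\<in>I. \<Phi> (\<rho> k) x y)"
  using assms(2)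
proof (induction I rule: infinite_finite_induct)
  case (insert k I)
  then show ?case
    using channel_add[OF assms(1), of "\<rho> k" "\<lambda>x y. \<Sum>k\<in>I. \<rho> k x y"] by (simp add: opers_sum)
qed (simp_all add: channel_zero[OF assms(1)])

lemma channel_id: "channel X X (\<lambda>\<rho>. \<rho>)"
  by (simp add: channel_def id_tensor_def split_def)

lemma channel_comp:
  assumes "channel X Y \<Phi>" "channel Y Z \<Psi>"
  shows "channel X Z (\<lambda>\<rho>. \<Psi> (\<Phi> \<rho>))"
proof -
  have "id_tensor (\<lambda>\<rho>. \<Psi> (\<Phi> \<rho>)) \<rho> = id_tensor \<Psi> (id_tensor \<Phi> \<rho>)" for \<rho> :: "(nat \<times> 'a) oper"
    by (simp add: id_tensor_def)
  then show ?thesis using assms by (simp add: channel_def)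
qed

lemma positive_op_relabel:
  assumes "positive_op X \<rho>" "bij_betw g Y X"
  shows "positive_op Y (\<lambda>y y'. if y \<in> Y \<and> y' \<in> Y then \<rho> (g y) (g y') else 0)"
proof -
  let ?\<rho> = "\<lambda>y y'. if y \<in> Y \<and> y' \<in> Y then \<rho> (g y) (g y') else 0"
  have "sesq Y ?\<rho> v v = sesq X \<rho> (\<lambda>x. v (the_inv_into Y g x)) (\<lambda>x. v (the_inv_into Y g x))" for v
    using assms(2) unfolding sesq_def
    by (subst (1 2) sum.reindex_bij_betw[OF assms(2), symmetric])
      (auto simp: the_inv_into_f_f bij_betw_def intro!: sum.cong)
  then show ?thesis using positive_opD[OF assms(1)] by (auto simp: positive_op_iff opers_def)
qed

text \<open>The definition of \<open>channel\<close> tests complete positivity only with ancillas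
  labelled by an initial segment of the naturals. A bijection carries any finite ancilla there and
  back; the decoupling argument needs an ancilla made of a reference and an environment.\<close>

lemma channel_positive_ancilla:
  assumes ch: "channel X Y \<Phi>" and pos: "positive_op (Z \<times> X) \<rho>" and fin: "finite Z"
  shows "positive_op (Z \<times> Y) (id_tensor \<Phi> \<rho>)"
proof -
  obtain g where g: "bij_betw g {..<card Z} Z"
    using fin ex_bij_betw_nat_finite[of Z] by (auto simp: atLeast0LessThan)
  obtain h where h: "bij_betw h Z {..<card Z}" "\<And>z. z \<in> Z \<Longrightarrow> g (h z) = z"
    using g by (metis bij_betw_the_inv_into f_the_inv_into_f_bij_betw)
  let ?k = "card Z"
  define \<rho>' where "\<rho>' = (\<lambda>y y'. if y \<in> {..<?k} \<times> X \<and> y' \<in> {..<?k} \<times> X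
     then \<rho> (map_prod g id y) (map_prod g id y') else 0)"
  have "positive_op ({..<?k} \<times> X) \<rho>'"
    unfolding \<rho>'_def by (rule positive_op_relabel[OF pos]) (intro bij_betw_map_prod g bij_betw_id)
  then have "positive_op ({..<?k} \<times> Y) (id_tensor \<Phi> \<rho>')" using ch by (simp add: channel_def)
  from positive_op_relabel[OF this, of "map_prod h id" "Z \<times> Y"]
  have "positive_op (Z \<times> Y) (\<lambda>y y'. if y \<in> Z \<times> Y \<and> y' \<in> Z \<times> Y
      then id_tensor \<Phi> \<rho>' (map_prod h id y) (map_prod h id y') else 0)"
    by (simp add: bij_betw_map_prod h)
  moreover have "(\<lambda>y y'. if y \<in> Z \<times> Y \<and> y' \<in> Z \<times> Y
      then id_tensor \<Phi> \<rho>' (map_prod h id y) (map_prod h id y') else 0) = id_tensor \<Phi> \<rho>"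
  proof (intro ext, clarify)
    fix z y z' y'
    have op: "(\<lambda>x x'. \<rho> (z, x) (z', x')) \<in> opers X"
      using opers_outside[OF positive_op_opers[OF pos]] by (auto intro: opersI)
    have zero: "z \<notin> Z \<or> z' \<notin> Z \<Longrightarrow> (\<lambda>x x'. \<rho> (z, x) (z', x')) = (\<lambda>_ _. 0)"
      using opers_outside[OF positive_op_opers[OF pos]] by (auto simp: fun_eq_iff)
    have eq: "(\<lambda>x x'. \<rho>' (h z, x) (h z', x')) = (\<lambda>x x'. \<rho> (z, x) (z', x'))" if "z \<in> Z" "z' \<in> Z"
    proof -
      have "h z < ?k" "h z' < ?k" using that h(1) by (auto dest: bij_betwE)
      then show ?thesis
        using that h(2) opers_outside[OF op] by (auto simp: \<rho>'_def fun_eq_iff)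
    qed
    show "(if (z, y) \<in> Z \<times> Y \<and> (z', y') \<in> Z \<times> Y
      then id_tensor \<Phi> \<rho>' (map_prod h id (z, y)) (map_prod h id (z', y')) else 0) = id_tensor \<Phi> \<rho> (z, y) (z', y')"
      using eq zero channel_zero[OF ch] opers_outside[OF channel_opers[OF ch op]]
      by (auto simp: id_tensor_def)
  qed
  ultimately show ?thesis by simp
qed

lemma channel_positive:
  assumes ch: "channel X Y \<Phi>" and pos: "positive_op X \<rho>"
  shows "positive_op Y (\<Phi> \<rho>)"
proof -
  have s: "bij_betw snd ({()} \<times> X) X" for X :: "'z set"
    by (auto simp: bij_betw_def inj_on_def)
  have p: "bij_betw (Pair ()) X ({()} \<times> X)" for X :: "'z set"
    by (auto simp: bij_betw_def inj_on_def)
  have "positive_op ({()} \<times> X) (\<lambda>p p'. \<rho> (snd p) (snd p'))"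
    using positive_op_relabel[OF pos s] opers_outside[OF positive_op_opers[OF pos]]
    by (auto simp: fun_eq_iff split: if_splits elim!: back_subst[of "positive_op _"])
  from channel_positive_ancilla[OF ch this]
  have "positive_op ({()} \<times> Y) (\<lambda>p p'. \<Phi> \<rho> (snd p) (snd p'))"
    by (simp add: id_tensor_def split_def)
  from positive_op_relabel[OF this p] show ?thesis
    using opers_outside[OF channel_opers[OF ch positive_op_opers[OF pos]]]
    by (auto simp: fun_eq_iff split: if_splits elim!: back_subst[of "positive_op _"])
qed

section \<open>Isometries, partial traces and Cholesky factorisation\<close>

lemma isometry_outside: "isometry X Y K \<Longrightarrow> y \<notin> Y \<or> x \<notin> X \<Longrightarrow> K y x = 0"
  unfolding isometry_def by blast

lemma isometry_inner: "isometry X Y K \<Longrightarrow> x \<in> X \<Longrightarrow> x' \<in> X \<Longrightarrow>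
   (\<Sum>y\<in>Y. cnj (K y x) * K y x') = (if x = x' then 1 else 0)"
  unfolding isometry_def by blast

lemma conj_by_conj_by:
  "conj_by Y K (conj_by X L \<rho>) = conj_by X (\<lambda>z x. \<Sum>y\<in>Y. K z y * L y x) \<rho>"
proof (intro ext)
  fix z z'
  have "conj_by Y K (conj_by X L \<rho>) z z'
     = (\<Sum>y\<in>Y. \<Sum>y'\<in>Y. \<Sum>x\<in>X. \<Sum>x'\<in>X. K z y * (L y x * \<rho> x x' * cnj (L y' x')) * cnj (K z' y'))"
    by (simp add: conj_by_def sum_distrib_left sum_distrib_right)
  also have "\<dots> = (\<Sum>x\<in>X. \<Sum>x'\<in>X. \<Sum>y\<in>Y. \<Sum>y'\<in>Y. K z y * (L y x * \<rho> x x' * cnj (L y' x')) * cnj (K z' y'))"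
    by (rule sum_swap_pairs)
  also have "\<dots> = conj_by X (\<lambda>z x. \<Sum>y\<in>Y. K z y * L y x) \<rho> z z'"
    by (simp add: conj_by_def cnj_sum sum_distrib_left sum_distrib_right algebra_simps)
  finally show "conj_by Y K (conj_by X L \<rho>) z z' = conj_by X (\<lambda>z x. \<Sum>y\<in>Y. K z y * L y x) \<rho> z z'" .
qed

lemma sum_delta_mult:
  fixes f :: "'a \<Rightarrow> complex"
  assumes "finite X"
  shows "(\<Sum>x\<in>X. (if a = x then c else 0) * f x) = (if a \<in> X then c * f a else 0)"
    "(\<Sum>x\<in>X. (if x = a then c else 0) * f x) = (if a \<in> X then c * f a else 0)"
    "(\<Sum>x\<in>X. f x * (if a = x then c else 0)) = (if a \<in> X then f a * c else 0)"
    "(\<Sum>x\<in>X. f x * (if x = a then c else 0)) = (if a \<in> X then f a * c else 0)"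
proof -
  have *: "(\<Sum>x\<in>X. (if a = x then c else 0) * f x) = (\<Sum>x\<in>X. if a = x then c * f x else 0)"
    "(\<Sum>x\<in>X. (if x = a then c else 0) * f x) = (\<Sum>x\<in>X. if a = x then c * f x else 0)"
    "(\<Sum>x\<in>X. f x * (if a = x then c else 0)) = (\<Sum>x\<in>X. if a = x then f x * c else 0)"
    "(\<Sum>x\<in>X. f x * (if x = a then c else 0)) = (\<Sum>x\<in>X. if a = x then f x * c else 0)"
    by (intro sum.cong; simp)+
  show "(\<Sum>x\<in>X. (if a = x then c else 0) * f x) = (if a \<in> X then c * f a else 0)"
    "(\<Sum>x\<in>X. (if x = a then c else 0) * f x) = (if a \<in> X then c * f a else 0)"
    "(\<Sum>x\<in>X. f x * (if a = x then c else 0)) = (if a \<in> X then f a * c else 0)"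
    "(\<Sum>x\<in>X. f x * (if x = a then c else 0)) = (if a \<in> X then f a * c else 0)"
    unfolding * using assms by simp_all
qed

lemma conj_by_cong:
  assumes "\<And>y x. x \<in> X \<Longrightarrow> K y x = K' y x" "\<And>x x'. x \<in> X \<Longrightarrow> x' \<in> X \<Longrightarrow> \<rho> x x' = \<rho>' x x'"
  shows "conj_by X K \<rho> = conj_by X K' \<rho>'"
  unfolding conj_by_def using assms by (intro ext sum.cong refl) simp

lemma conj_by_identity:
  assumes "finite X" "\<rho> \<in> opers X"
  shows "conj_by X (\<lambda>y x. if y = x then 1 else 0) \<rho> = \<rho>"
proof (intro ext)
  fix y y'
  have "conj_by X (\<lambda>y x. if y = x then 1 else 0) \<rho> y y'
     = (\<Sum>x\<in>X. (if y = x then 1 else 0) * (\<Sum>x'\<in>X. \<rho> x x' * (if y' = x' then 1 else 0)))"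
    unfolding conj_by_def sum_distrib_left by (intro sum.cong refl) auto
  also have "\<dots> = \<rho> y y'"
    using opers_outside[OF assms(2)] assms(1) by (simp add: sum_delta_mult)
  finally show "conj_by X (\<lambda>y x. if y = x then 1 else 0) \<rho> y y' = \<rho> y y'" .
qed

lemma isometry_adjoint_conj_by:
  assumes "isometry X Y K" "finite X" "\<sigma> \<in> opers X"
  shows "conj_by Y (\<lambda>x y. cnj (K y x)) (conj_by X K \<sigma>) = \<sigma>"
proof -
  have "conj_by Y (\<lambda>x y. cnj (K y x)) (conj_by X K \<sigma>)
     = conj_by X (\<lambda>z x. \<Sum>y\<in>Y. cnj (K y z) * K y x) \<sigma>"
    by (rule conj_by_conj_by)
  also have "\<dots> = conj_by X (\<lambda>y x. if y = x then 1 else 0) \<sigma>"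
  proof (rule conj_by_cong[OF _ refl])
    fix z x assume "x \<in> X"
    then show "(\<Sum>y\<in>Y. cnj (K y z) * K y x) = (if z = x then 1 else 0)"
      using isometry_inner[OF assms(1), of z x] isometry_outside[OF assms(1)]
      by (cases "z \<in> X") auto
  qed
  finally show ?thesis using assms by (simp add: conj_by_identity)
qed

lemma isometry_comp:
  assumes "isometry X Y L" "isometry Y Z K" "finite Y"
  shows "isometry X Z (\<lambda>z x. \<Sum>y\<in>Y. K z y * L y x)"
  unfolding isometry_def
proof (intro conjI ballI allI impI)
  fix z x assume "z \<notin> Z \<or> x \<notin> X"
  then show "(\<Sum>y\<in>Y. K z y * L y x) = 0"
    using isometry_outside[OF assms(1)] isometry_outside[OF assms(2)] by (auto intro: sum.neutral)
next
  fix x x' assume x: "x \<in> X" "x' \<in> X"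
  have "(\<Sum>z\<in>Z. cnj (\<Sum>y\<in>Y. K z y * L y x) * (\<Sum>y\<in>Y. K z y * L y x'))
     = (\<Sum>z\<in>Z. \<Sum>y\<in>Y. \<Sum>y'\<in>Y. cnj (L y x) * L y' x' * (cnj (K z y) * K z y'))"
    by (simp only: cnj_sum sum_product) (simp add: mult_ac)
  also have "\<dots> = (\<Sum>y\<in>Y. \<Sum>y'\<in>Y. \<Sum>z\<in>Z. cnj (L y x) * L y' x' * (cnj (K z y) * K z y'))"
    by (subst sum.swap, intro sum.cong refl, rule sum.swap)
  also have "\<dots> = (\<Sum>y\<in>Y. cnj (L y x) * (\<Sum>y'\<in>Y. L y' x' * (if y = y' then 1 else 0)))"
    unfolding sum_distrib_left[symmetric]
    using isometry_inner[OF assms(2)] by (simp add: sum_distrib_left mult.assoc)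
  also have "\<dots> = (\<Sum>y\<in>Y. cnj (L y x) * L y x')"
    using assms(3) by (simp add: sum_delta_mult)
  finally show "(\<Sum>z\<in>Z. cnj (\<Sum>y\<in>Y. K z y * L y x) * (\<Sum>y\<in>Y. K z y * L y x')) = (if x = x' then 1 else 0)"
    using isometry_inner[OF assms(1) x] by simp
qed

lemma channel_isometry:
  assumes "isometry X Y K" "finite X"
  shows "channel X Y (conj_by X K)"
proof -
  have "channel X Y (kraus {()} X (\<lambda>_. K))"
    using isometry_outside[OF assms(1)] isometry_inner[OF assms(1)] assms(2)
    by (intro channel_kraus) auto
  moreover have "kraus {()} X (\<lambda>_. K) = conj_by X K"
    by (simp add: kraus_def fun_eq_iff)
  ultimately show ?thesis by simp
qed

lemma sum_option: "finite Y \<Longrightarrow> (\<Sum>k\<in>insert None (Some ` Y). f k) = f None + (\<Sum>y\<in>Y. f (Some y))"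
  by (subst sum.insert) (auto simp: sum.reindex)

text \<open>The adjoint of \<open>K\<close> inverts it but loses trace off the range. The missing
  weight is restored by sending the orthogonal complement of the range to the fixed label
  \<open>x0\<close>.\<close>

lemma isometry_left_inverse:
  assumes iso: "isometry X Y K" and fin: "finite X" "finite Y" and x0: "x0 \<in> X"
  obtains R where "channel Y X R" "\<And>\<sigma>. \<sigma> \<in> opers X \<Longrightarrow> R (conj_by X K \<sigma>) = \<sigma>"
proof -
  define P where "P y y' = (\<Sum>x\<in>X. K y x * cnj (K y' x))" for y y'
  define C where "C y y' = (if y = y' then 1 else 0) - P y y'" for y y'
  have PK: "(\<Sum>y\<in>Y. P z y * K y x) = K z x" if "x \<in> X" for z x
  proof -
    have "(\<Sum>y\<in>Y. P z y * K y x) = (\<Sum>x'\<in>X. K z x' * (\<Sum>y\<in>Y. cnj (K y x') * K y x))"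
      unfolding P_def sum_distrib_right sum_distrib_left by (subst sum.swap) (simp add: mult.assoc)
    also have "\<dots> = (\<Sum>x'\<in>X. K z x' * (if x' = x then 1 else 0))"
      using isometry_inner[OF iso _ that] by simp
    finally show ?thesis using fin that by (simp add: sum_delta_mult)
  qed
  have CK: "(\<Sum>y\<in>Y. C z y * K y x) = 0" if "z \<in> Y" "x \<in> X" for z x
    using PK[OF that(2), of z] that fin by (simp add: C_def left_diff_distrib sum_subtractf sum_delta_mult)
  have PP: "(\<Sum>z\<in>Y. P y z * P z y') = P y y'" for y y'
  proof -
    have "(\<Sum>z\<in>Y. P y z * P z y') = (\<Sum>x\<in>X. (\<Sum>z\<in>Y. P y z * K z x) * cnj (K y' x))"
      unfolding P_def[of _ y'] sum_distrib_left sum_distrib_right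
      by (subst sum.swap) (simp add: mult.assoc)
    also have "\<dots> = P y y'" by (simp add: PK) (simp add: P_def)
    finally show ?thesis .
  qed
  have herm: "cnj (C z y) = C y z" for z y 
    by (cases "z = y") (simp_all add: C_def P_def cnj_sum mult.commute)
  have CC: "(\<Sum>z\<in>Y. C y z * C z y') = C y y'" if "y \<in> Y" "y' \<in> Y" for y y'
  proof -
    have "(\<Sum>z\<in>Y. C y z * C z y') = (if y = y' then 1 else 0) - P y y' - P y y' + (\<Sum>z\<in>Y. P y z * P z y')"
      using that fin
      by (simp add: C_def algebra_simps sum.distrib sum_subtractf sum_delta_mult)
    then show ?thesis by (simp add: PP C_def)
  qed
  \<comment> \<open>\<open>None\<close> gives the adjoint of \<open>K\<close>; \<open>Some z\<close>
    applies the complementary projector \<open>C\<close>, reads off \<open>z\<close> and prepares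
    \<open>x0\<close>.\<close>
  define Kr where "Kr k x y = (if x \<in> X then (case k of None \<Rightarrow> cnj (K y x)
     | Some z \<Rightarrow> if x = x0 then C z y else 0) else 0)" for k x y
  define R where "R = kraus (insert None (Some ` Y)) Y Kr"
  have "channel Y X R" unfolding R_def
  proof (rule channel_kraus[OF fin(2)])
    fix y y' assume y: "y \<in> Y" "y' \<in> Y"
    have "(\<Sum>x\<in>X. cnj (Kr (Some z) x y) * Kr (Some z) x y') = C y z * C z y'" if "z \<in> Y" for z
    proof -
      have "(\<Sum>x\<in>X. cnj (Kr (Some z) x y) * Kr (Some z) x y')
         = (\<Sum>x\<in>X. if x = x0 then C y z * C z y' else 0)"
        by (intro sum.cong) (auto simp: Kr_def herm)
      then show ?thesis using fin x0 by simp
    qed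
    moreover have "(\<Sum>x\<in>X. cnj (Kr None x y) * Kr None x y') = P y y'"
      by (simp add: Kr_def P_def)
    ultimately show "(\<Sum>k\<in>insert None (Some ` Y). \<Sum>x\<in>X. cnj (Kr k x y) * Kr k x y') = (if y = y' then 1 else 0)"
      using fin y by (simp add: sum_option CC del: insert_iff sum.insert) (simp add: C_def)
  qed (auto simp: Kr_def)
  moreover have "R (conj_by X K \<sigma>) = \<sigma>" if "\<sigma> \<in> opers X" for \<sigma>
  proof -
    have "conj_by Y (Kr (Some z)) (conj_by X K \<sigma>) = (\<lambda>_ _. 0)" if "z \<in> Y" for z
    proof -
      have "conj_by Y (Kr (Some z)) (conj_by X K \<sigma>) = conj_by X (\<lambda>_ _. 0) \<sigma>"
        unfolding conj_by_conj_by
      proof (intro conj_by_cong refl)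
        fix y x assume "x \<in> X"
        then show "(\<Sum>ya\<in>Y. Kr (Some z) y ya * K ya x) = 0"
          using CK[OF that] by (cases "y \<in> X"; cases "y = x0") (simp_all add: Kr_def)
      qed
      then show ?thesis by (simp add: conj_by_def)
    qed
    moreover have "conj_by Y (Kr None) (conj_by X K \<sigma>) = \<sigma>"
    proof -
      have "Kr None = (\<lambda>x y. cnj (K y x))"
        using isometry_outside[OF iso] by (auto simp: Kr_def fun_eq_iff)
      then show ?thesis using isometry_adjoint_conj_by[OF iso fin(1) that] by simp
    qed
    ultimately show ?thesis using fin by (simp add: R_def kraus_def sum_option fun_eq_iff del: sum.insert)
  qed
  ultimately show ?thesis using that by blast
qed

text \<open>The partial trace over \<open>C\<close> when \<open>g\<close> identifies \<open>Y \<times> C\<close> with the label set; for a singleton \<open>C\<close> it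
  merely relabels the basis.\<close>

definition ptr :: "('y \<Rightarrow> 'c \<Rightarrow> 'x) \<Rightarrow> 'y set \<Rightarrow> 'c set \<Rightarrow> 'x oper \<Rightarrow> 'y oper" where
  "ptr g Y C \<rho> = (\<lambda>y y'. if y \<in> Y \<and> y' \<in> Y then \<Sum>c\<in>C. \<rho> (g y c) (g y' c) else 0)"

lemma channel_ptr:
  assumes bij: "bij_betw (\<lambda>(y, c). g y c) (Y \<times> C) X" and fin: "finite X" "finite C"
  shows "channel X Y (ptr g Y C)"
proof -
  define K where "K c y x = (if y \<in> Y \<and> x = g y c then 1 else (0::complex))" for c y x
  have inX: "g y c \<in> X" if "y \<in> Y" "c \<in> C" for y c using bij that by (auto dest: bij_betwE)
  have "finite (Y \<times> C)" using bij fin bij_betw_finite by blast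
  have fY: "finite Y" if "C \<noteq> {}" using \<open>finite (Y \<times> C)\<close> that by (rule finite_cartesian_productD1)
  have "conj_by X (K c) \<rho> y y' = (if y \<in> Y \<and> y' \<in> Y then \<rho> (g y c) (g y' c) else 0)"
    if "c \<in> C" for c \<rho> y y'
  proof -
    have "conj_by X (K c) \<rho> y y' = (\<Sum>x\<in>X. (if x = g y c then 1 else 0) *
       (\<Sum>x'\<in>X. (if x' = g y' c then 1 else 0) * (if y \<in> Y \<and> y' \<in> Y then \<rho> x x' else 0)))"
      unfolding conj_by_def sum_distrib_left by (intro sum.cong refl) (auto simp: K_def)
    also have "\<dots> = (if y \<in> Y \<and> y' \<in> Y then \<rho> (g y c) (g y' c) else 0)"
      using fin inX[OF _ that] by (simp add: sum_delta_mult)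
    finally show ?thesis .
  qed
  then have eq: "kraus C X K = ptr g Y C"
    by (auto simp: kraus_def ptr_def fun_eq_iff)
  have "channel X Y (kraus C X K)"
  proof (rule channel_kraus[OF fin(1)])
    fix x x' assume x: "x \<in> X" "x' \<in> X"
    obtain y0 c0 where yc: "y0 \<in> Y" "c0 \<in> C" "x = g y0 c0"
      using bij x by (auto simp: bij_betw_def image_iff)
    have uniq: "x = g y c \<longleftrightarrow> y = y0 \<and> c = c0" if "y \<in> Y" "c \<in> C" for y c
      using bij that yc by (auto simp: bij_betw_def inj_on_def)
    have "(\<Sum>c\<in>C. \<Sum>y\<in>Y. cnj (K c y x) * K c y x')
       = (\<Sum>c\<in>C. (if c = c0 then 1 else 0) * (\<Sum>y\<in>Y. (if y = y0 then 1 else 0) * (if x = x' then 1 else 0)))"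
      unfolding sum_distrib_left using uniq by (intro sum.cong refl) (auto simp: K_def)
    also have "\<dots> = (if x = x' then 1 else 0)"
      using fin fY[OF ex_in_conv[THEN iffD1, OF exI, OF yc(2)]] yc by (simp add: sum_delta_mult)
    finally show "(\<Sum>c\<in>C. \<Sum>y\<in>Y. cnj (K c y x) * K c y x') = (if x = x' then 1 else 0)" .
  qed (auto simp: K_def)
  then show ?thesis by (simp add: eq)
qed

lemma bij_betw_override_on:
  assumes "S \<inter> R = {}"
  shows "bij_betw (\<lambda>(f, h). override_on h f S) (PiE S L \<times> PiE R L) (PiE (S \<union> R) L)"
proof (rule bij_betwI[where g = "\<lambda>b. (restrict b S, restrict b R)"])
  show "(\<lambda>(f, h). override_on h f S) \<in> PiE S L \<times> PiE R L \<rightarrow> PiE (S \<union> R) L"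
    by (auto simp: override_on_def PiE_iff extensional_def)
  show "(\<lambda>b. (restrict b S, restrict b R)) \<in> PiE (S \<union> R) L \<rightarrow> PiE S L \<times> PiE R L"
    by (auto simp: PiE_iff)
next
  fix p assume "p \<in> PiE S L \<times> PiE R L"
  then show "(restrict (case p of (f, h) \<Rightarrow> override_on h f S) S,
      restrict (case p of (f, h) \<Rightarrow> override_on h f S) R) = p"
    using assms by (auto simp: override_on_def PiE_iff extensional_def fun_eq_iff)
next
  fix b assume "b \<in> PiE (S \<union> R) L"
  then show "(case (restrict b S, restrict b R) of (f, h) \<Rightarrow> override_on h f S) = b"
    by (auto simp: override_on_def PiE_iff extensional_def fun_eq_iff)
qed

lemma sum_PiE_split:
  assumes "S \<inter> R = {}"
  shows "(\<Sum>b\<in>PiE (S \<union> R) L. F b) = (\<Sum>f\<in>PiE S L. \<Sum>h\<in>PiE R L. F (override_on h f S))"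
  unfolding sum.cartesian_product
  by (subst sum.reindex_bij_betw[OF bij_betw_override_on[OF assms], symmetric]) (simp add: split_def)

lemma sum_PiE_UNIV_split:
  "(\<Sum>b\<in>PiE UNIV L. F b) = (\<Sum>f\<in>PiE S L. \<Sum>h\<in>PiE (- S) L. F (override_on h f S))"
  using sum_PiE_split[of S "- S" F L] by simp

lemma finite_PiE_type: "(\<And>p. finite (L p)) \<Longrightarrow> finite (PiE (S :: 'p::finite set) L)"
  by (rule finite_PiE) auto

lemma reduce_eq_ptr: "reduce L S = ptr (\<lambda>f h. override_on h f S) (PiE S L) (PiE (- S) L)"
  by (simp add: reduce_def ptr_def fun_eq_iff)

lemma channel_reduce:
  fixes L :: "'p::finite \<Rightarrow> 'l set"
  assumes "\<And>p. finite (L p)"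
  shows "channel (PiE UNIV L) (PiE S L) (reduce L S)"
  unfolding reduce_eq_ptr
  using bij_betw_override_on[of S "- S" L] assms
  by (intro channel_ptr finite_PiE_type) auto

lemma reduce_opers: "reduce L S \<rho> \<in> opers (PiE S L)"
  by (auto simp: reduce_def opers_def)

text \<open>Cholesky factorisation: eliminating one pivot at a time makes the columns independent, so
  that the factor comes with a left inverse.\<close>

lemma positive_op_factor:
  assumes "finite X" "positive_op X M"
  shows "\<exists>n (\<psi> :: nat \<Rightarrow> 'x ket) L. (\<forall>k<n. \<psi> k \<in> kets X) \<and>
     M = (\<lambda>x y. \<Sum>k<n. \<psi> k x * cnj (\<psi> k y)) \<and>
     (\<forall>k<n. \<forall>l<n. (\<Sum>x\<in>X. L k x * \<psi> l x) = (if k = l then 1 else 0))"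
  using assms
proof (induction X arbitrary: M rule: finite_induct)
  case empty
  then have "M = (\<lambda>_ _. 0)" by (auto simp: positive_op_iff opers_def)
  then show ?case by (intro exI[of _ 0]) simp
next
  case (insert x X)
  note pos = insert.prems and finX = insert.hyps(1) and xX = insert.hyps(2)
  have fin: "finite (insert x X)" using finX by simp
  have out: "M y z = 0" if "y \<notin> insert x X \<or> z \<notin> insert x X" for y z
    using opers_outside[OF positive_op_opers[OF pos] that] .
  have herm: "cnj (M y z) = M z y" for y z
    by (simp add: positive_op_hermitian[OF fin pos, of z y])
  define r where "r = Re (M x x)"
  have r: "M x x = of_real r" "0 \<le> r"
    using positive_op_diag[OF fin pos, of x] by (auto simp: r_def complex_nonneg_Reals_iff complex_eq_iff)
  define u where "u y = M y x / of_real (sqrt r)" for y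
  \<comment> \<open>The Schur complement of the pivot \<open>x\<close>: subtracting the rank-one
    part \<open>u\<close> clears row and column \<open>x\<close>.\<close>
  define M' where "M' y z = M y z - u y * cnj (u z)" for y z
  have uu: "u y * cnj (u z) = M y x * M x z / M x x" for y z
  proof -
    have "of_real (sqrt r) * of_real (sqrt r) = (M x x)"
      unfolding r(1) of_real_mult[symmetric] using r(2) by simp
    then show ?thesis by (simp add: u_def herm)
  qed
  have row: "M y x = 0" "M x y = 0" if "M x x = 0" for y
    using positive_op_zero_diag[OF fin pos that] by auto
  have M'x: "M' x y = 0 \<and> M' y x = 0" for y
  proof (cases "M x x = 0")
    case True
    then show ?thesis using row[OF True, of y] by (simp add: M'_def uu)
  qed (simp add: M'_def uu)
  have "positive_op X M'"
    unfolding positive_op_iff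
  proof (intro conjI allI)
    show "M' \<in> opers X"
    proof (rule opersI)
      fix y z assume "y \<notin> X \<or> z \<notin> X"
      then show "M' y z = 0" using M'x out by (cases "y = x"; cases "z = x") (auto simp: M'_def uu)
    qed
    fix v
    define s where "s = (\<Sum>z\<in>X. M x z * v z)"
    \<comment> \<open>The value at the pivot completes the square: entry \<open>x\<close> of
      \<open>M\<close> applied to \<open>w\<close> vanishes, and the form of \<open>M\<close> at
      \<open>w\<close> becomes that of \<open>M'\<close> at \<open>v\<close>. For a zero pivot the
      quotient is 0, and the row of the pivot is zero anyway.\<close>
    define w where "w y = (if y = x then - s / M x x else v y)" for y
    have sum_w: "(\<Sum>y\<in>insert x X. f y * w y) = f x * w x + (\<Sum>y\<in>X. f y * v y)" for f
      using finX xX by (simp add: w_def) (intro sum.cong, auto)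
    have "sesq (insert x X) M w w = (\<Sum>y\<in>insert x X. cnj (w y) * (M y x * w x + (\<Sum>z\<in>X. M y z * v z)))"
      unfolding sesq_def by (simp only: mult.assoc sum_distrib_left[symmetric] sum_w)
    also have "\<dots> = (\<Sum>y\<in>X. cnj (v y) * (M y x * w x + (\<Sum>z\<in>X. M y z * v z)))"
    proof -
      have "M x x * w x + s = 0"
      proof (cases "M x x = 0")
        case True
        then show ?thesis using row(2)[OF True] by (simp add: s_def)
      qed (simp add: w_def)
      moreover have "(\<Sum>y\<in>X. cnj (w y) * g y) = (\<Sum>y\<in>X. cnj (v y) * g y)" for g
        using xX by (intro sum.cong) (auto simp: w_def)
      ultimately show ?thesis using finX xX by (simp add: s_def)
    qed
    also have "\<dots> = (\<Sum>y\<in>X. cnj (v y) * (\<Sum>z\<in>X. M' y z * v z))"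
    proof (intro sum.cong refl arg_cong2[where f = times])
      fix y
      have "(\<Sum>z\<in>X. M' y z * v z) = (\<Sum>z\<in>X. M y z * v z) - M y x / M x x * s"
        by (simp add: M'_def uu s_def left_diff_distrib sum_subtractf sum_distrib_left algebra_simps)
      then show "M y x * w x + (\<Sum>z\<in>X. M y z * v z) = (\<Sum>z\<in>X. M' y z * v z)"
        by (simp add: w_def)
    qed
    also have "\<dots> = sesq X M' v v" by (simp add: sesq_def sum_distrib_left mult.assoc)
    finally show "sesq X M' v v \<in> \<real>\<^sub>\<ge>\<^sub>0" using positive_opD[OF pos, of w] by simp
  qed
  from insert.IH[OF this] obtain n :: nat and \<psi> L where IH': "\<forall>k<n. \<psi> k \<in> kets X"
    "M' = (\<lambda>x y. \<Sum>k<n. \<psi> k x * cnj (\<psi> k y))"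
    "\<forall>k<n. \<forall>l<n. (\<Sum>x\<in>X. L k x * \<psi> l x) = (if k = l then 1 else 0)"
    by (elim exE conjE) (rule that)
  note IH = IH'(1)[rule_format] IH'(2) IH'(3)[rule_format]
  have \<psi>x: "\<psi> k x = 0" if "k < n" for k using IH(1)[OF that] xX by (simp add: kets_def)
  show ?case
  proof (cases "M x x = 0")
    case True
    then have "M = M'" by (simp add: M'_def uu fun_eq_iff)
    moreover have "\<psi> k \<in> kets (insert x X)" if "k < n" for k
      using IH(1)[OF that] by (simp add: kets_def)
    ultimately show ?thesis using IH \<psi>x finX xX
      by (intro exI[of _ n] exI[of _ \<psi>] exI[of _ L]) simp
  next
    case False
    then have "r \<noteq> 0" using r by auto
    then have ux: "u x \<noteq> 0" using False r(2) by (simp add: u_def)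
    define \<psi>' where "\<psi>' k = (if k = n then u else \<psi> k)" for k
    \<comment> \<open>The new dual vector reads the pivot coordinate, where the old columns vanish;
      the old dual vectors are corrected there so as to annihilate \<open>u\<close>.\<close>
    define L' where "L' k y = (if k = n then (if y = x then 1 / u x else 0)
       else if y = x then - (\<Sum>z\<in>X. L k z * u z) / u x else L k y)" for k y
    have "\<psi>' k \<in> kets (insert x X)" if "k < Suc n" for k
      using that IH(1)[of k] out by (auto simp: \<psi>'_def u_def kets_def less_Suc_eq)
    moreover have "M = (\<lambda>y z. \<Sum>k<Suc n. \<psi>' k y * cnj (\<psi>' k z))"
    proof (intro ext)
      fix y z
      have "(\<Sum>k<n. \<psi>' k y * cnj (\<psi>' k z)) = M' y z" by (simp add: IH(2) \<psi>'_def)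
      then show "M y z = (\<Sum>k<Suc n. \<psi>' k y * cnj (\<psi>' k z))" by (simp add: \<psi>'_def M'_def)
    qed
    moreover have "(\<Sum>y\<in>insert x X. L' k y * \<psi>' l y) = (if k = l then 1 else 0)"
      if kl: "k < Suc n" "l < Suc n" for k l
    proof -
      have s: "(\<Sum>y\<in>insert x X. L' k y * \<psi>' l y) = L' k x * \<psi>' l x +
         (\<Sum>y\<in>X. (if k = n then 0 else L k y) * \<psi>' l y)"
        using finX xX by (simp, intro sum.cong) (auto simp: L'_def)
      show ?thesis
        using kl ux \<psi>x IH(3)
        unfolding s by (cases "k = n"; cases "l = n") (auto simp: L'_def \<psi>'_def)
    qed
    ultimately show ?thesis by blast
  qed
qed

section \<open>Decoupling\<close>

definition unit_op :: "'q \<Rightarrow> 'q \<Rightarrow> 'q oper" where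
  "unit_op r r' = (\<lambda>x x'. if x = r \<and> x' = r' then 1 else 0)"

lemma unit_op_opers: "r \<in> Q \<Longrightarrow> r' \<in> Q \<Longrightarrow> unit_op r r' \<in> opers Q"
  by (auto simp: unit_op_def opers_def)

lemma conj_by_unit_op:
  assumes "finite Q" "r \<in> Q" "r' \<in> Q"
  shows "conj_by Q K (unit_op r r') y y' = K y r * cnj (K y' r')"
proof -
  have "conj_by Q K (unit_op r r') y y'
     = (\<Sum>x\<in>Q. (if x = r then 1 else 0) * (\<Sum>x'\<in>Q. (if x' = r' then 1 else 0) * (K y x * cnj (K y' x'))))"
    unfolding conj_by_def sum_distrib_left by (intro sum.cong refl) (auto simp: unit_op_def)
  then show ?thesis using assms by (simp add: sum_delta_mult)
qed

text \<open>The Knill-Laflamme condition for the erasure of \<open>C\<close>: the code \<open>J\<close>, with its output split into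
  \<open>S\<close> and \<open>C\<close>, maps \<open>|m\<rangle>\<langle>m'|\<close> to an operator whose reduction to \<open>C\<close> is \<open>\<omega>\<close> or \<open>0\<close>.\<close>

definition decoupled ::
  "'s set \<Rightarrow> 'c set \<Rightarrow> 'q set \<Rightarrow> ('s \<Rightarrow> 'c \<Rightarrow> 'q \<Rightarrow> complex) \<Rightarrow> ('c \<Rightarrow> 'c \<Rightarrow> complex) \<Rightarrow> bool" where
  "decoupled S C Q J \<omega> \<longleftrightarrow> (\<forall>c\<in>C. \<forall>c'\<in>C. \<forall>m\<in>Q. \<forall>m'\<in>Q.
     (\<Sum>s\<in>S. J s c m * cnj (J s c' m')) = (if m = m' then \<omega> c c' else 0))"

lemma decoupledD: "decoupled S C Q J \<omega> \<Longrightarrow> c \<in> C \<Longrightarrow> c' \<in> C \<Longrightarrow> m \<in> Q \<Longrightarrow> m' \<in> Q \<Longrightarrow>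
   (\<Sum>s\<in>S. J s c m * cnj (J s c' m')) = (if m = m' then \<omega> c c' else 0)"
  by (simp add: decoupled_def)

definition reduced_op ::
  "'s set \<Rightarrow> 'c set \<Rightarrow> 'q set \<Rightarrow> ('s \<Rightarrow> 'c \<Rightarrow> 'q \<Rightarrow> complex) \<Rightarrow> 'q oper \<Rightarrow> 's oper" where
  "reduced_op S C Q J \<sigma> = (\<lambda>s s'. if s \<in> S \<and> s' \<in> S
     then \<Sum>c\<in>C. conj_by Q (\<lambda>s m. J s c m) \<sigma> s s' else 0)"

lemma reduced_op_opers: "reduced_op S C Q J \<sigma> \<in> opers S"
  by (auto simp: reduced_op_def opers_def)

text \<open>The decoder is applied to one half of an encoded maximally entangled state. The reference
  system and the decoded secret are then again in a pure state, so the environment \<open>C\<close> factors out.\<close>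

theorem decoder_imp_decoupled:
  fixes S :: "'s set" and C :: "'c set" and Q :: "'q set"
  assumes fin: "finite S" "finite C" "finite Q" and q0: "q0 \<in> Q" and ch: "channel S Q D"
    and dec: "\<And>r r'. r \<in> Q \<Longrightarrow> r' \<in> Q \<Longrightarrow> D (reduced_op S C Q J (unit_op r r')) = unit_op r r'"
  shows "\<exists>\<omega>. decoupled S C Q J \<omega>"
proof -
  \<comment> \<open>The encoded maximally entangled state, left unnormalised. The reference
    \<open>r\<close> and the environment \<open>c\<close> together form the ancilla of the
    decoder.\<close>
  define \<eta> where "\<eta> = (\<lambda>((r, c), s). if r \<in> Q \<and> c \<in> C \<and> s \<in> S then J s c r else 0)"
  let ?P = "(Q \<times> C) \<times> Q"
  define T where "T = id_tensor D (ket_bra \<eta>)"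
  define B where "B r c r' c' = (\<lambda>s s'. \<eta> ((r, c), s) * cnj (\<eta> ((r', c'), s')))" for r c r' c'
  have finP: "finite ?P" using fin by simp
  have "\<eta> \<in> kets ((Q \<times> C) \<times> S)" by (auto simp: \<eta>_def kets_def)
  then have pos: "positive_op ?P T"
    unfolding T_def using fin
    by (intro channel_positive_ancilla[OF ch] ket_bra_positive) auto
  have TB: "T ((r, c), x) ((r', c'), x') = D (B r c r' c') x x'" for r c x r' c' x'
    by (simp add: T_def id_tensor_def ket_bra_def B_def)
  have B: "B r c r' c' \<in> opers S" for r c r' c'
    by (auto simp: B_def \<eta>_def opers_def)
  have sumT: "(\<Sum>c\<in>C. T ((r, c), x) ((r', c), x')) = unit_op r r' x x'" if "r \<in> Q" "r' \<in> Q" for r r' x x'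
  proof -
    have "(\<lambda>s s'. \<Sum>c\<in>C. B r c r' c s s') = reduced_op S C Q J (unit_op r r')"
      using that fin by (auto simp: B_def \<eta>_def reduced_op_def conj_by_unit_op fun_eq_iff intro!: sum.cong)
    then have "(\<lambda>x x'. \<Sum>c\<in>C. D (B r c r' c) x x') = unit_op r r'"
      using channel_sum[OF ch, of C "\<lambda>c. B r c r' c"] B dec[OF that]
      by simp
    then show ?thesis by (simp add: TB fun_eq_iff)
  qed
  \<comment> \<open>Summed over \<open>c\<close>, the diagonal entries with
    \<open>r \<noteq> x\<close> give 0, since reference and decoded secret agree. Being nonnegative,
    each of them is 0, and with it its whole row and column.\<close>
  have offdiag: "T p ((r, c), x) = 0 \<and> T ((r, c), x) p = 0"
    if "r \<in> Q" "c \<in> C" "r \<noteq> x" for p r c x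
  proof -
    have "T ((r, c), x) ((r, c), x) = 0"
      by (rule nonneg_Reals_sum_0[where f = "\<lambda>c. T ((r, c), x) ((r, c), x)", OF fin(2) _ _ that(2)])
        (use that sumT[of r r x x] positive_op_diag[OF finP pos] in \<open>auto simp: unit_op_def\<close>)
    then show ?thesis using positive_op_zero_diag[OF finP pos] by blast
  qed
  have col: "T p ((r, c), r) = T p ((q0, c), q0)" if "r \<in> Q" "c \<in> C" for p r c
  proof (cases "r = q0")
    case False
    \<comment> \<open>The difference of two agreeing basis kets lies in the kernel of the maximally
      entangled projector: summed over \<open>c\<close> the form is 1 - 1 - 1 + 1, hence it is 0 for
      each \<open>c\<close>.\<close>
    define w where "w c = (\<lambda>p. - 1 * basis_ket ((q0, c), q0) p + basis_ket ((r, c), r) p)" for c :: 'c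
    have val: "sesq ?P T (w c) (w c) = T ((r, c), r) ((r, c), r) - T ((r, c), r) ((q0, c), q0)
        - T ((q0, c), q0) ((r, c), r) + T ((q0, c), q0) ((q0, c), q0)" if "c \<in> C" for c
      unfolding w_def sesq_add_left sesq_add_right using finP that q0 \<open>r \<in> Q\<close>
      by (simp add: sesq_basis_basis)
    have "sesq ?P T (w c) (w c) = 0"
    proof (rule nonneg_Reals_sum_0[where f = "\<lambda>c. sesq ?P T (w c) (w c)", OF fin(2) _ _ that(2)])
      show "(\<Sum>c\<in>C. sesq ?P T (w c) (w c)) = 0"
        using sumT q0 that by (simp add: val sum.distrib sum_subtractf unit_op_def)
    qed (rule positive_opD[OF pos])
    from positive_op_null_column[OF finP pos this]
    have "(\<Sum>y\<in>?P. T p y * w c y) = 0" .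
    then have "- (\<Sum>y\<in>?P. T p y * basis_ket ((q0, c), q0) y) + (\<Sum>y\<in>?P. T p y * basis_ket ((r, c), r) y) = 0"
      by (simp add: w_def algebra_simps sum_subtractf)
    then show ?thesis using finP that q0 by (simp add: sum_basis_ket)
  qed simp
  have row: "T ((r, c), r) p = T ((q0, c), q0) p" if "r \<in> Q" "c \<in> C" for p r c
    using col[OF that, of p] positive_op_hermitian[OF finP pos] by metis
  define \<omega> where "\<omega> c c' = T ((q0, c), q0) ((q0, c'), q0)" for c c'
  have "decoupled S C Q J \<omega>"
    unfolding decoupled_def
  proof (intro ballI)
    fix c c' m m' assume c: "c \<in> C" "c' \<in> C" and m: "m \<in> Q" "m' \<in> Q"
    have "(\<Sum>s\<in>S. J s c m * cnj (J s c' m')) = trace_on S (B m c m' c')"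
      using c m by (simp add: trace_on_def B_def \<eta>_def)
    also have "\<dots> = trace_on Q (D (B m c m' c'))" by (rule channel_trace[OF ch B, symmetric])
    also have "\<dots> = (\<Sum>x\<in>Q. T ((m, c), x) ((m', c'), x))" by (simp add: trace_on_def TB)
    also have "\<dots> = (\<Sum>x\<in>Q. if x = m then (if m = m' then \<omega> c c' else 0) else 0)"
    proof (rule sum.cong[OF refl])
      fix x assume "x \<in> Q"
      have "T ((m, c), x) ((m', c'), x) = \<omega> c c'" if "x = m" "m = m'"
        using that row[OF m(1) c(1)] col[OF m(1) c(2)] by (simp add: \<omega>_def)
      then show "T ((m, c), x) ((m', c'), x) = (if x = m then (if m = m' then \<omega> c c' else 0) else 0)"
        using offdiag[OF m(1) c(1), of x] offdiag[OF m(2) c(2), of x] by auto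
    qed
    finally show "(\<Sum>s\<in>S. J s c m * cnj (J s c' m')) = (if m = m' then \<omega> c c' else 0)"
      using fin m by simp
  qed
  then show ?thesis by blast
qed

text \<open>Two purifications of the same reduced state on \<open>C\<close> differ by an isometry on
  \<open>S\<close>. The Cholesky factor is a purification with independent columns, so this isometry
  can be written down directly, by applying the left inverse \<open>L\<close> to the environment
  index of \<open>J\<close>.\<close>

theorem decoupled_imp_factor:
  fixes S :: "'s set" and C :: "'c set" and Q :: "'q set"
  assumes fin: "finite S" "finite C" "finite Q" and q0: "q0 \<in> Q" and dec: "decoupled S C Q J \<omega>"
    and norm: "(\<Sum>s\<in>S. \<Sum>c\<in>C. J s c q0 * cnj (J s c q0)) = 1"
  obtains n :: nat and \<psi> U where "isometry ({..<n} \<times> Q) S U"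
    "\<And>s c m. s \<in> S \<Longrightarrow> c \<in> C \<Longrightarrow> m \<in> Q \<Longrightarrow> J s c m = (\<Sum>x<n. \<psi> (c, x) * U s (x, m))"
    "(\<Sum>c\<in>C. \<Sum>x<n. \<psi> (c, x) * cnj (\<psi> (c, x))) = 1" "\<psi> \<in> kets (C \<times> {..<n})"
proof -
  define \<omega>' where "\<omega>' = (\<lambda>c c'. \<Sum>s\<in>S. ket_bra (\<lambda>c. if c \<in> C then J s c q0 else 0) c c')"
  have \<omega>': "\<omega>' c c' = \<omega> c c'" if "c \<in> C" "c' \<in> C" for c c'
    using decoupledD[OF dec that q0 q0] that by (simp add: \<omega>'_def ket_bra_def)
  have "positive_op C \<omega>'"
    unfolding \<omega>'_def by (intro positive_op_sum ket_bra_positive) (simp add: kets_def)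
  from positive_op_factor[OF fin(2) this] obtain n \<phi> L where
    \<phi>: "\<forall>k<(n::nat). \<phi> k \<in> kets C" and fact: "\<omega>' = (\<lambda>x y. \<Sum>k<n. \<phi> k x * cnj (\<phi> k y))"
    and left: "\<forall>k<n. \<forall>l<n. (\<Sum>x\<in>C. L k x * \<phi> l x) = (if k = l then 1 else 0)"
    by (elim exE conjE) (rule that)
  \<comment> \<open>Decoupling fixes all inner products of the vectors \<open>J s c m\<close> in the
    variable \<open>s\<close>: those of the factor within one \<open>m\<close>, and 0 across
    different ones. This extends to linear combinations over \<open>c\<close>.\<close>
  have gram: "(\<Sum>s\<in>S. (\<Sum>c\<in>C. a c * J s c m) * cnj (\<Sum>c\<in>C. b c * J s c m'))
     = (if m = m' then \<Sum>k<n. (\<Sum>c\<in>C. a c * \<phi> k c) * cnj (\<Sum>c\<in>C. b c * \<phi> k c) else 0)"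
    if m: "m \<in> Q" "m' \<in> Q" for a b m m'
  proof -
    have "(\<Sum>s\<in>S. (\<Sum>c\<in>C. a c * J s c m) * cnj (\<Sum>c\<in>C. b c * J s c m'))
       = (\<Sum>s\<in>S. \<Sum>c\<in>C. \<Sum>c'\<in>C. a c * cnj (b c') * (J s c m * cnj (J s c' m')))"
      by (simp only: cnj_sum sum_product) (simp add: mult_ac)
    also have "\<dots> = (\<Sum>c\<in>C. \<Sum>c'\<in>C. a c * cnj (b c') * (\<Sum>s\<in>S. J s c m * cnj (J s c' m')))"
      unfolding sum_distrib_left by (subst sum.swap, intro sum.cong refl, rule sum.swap)
    also have "\<dots> = (\<Sum>c\<in>C. \<Sum>c'\<in>C. a c * cnj (b c') * (if m = m' then \<omega>' c c' else 0))"
      by (intro sum.cong refl) (simp add: decoupledD[OF dec _ _ m] \<omega>')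
    also have "\<dots> = (if m = m' then \<Sum>c\<in>C. \<Sum>c'\<in>C. \<Sum>k<n. (a c * \<phi> k c) * cnj (b c' * \<phi> k c') else 0)"
      by (simp add: fact sum_distrib_left mult_ac)
    also have "(\<Sum>c\<in>C. \<Sum>c'\<in>C. \<Sum>k<n. (a c * \<phi> k c) * cnj (b c' * \<phi> k c'))
       = (\<Sum>k<n. (\<Sum>c\<in>C. a c * \<phi> k c) * cnj (\<Sum>c\<in>C. b c * \<phi> k c))"
      unfolding cnj_sum sum_product
      by (rule sym, subst sum.swap, intro sum.cong refl, rule sum.swap)
    finally show ?thesis .
  qed
  define \<psi> where "\<psi> = (\<lambda>(c, x). if c \<in> C \<and> x < n then \<phi> x c else 0)"
  define U where "U = (\<lambda>s (x, m). if s \<in> S \<and> x < n \<and> m \<in> Q then \<Sum>c\<in>C. L x c * J s c m else 0)"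
  have "isometry ({..<n} \<times> Q) S U"
    unfolding isometry_def
  proof (intro conjI allI impI ballI)
    fix y x assume "y \<notin> S \<or> x \<notin> {..<n} \<times> Q"
    then show "U y x = 0" by (auto simp: U_def split: prod.splits)
  next
    fix p p' assume p: "p \<in> {..<n} \<times> Q" "p' \<in> {..<n} \<times> Q"
    obtain x m x' m' where [simp]: "p = (x, m)" "p' = (x', m')" by (cases p, cases p')
    have "(\<Sum>s\<in>S. cnj (U s p) * U s p')
       = (\<Sum>s\<in>S. (\<Sum>c\<in>C. L x' c * J s c m') * cnj (\<Sum>c\<in>C. L x c * J s c m))"
      using p by (simp add: U_def mult.commute)
    also have "\<dots> = (if m' = m then \<Sum>k<n. (\<Sum>c\<in>C. L x' c * \<phi> k c) * cnj (\<Sum>c\<in>C. L x c * \<phi> k c) else 0)"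
      using p by (intro gram) auto
    also have "\<dots> = (if m' = m then \<Sum>k<n. (if x' = k then 1 else 0) * (if x = k then 1 else 0) else 0)"
      using p left by (auto intro!: sum.cong)
    also have "\<dots> = (if p = p' then 1 else 0)" using p by (simp add: sum_delta_mult)
    finally show "(\<Sum>s\<in>S. cnj (U s p) * U s p') = (if p = p' then 1 else 0)" .
  qed
  moreover have "J s c m = (\<Sum>x<n. \<psi> (c, x) * U s (x, m))" if s: "s \<in> S" and c: "c \<in> C" and m: "m \<in> Q" for s c m
  proof -
    \<comment> \<open>Row \<open>c\<close> of the identity minus the factor times its left inverse.
      It annihilates every \<phi> \<open>k\<close>, so \<open>gram\<close> with both coefficient
      vectors equal to \<open>A\<close> yields norm 0.\<close>
    define A where "A c' = (if c = c' then 1 else 0) - (\<Sum>x<n. \<phi> x c * L x c')" for c'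
    have A\<phi>: "(\<Sum>c'\<in>C. A c' * \<phi> k c') = 0" if "k < n" for k
    proof -
      have "(\<Sum>c'\<in>C. A c' * \<phi> k c') = \<phi> k c - (\<Sum>x<n. \<phi> x c * (\<Sum>c'\<in>C. L x c' * \<phi> k c'))"
        unfolding A_def left_diff_distrib sum_subtractf sum_distrib_left sum_distrib_right
        using fin c by (subst sum.swap) (simp add: sum_delta_mult mult.assoc)
      also have "\<dots> = \<phi> k c - (\<Sum>x<n. \<phi> x c * (if x = k then 1 else 0))"
        using left that by simp
      finally show ?thesis using that by (simp add: sum_delta_mult)
    qed
    have AJ: "(\<Sum>c'\<in>C. A c' * J s c' m) = J s c m - (\<Sum>x<n. \<psi> (c, x) * U s (x, m))" if "s \<in> S" for s
      unfolding A_def left_diff_distrib sum_subtractf sum_distrib_left sum_distrib_right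
      using fin c that m
      by (subst sum.swap) (simp add: sum_delta_mult mult.assoc \<psi>_def U_def sum_distrib_left)
    have "(\<Sum>s\<in>S. (\<Sum>c'\<in>C. A c' * J s c' m) * cnj (\<Sum>c'\<in>C. A c' * J s c' m)) = 0"
      using gram[OF m m, of A A] A\<phi> by simp
    then have "(\<Sum>c'\<in>C. A c' * J s c' m) * cnj (\<Sum>c'\<in>C. A c' * J s c' m) = 0"
      by (rule nonneg_Reals_sum_0[OF fin(1) _ _ s, rotated]) (rule cnj_mult_self_nonneg)
    then have "(\<Sum>c'\<in>C. A c' * J s c' m) = 0" by (simp only: mult_eq_0_iff complex_cnj_zero_iff simp_thms)
    then show ?thesis using AJ[OF s] by simp
  qed
  moreover have "(\<Sum>c\<in>C. \<Sum>x<n. \<psi> (c, x) * cnj (\<psi> (c, x))) = 1"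
  proof -
    have "(\<Sum>c\<in>C. \<Sum>x<n. \<psi> (c, x) * cnj (\<psi> (c, x))) = (\<Sum>c\<in>C. \<omega>' c c)"
      by (simp add: \<psi>_def fact)
    also have "\<dots> = (\<Sum>c\<in>C. \<Sum>s\<in>S. J s c q0 * cnj (J s c q0))"
      by (simp add: \<omega>'_def ket_bra_def)
    finally show ?thesis using norm by (subst (asm) sum.swap) simp
  qed
  moreover have "\<psi> \<in> kets (C \<times> {..<n})" by (auto simp: \<psi>_def kets_def)
  ultimately show ?thesis using that by blast
qed

text \<open>Undoing \<open>U\<close> leaves the secret in a product with a fixed state, the reduced
  state of \<psi>, which is traced out. The normalisation gives that state trace one and also
  excludes \<open>n = 0\<close>, so that the inverse of \<open>U\<close> has a nonempty
  target.\<close>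

theorem decoupled_imp_decoder:
  fixes S :: "'s set" and C :: "'c set" and Q :: "'q set"
  assumes fin: "finite S" "finite C" "finite Q" and q0: "q0 \<in> Q" and dec: "decoupled S C Q J \<omega>"
    and norm: "(\<Sum>s\<in>S. \<Sum>c\<in>C. J s c q0 * cnj (J s c q0)) = 1"
  obtains D where "channel S Q D" "\<And>\<sigma>. \<sigma> \<in> opers Q \<Longrightarrow> D (reduced_op S C Q J \<sigma>) = \<sigma>"
proof -
  obtain n :: nat and \<psi> U where U: "isometry ({..<n} \<times> Q) S U"
    and J: "\<And>s c m. s \<in> S \<Longrightarrow> c \<in> C \<Longrightarrow> m \<in> Q \<Longrightarrow> J s c m = (\<Sum>x<n. \<psi> (c, x) * U s (x, m))"
    and \<psi>: "(\<Sum>c\<in>C. \<Sum>x<n. \<psi> (c, x) * cnj (\<psi> (c, x))) = 1"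
    using assms by (rule decoupled_imp_factor) (rule that)
  have "n \<noteq> 0" using \<psi> by (intro notI) simp
  then obtain R where R: "channel S ({..<n} \<times> Q) R"
    "\<And>\<sigma>. \<sigma> \<in> opers ({..<n} \<times> Q) \<Longrightarrow> R (conj_by ({..<n} \<times> Q) U \<sigma>) = \<sigma>"
    using isometry_left_inverse[OF U _ _, of "(0, q0)"] fin q0 by auto
  define \<theta> where "\<theta> \<sigma> = (\<lambda>(x, m) (x', m'). if x < n \<and> x' < n
     then (\<Sum>c\<in>C. \<psi> (c, x) * cnj (\<psi> (c, x'))) * \<sigma> m m' else 0)" for \<sigma> :: "'q oper"
  let ?T = "ptr (\<lambda>m x. (x, m)) Q {..<n}"
  have "channel ({..<n} \<times> Q) Q ?T"
    using fin by (intro channel_ptr) (auto simp: bij_betw_def inj_on_def)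
  note ch = channel_comp[OF R(1) this]
  moreover have "?T (R (reduced_op S C Q J \<sigma>)) = \<sigma>" if \<sigma>: "\<sigma> \<in> opers Q" for \<sigma>
  proof -
    have \<theta>: "\<theta> \<sigma> \<in> opers ({..<n} \<times> Q)"
      using opers_outside[OF \<sigma>] by (auto simp: \<theta>_def opers_def)
    have "reduced_op S C Q J \<sigma> = conj_by ({..<n} \<times> Q) U (\<theta> \<sigma>)"
    proof (intro ext)
      fix s s'
      show "reduced_op S C Q J \<sigma> s s' = conj_by ({..<n} \<times> Q) U (\<theta> \<sigma>) s s'"
      proof (cases "s \<in> S \<and> s' \<in> S")
        case True
        have "reduced_op S C Q J \<sigma> s s' = (\<Sum>c\<in>C. \<Sum>m\<in>Q. \<Sum>m'\<in>Q. \<Sum>x<n. \<Sum>x'<n.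
            \<sigma> m m' * ((\<psi> (c, x) * U s (x, m)) * cnj (\<psi> (c, x') * U s' (x', m'))))"
        proof -
          have "J s c m * \<sigma> m m' * cnj (J s' c m') = (\<Sum>x<n. \<Sum>x'<n.
              \<sigma> m m' * ((\<psi> (c, x) * U s (x, m)) * cnj (\<psi> (c, x') * U s' (x', m'))))"
            if "c \<in> C" "m \<in> Q" "m' \<in> Q" for c m m'
          proof -
            have "J s c m * \<sigma> m m' * cnj (J s' c m')
               = \<sigma> m m' * ((\<Sum>x<n. \<psi> (c, x) * U s (x, m)) * cnj (\<Sum>x<n. \<psi> (c, x) * U s' (x, m')))"
              unfolding J[OF conjunct1[OF True] that(1,2), symmetric] J[OF conjunct2[OF True] that(1,3), symmetric]
              by (simp only: mult_ac)
            then show ?thesis by (simp only: cnj_sum sum_product) (simp only: sum_distrib_left)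
          qed
          then show ?thesis using True by (simp add: reduced_op_def conj_by_def cong: sum.cong)
        qed
        also have "\<dots> = (\<Sum>m\<in>Q. \<Sum>m'\<in>Q. \<Sum>x<n. \<Sum>x'<n. \<Sum>c\<in>C.
            \<sigma> m m' * ((\<psi> (c, x) * U s (x, m)) * cnj (\<psi> (c, x') * U s' (x', m'))))"
          by (subst sum.swap, intro sum.cong refl, subst sum.swap, intro sum.cong refl,
              subst sum.swap, intro sum.cong refl, rule sum.swap)
        also have "\<dots> = (\<Sum>m\<in>Q. \<Sum>m'\<in>Q. \<Sum>x<n. \<Sum>x'<n. U s (x, m) * \<theta> \<sigma> (x, m) (x', m') * cnj (U s' (x', m')))"
          by (intro sum.cong refl) (simp add: \<theta>_def sum_distrib_left sum_distrib_right mult_ac)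
        also have "\<dots> = (\<Sum>x<n. \<Sum>x'<n. \<Sum>m\<in>Q. \<Sum>m'\<in>Q. U s (x, m) * \<theta> \<sigma> (x, m) (x', m') * cnj (U s' (x', m')))"
          by (rule sum_swap_pairs)
        also have "\<dots> = conj_by ({..<n} \<times> Q) U (\<theta> \<sigma>) s s'"
          unfolding conj_by_def sum.cartesian_product' by (intro sum.cong refl) (rule sum.swap)
        finally show ?thesis .
      next
        case False
        then show ?thesis using isometry_outside[OF U]
          by (auto simp: reduced_op_def conj_by_def intro!: sum.neutral)
      qed
    qed
    then have "R (reduced_op S C Q J \<sigma>) = \<theta> \<sigma>" using R(2)[OF \<theta>] by simp
    moreover have "?T (\<theta> \<sigma>) = \<sigma>"
    proof (intro ext)
      fix m m'
      have "(\<Sum>x<n. \<theta> \<sigma> (x, m) (x, m')) = (\<Sum>c\<in>C. \<Sum>x<n. \<psi> (c, x) * cnj (\<psi> (c, x))) * \<sigma> m m'"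
        by (subst sum.swap) (simp add: \<theta>_def sum_distrib_right)
      then show "?T (\<theta> \<sigma>) m m' = \<sigma> m m'" using \<psi> opers_outside[OF \<sigma>] by (simp add: ptr_def)
    qed
    ultimately show ?thesis by simp
  qed
  ultimately show ?thesis using that by blast
qed

section \<open>Recovery by sets of parties\<close>

lemma app_kets: "(\<And>y x. y \<notin> Y \<Longrightarrow> K y x = 0) \<Longrightarrow> app X K v \<in> kets Y"
  by (simp add: app_def kets_def)

lemma app_app: "app Y K (app X L v) = app X (\<lambda>z x. \<Sum>y\<in>Y. K z y * L y x) v"
  unfolding app_def sum_distrib_left sum_distrib_right
  by (rule ext, subst sum.swap) (simp add: mult.assoc)

lemma app_cong: "(\<And>y x. x \<in> X \<Longrightarrow> K y x = K' y x) \<Longrightarrow> app X K v = app X K' v"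
  by (simp add: app_def cong: sum.cong)

lemma app_identity: "finite X \<Longrightarrow> v \<in> kets X \<Longrightarrow> app X (\<lambda>y x. if y = x then 1 else 0) v = v"
  by (auto simp: app_def sum_delta_mult kets_def)

lemma inner_on_adjoint:
  "inner_on Y (app X K v) w = inner_on X v (app Y (\<lambda>x y. cnj (K y x)) w)"
  unfolding inner_on_def app_def cnj_sum sum_distrib_left sum_distrib_right
  by (subst sum.swap) (simp add: mult_ac)

lemma inner_on_basis_ket: "finite X \<Longrightarrow> x \<in> X \<Longrightarrow> inner_on X (basis_ket x) v = v x"
  by (simp add: inner_on_def basis_ket_def if_distrib[of cnj] sum_delta_mult cong: if_cong)

lemma basis_ket_kets: "x \<in> X \<Longrightarrow> basis_ket x \<in> kets X"
  by (auto simp: basis_ket_def kets_def)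

lemma app_basis_ket: "finite X \<Longrightarrow> x \<in> X \<Longrightarrow> app X K (basis_ket x) y = K y x"
  by (simp add: app_def sum_basis_ket)

lemma isometry_adjoint_app:
  assumes "isometry X Y K" "finite X" "v \<in> kets X"
  shows "app Y (\<lambda>x y. cnj (K y x)) (app X K v) = v"
proof -
  have "app Y (\<lambda>x y. cnj (K y x)) (app X K v) = app X (\<lambda>y x. if y = x then 1 else 0) v"
    unfolding app_app
  proof (rule app_cong)
    fix z x assume "x \<in> X"
    then show "(\<Sum>y\<in>Y. cnj (K y z) * K y x) = (if z = x then 1 else 0)"
      using isometry_inner[OF assms(1), of z x] isometry_outside[OF assms(1)]
      by (cases "z \<in> X") auto
  qed
  then show ?thesis using assms by (simp add: app_identity)
qed

definition range_proj :: "'q set \<Rightarrow> ('y, 'q) lin \<Rightarrow> 'y oper" where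
  "range_proj Q J = (\<lambda>y y'. \<Sum>m\<in>Q. J y m * cnj (J y' m))"

text \<open>The description in \<open>projector\<close> determines the operator: a basis ket splits
  into its image under \<open>range_proj\<close> and a remainder \<open>w\<close> orthogonal to the
  range, and the action on both parts is prescribed.\<close>

lemma projector_lin_range:
  assumes J: "isometry Q Y J" and fin: "finite Q" "finite Y"
  shows "projector Y (lin_range Q J) = range_proj Q J"
  unfolding projector_def
proof (rule the_equality)
  let ?J' = "\<lambda>m y. cnj (J y m)"
  have PJ: "app Y (range_proj Q J) w = app Q J (app Y ?J' w)" for w
    by (simp add: app_app range_proj_def)
  have Pop: "range_proj Q J \<in> opers Y"
    using isometry_outside[OF J] by (auto simp: range_proj_def opers_def intro!: sum.neutral)
  have J'k: "app Y ?J' w \<in> kets Q" for w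
    using isometry_outside[OF J] by (intro app_kets) auto
  have J_kets: "app Q J v \<in> kets Y" for v
    using isometry_outside[OF J] by (intro app_kets) auto
  have orth: "app Y ?J' w = (\<lambda>_. 0)" if "\<forall>v\<in>lin_range Q J. inner_on Y v w = 0" for w
  proof
    fix m
    show "app Y ?J' w m = 0"
    proof (cases "m \<in> Q")
      case True
      then have "inner_on Y (app Q J (basis_ket m)) w = 0"
        using that basis_ket_kets[OF True] unfolding lin_range_def by blast
      then show ?thesis using True fin by (simp add: inner_on_adjoint inner_on_basis_ket)
    qed (use J'k in \<open>auto simp: kets_def\<close>)
  qed
  show "range_proj Q J \<in> opers Y \<and> (\<forall>v\<in>lin_range Q J. app Y (range_proj Q J) v = v) \<and>
     (\<forall>w\<in>kets Y. (\<forall>v\<in>lin_range Q J. inner_on Y v w = 0) \<longrightarrow> app Y (range_proj Q J) w = (\<lambda>_. 0))"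
  proof (intro conjI ballI impI Pop)
    fix v assume "v \<in> lin_range Q J"
    then show "app Y (range_proj Q J) v = v"
      using isometry_adjoint_app[OF J fin(1)] by (auto simp: PJ lin_range_def)
  next
    fix w assume "\<forall>v\<in>lin_range Q J. inner_on Y v w = 0"
    then show "app Y (range_proj Q J) w = (\<lambda>_. 0)"
      unfolding PJ by (subst orth) (simp_all add: app_def)
  qed
  fix P assume P: "P \<in> opers Y \<and> (\<forall>v\<in>lin_range Q J. app Y P v = v) \<and>
     (\<forall>w\<in>kets Y. (\<forall>v\<in>lin_range Q J. inner_on Y v w = 0) \<longrightarrow> app Y P w = (\<lambda>_. 0))"
  show "P = range_proj Q J"
  proof (rule opers_eqI[OF conjunct1[OF P] Pop])
    fix y y' assume y: "y \<in> Y" "y' \<in> Y"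
    let ?e = "basis_ket y'"
    let ?p = "app Y (range_proj Q J) ?e"
    have pin: "?p \<in> lin_range Q J" unfolding PJ lin_range_def using J'k by blast
    define w where "w = (\<lambda>z. ?e z - ?p z)"
    have "inner_on Y v w = 0" if v: "v \<in> lin_range Q J" for v
    proof -
      obtain u where u: "u \<in> kets Q" "v = app Q J u" using v by (auto simp: lin_range_def)
      have "app Y ?J' w = (\<lambda>z. app Y ?J' ?e z - app Y ?J' ?p z)"
        by (simp add: w_def app_def right_diff_distrib sum_subtractf)
      also have "app Y ?J' ?p = app Y ?J' ?e"
        unfolding PJ by (rule isometry_adjoint_app[OF J fin(1) J'k])
      finally show ?thesis by (simp add: u(2) inner_on_adjoint) (simp add: inner_on_def)
    qed
    moreover have "w \<in> kets Y"
      using basis_ket_kets[OF y(2)] J_kets by (auto simp: w_def PJ kets_def)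
    ultimately have "app Y P w = (\<lambda>_. 0)" using P by blast
    moreover have "app Y P w y = app Y P ?e y - app Y P ?p y"
      by (simp add: w_def app_def right_diff_distrib sum_subtractf)
    moreover have "app Y P ?p = ?p" using P pin by blast
    ultimately show "P y y' = range_proj Q J y y'"
      using y fin by (simp add: app_basis_ket)
  qed
qed

lemma conj_by_range_proj:
  "conj_by Y (range_proj Q J) \<rho> = conj_by Q J (conj_by Y (\<lambda>m y. cnj (J y m)) \<rho>)"
  by (simp add: conj_by_conj_by range_proj_def)

lemma conj_by_range_proj_image:
  assumes "isometry Q Y J" "finite Q" "\<sigma> \<in> opers Q"
  shows "conj_by Y (range_proj Q J) (conj_by Q J \<sigma>) = conj_by Q J \<sigma>"
  unfolding conj_by_range_proj isometry_adjoint_conj_by[OF assms] ..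

text \<open>The projected operators are exactly the encoded ones. Conditions on the code space
  thereby become conditions on the secret system, free of \<open>projector\<close>.\<close>

lemma all_projected_iff:
  assumes J: "isometry Q Y J" and fin: "finite Q" "finite Y"
  shows "(\<forall>\<rho>\<in>opers Y. P (conj_by Y (projector Y (lin_range Q J)) \<rho>)) \<longleftrightarrow>
     (\<forall>\<sigma>\<in>opers Q. P (conj_by Q J \<sigma>))"
proof (intro iffI ballI)
  fix \<sigma> assume *: "\<forall>\<rho>\<in>opers Y. P (conj_by Y (projector Y (lin_range Q J)) \<rho>)" and \<sigma>: "\<sigma> \<in> opers Q"
  have "conj_by Q J \<sigma> \<in> opers Y" using isometry_outside[OF J] by (intro conj_by_opers) auto
  with * have "P (conj_by Y (range_proj Q J) (conj_by Q J \<sigma>))"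
    by (simp add: projector_lin_range[OF J fin])
  then show "P (conj_by Q J \<sigma>)" by (simp add: conj_by_range_proj_image[OF J fin(1) \<sigma>])
next
  fix \<rho> assume *: "\<forall>\<sigma>\<in>opers Q. P (conj_by Q J \<sigma>)" and "\<rho> \<in> opers Y"
  have "conj_by Y (\<lambda>m y. cnj (J y m)) \<rho> \<in> opers Q"
    using isometry_outside[OF J] by (intro conj_by_opers) auto
  then show "P (conj_by Y (projector Y (lin_range Q J)) \<rho>)"
    using * by (simp add: projector_lin_range[OF J fin] conj_by_range_proj)
qed

lemma recovers_iff_channel:
  assumes "isometry Q (PiE UNIV L) J" "finite Q" "\<And>p. finite (L p)"
  shows "recovers L (lin_range Q J) S \<longleftrightarrow> (\<exists>R. channel (PiE S L) (PiE UNIV L) R \<and>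
     (\<forall>\<sigma>\<in>opers Q. R (reduce L S (conj_by Q J \<sigma>)) = conj_by Q J \<sigma>))"
proof -
  have "finite (PiE UNIV L)" using assms(3) by (rule finite_PiE_type)
  note * = all_projected_iff[OF assms(1,2) this, of "\<lambda>\<pi>. R (reduce L S \<pi>) = \<pi>" for R]
  show ?thesis by (simp only: recovers_def Let_def *)
qed

text \<open>Restoring the codeword and decoding the secret are interconvertible: the former is
  followed by an inverse of \<open>J\<close>, the latter by \<open>J\<close> itself.\<close>

lemma recovers_iff_decoder:
  assumes J: "isometry Q (PiE UNIV L) J" and fin: "finite Q" "\<And>p. finite (L p)" and q0: "q0 \<in> Q"
  shows "recovers L (lin_range Q J) S \<longleftrightarrow> (\<exists>D. channel (PiE S L) Q D \<and>
     (\<forall>\<sigma>\<in>opers Q. D (reduce L S (conj_by Q J \<sigma>)) = \<sigma>))"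
proof -
  have finL: "finite (PiE UNIV L)" using fin(2) by (rule finite_PiE_type)
  obtain K where K: "channel (PiE UNIV L) Q K" "\<And>\<sigma>. \<sigma> \<in> opers Q \<Longrightarrow> K (conj_by Q J \<sigma>) = \<sigma>"
    using isometry_left_inverse[OF J fin(1) finL q0] by blast
  show ?thesis
    unfolding recovers_iff_channel[OF J fin]
  proof (intro iffI; elim exE conjE)
    fix R assume R: "channel (PiE S L) (PiE UNIV L) R"
      "\<forall>\<sigma>\<in>opers Q. R (reduce L S (conj_by Q J \<sigma>)) = conj_by Q J \<sigma>"
    show "\<exists>D. channel (PiE S L) Q D \<and> (\<forall>\<sigma>\<in>opers Q. D (reduce L S (conj_by Q J \<sigma>)) = \<sigma>)"
      by (rule exI[of _ "\<lambda>\<rho>. K (R \<rho>)"]) (use channel_comp[OF R(1) K(1)] R(2) K(2) in simp)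
  next
    fix D assume D: "channel (PiE S L) Q D"
      "\<forall>\<sigma>\<in>opers Q. D (reduce L S (conj_by Q J \<sigma>)) = \<sigma>"
    show "\<exists>R. channel (PiE S L) (PiE UNIV L) R \<and>
      (\<forall>\<sigma>\<in>opers Q. R (reduce L S (conj_by Q J \<sigma>)) = conj_by Q J \<sigma>)"
      by (rule exI[of _ "\<lambda>\<rho>. conj_by Q J (D \<rho>)"])
        (use channel_comp[OF D(1) channel_isometry[OF J fin(1)]] D(2) in simp)
  qed
qed

abbreviation split_code :: "'p set \<Rightarrow> ('p \<Rightarrow> 'l, 'q) lin \<Rightarrow> ('p \<Rightarrow> 'l) \<Rightarrow> ('p \<Rightarrow> 'l) \<Rightarrow> 'q \<Rightarrow> complex" where
  "split_code S J \<equiv> \<lambda>f h m. J (override_on h f S) m"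

lemma reduce_conj_by:
  "reduce L S (conj_by Q J \<sigma>) = reduced_op (PiE S L) (PiE (- S) L) Q (split_code S J) \<sigma>"
  by (simp add: reduce_def reduced_op_def conj_by_def fun_eq_iff)

lemma isometry_split_norm:
  assumes "isometry Q (PiE UNIV L) J" "m \<in> Q"
  shows "(\<Sum>f\<in>PiE S L. \<Sum>h\<in>PiE (- S) L. split_code S J f h m * cnj (split_code S J f h m)) = 1"
  using isometry_inner[OF assms(1,2,2)] sum_PiE_UNIV_split[of "\<lambda>b. cnj (J b m) * J b m" L S]
  by (simp add: mult.commute)

text \<open>Replaces the quantification over channels by identities between finite sums. The
  constructed codes are verified, and the given ones exploited, in this form.\<close>

theorem recovers_iff_decoupled:
  fixes L :: "'p::finite \<Rightarrow> 'l set"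
  assumes J: "isometry Q (PiE UNIV L) J" and fin: "finite Q" "\<And>p. finite (L p)" and q0: "q0 \<in> Q"
  shows "recovers L (lin_range Q J) S \<longleftrightarrow>
     (\<exists>\<omega>. decoupled (PiE S L) (PiE (- S) L) Q (split_code S J) \<omega>)"
proof -
  have finS: "finite (PiE S L)" "finite (PiE (- S) L)" using fin(2) by (auto intro: finite_PiE_type)
  show ?thesis
    unfolding recovers_iff_decoder[OF J fin q0] reduce_conj_by
  proof (intro iffI; elim exE conjE)
    fix D assume "channel (PiE S L) Q D" "\<forall>\<sigma>\<in>opers Q.
      D (reduced_op (PiE S L) (PiE (- S) L) Q (split_code S J) \<sigma>) = \<sigma>"
    then show "\<exists>\<omega>. decoupled (PiE S L) (PiE (- S) L) Q (split_code S J) \<omega>"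
      by (intro decoder_imp_decoupled[OF finS fin(1) q0]) (auto intro: unit_op_opers)
  next
    fix \<omega> assume "decoupled (PiE S L) (PiE (- S) L) Q (split_code S J) \<omega>"
    from decoupled_imp_decoder[OF finS fin(1) q0 this isometry_split_norm[OF J q0]]
    show "\<exists>D. channel (PiE S L) Q D \<and> (\<forall>\<sigma>\<in>opers Q.
      D (reduced_op (PiE S L) (PiE (- S) L) Q (split_code S J) \<sigma>) = \<sigma>)"
      by metis
  qed
qed

text \<open>\<open>T\<close> discards the shares of \<open>T - S\<close> and proceeds as
  \<open>S\<close>; tracing out in two steps agrees with tracing out \<open>- S\<close> at
  once.\<close>

lemma recovers_mono:
  fixes L :: "'p::finite \<Rightarrow> 'l set"
  assumes J: "isometry Q (PiE UNIV L) J" and fin: "finite Q" "\<And>p. finite (L p)"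
    and rec: "recovers L (lin_range Q J) S" and sub: "S \<subseteq> T"
  shows "recovers L (lin_range Q J) T"
proof -
  obtain R where R: "channel (PiE S L) (PiE UNIV L) R"
    "\<And>\<sigma>. \<sigma> \<in> opers Q \<Longrightarrow> R (reduce L S (conj_by Q J \<sigma>)) = conj_by Q J \<sigma>"
    using rec recovers_iff_channel[OF J fin] by auto
  let ?T = "ptr (\<lambda>f h. override_on h f S) (PiE S L) (PiE (T - S) L)"
  have "S \<union> (T - S) = T" using sub by auto
  then have "channel (PiE T L) (PiE S L) ?T"
    using bij_betw_override_on[of S "T - S" L] fin(2) by (intro channel_ptr finite_PiE_type) auto
  moreover have "?T (reduce L T \<rho>) = reduce L S \<rho>" for \<rho>
  proof (intro ext)
    fix f g
    have un: "(T - S) \<union> (- T) = - S" using sub by auto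
    have in_T: "override_on h x S \<in> PiE T L" if "x \<in> PiE S L" "h \<in> PiE (T - S) L" for x h
      using that sub by (auto simp: override_on_def PiE_iff extensional_def)
    have ov: "override_on (override_on k h (T - S)) x S = override_on k (override_on h x S) T" for k h x :: "'p \<Rightarrow> 'l"
      using sub by (auto simp: override_on_def fun_eq_iff)
    have "reduce L S \<rho> f g = (if f \<in> PiE S L \<and> g \<in> PiE S L
       then \<Sum>h\<in>PiE (T - S) L. \<Sum>k\<in>PiE (- T) L. \<rho> (override_on k (override_on h f S) T) (override_on k (override_on h g S) T) else 0)"
      unfolding reduce_def un[symmetric] by (subst sum_PiE_split) (auto simp: ov)
    then show "?T (reduce L T \<rho>) f g = reduce L S \<rho> f g"
      using in_T by (simp add: ptr_def reduce_def)
  qed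
  ultimately show ?thesis
    unfolding recovers_iff_channel[OF J fin] using channel_comp[of "PiE T L" "PiE S L" ?T "PiE UNIV L" R] R by auto
qed

text \<open>If \<open>T\<close> recovers, so does \<open>- S\<close>; but recovery by
  \<open>S\<close> makes the reduced operator on \<open>- S\<close> the same for the secrets
  \<open>m\<close> and \<open>m'\<close>.\<close>

theorem no_cloning:
  fixes L :: "'p::finite \<Rightarrow> 'l set"
  assumes J: "isometry Q (PiE UNIV L) J" and fin: "finite Q" "\<And>p. finite (L p)"
    and S: "recovers L (lin_range Q J) S" and T: "recovers L (lin_range Q J) T" and disj: "S \<inter> T = {}"
    and m: "m \<in> Q" "m' \<in> Q" "m \<noteq> m'"
  shows False
proof -
  have "recovers L (lin_range Q J) (- S)" by (rule recovers_mono[OF J fin T]) (use disj in auto)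
  then obtain D where D: "\<And>\<sigma>. \<sigma> \<in> opers Q \<Longrightarrow> D (reduce L (- S) (conj_by Q J \<sigma>)) = \<sigma>"
    using recovers_iff_decoder[OF J fin m(1)] by blast
  obtain \<omega> where \<omega>: "decoupled (PiE S L) (PiE (- S) L) Q (split_code S J) \<omega>"
    using S recovers_iff_decoupled[OF J fin m(1)] by blast
  have ov: "override_on h f (- S) = override_on f h S" for f h :: "'p \<Rightarrow> 'l"
    by (auto simp: override_on_def fun_eq_iff)
  have "reduce L (- S) (conj_by Q J (unit_op m m)) = reduce L (- S) (conj_by Q J (unit_op m' m'))"
    using decoupledD[OF \<omega>] m fin
    by (auto simp: reduce_def conj_by_unit_op fun_eq_iff ov)
  then have "unit_op m m = unit_op m' m'"
    using D unit_op_opers[OF m(1,1)] unit_op_opers[OF m(2,2)] by metis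
  then show False using m(3) by (auto simp: unit_op_def fun_eq_iff split: if_splits)
qed

lemma recovers_UNIV:
  fixes L :: "'p::finite \<Rightarrow> 'l set"
  assumes J: "isometry Q (PiE UNIV L) J" and fin: "finite Q" "\<And>p. finite (L p)"
  shows "recovers L (lin_range Q J) UNIV"
proof -
  have "reduce L UNIV (conj_by Q J \<sigma>) = conj_by Q J \<sigma>" for \<sigma>
    using isometry_outside[OF J] by (fastforce simp: reduce_def override_on_def conj_by_def fun_eq_iff intro!: sum.neutral)
  then show ?thesis unfolding recovers_iff_channel[OF J fin] using channel_id by auto
qed

text \<open>From here on validity enters only through these three properties. The witnessing code is
  dropped, as it may encode a system of the wrong dimension.\<close>

lemma valid_access_structureD:
  assumes "valid_access_structure \<Gamma>"
  shows valid_access_structure_UNIV: "UNIV \<in> \<Gamma>"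
    and valid_access_structure_mono: "\<And>S T. S \<in> \<Gamma> \<Longrightarrow> S \<subseteq> T \<Longrightarrow> T \<in> \<Gamma>"
    and valid_access_structure_no_cloning: "\<And>S T. S \<in> \<Gamma> \<Longrightarrow> T \<in> \<Gamma> \<Longrightarrow> S \<inter> T \<noteq> {}"
proof -
  obtain q :: nat and d :: "'a \<Rightarrow> nat" and J where q: "2 \<le> q" and
    J: "isometry {..<q} (PiE UNIV (\<lambda>p. {..<d p})) J" and
    iff: "\<And>S. S \<in> \<Gamma> \<longleftrightarrow> recovers (\<lambda>p. {..<d p}) (lin_range {..<q} J) S"
    using assms by (auto simp: valid_access_structure_def qss_code_def code_for_def)
  note fin = finite_lessThan[of q] finite_lessThan
  show "UNIV \<in> \<Gamma>" using recovers_UNIV[OF J fin] iff by blast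
  show "T \<in> \<Gamma>" if "S \<in> \<Gamma>" "S \<subseteq> T" for S T
    using recovers_mono[OF J fin] that iff by blast
  show "S \<inter> T \<noteq> {}" if "S \<in> \<Gamma>" "T \<in> \<Gamma>" for S T
    using no_cloning[OF J fin, of S T 0 1] that iff q by auto
qed

section \<open>Tight codes for valid access structures\<close>

lemma unit_op_positive: "m \<in> Q \<Longrightarrow> positive_op Q (unit_op m m)"
proof -
  have "unit_op m m = ket_bra (basis_ket m)"
    by (auto simp: unit_op_def ket_bra_def basis_ket_def fun_eq_iff)
  then show "m \<in> Q \<Longrightarrow> positive_op Q (unit_op m m)"
    by (simp add: ket_bra_positive basis_ket_kets)
qed

lemma state_unit_op: "finite Q \<Longrightarrow> m \<in> Q \<Longrightarrow> state Q (unit_op m m)"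
  by (simp add: state_def unit_op_positive trace_on_def) (simp add: unit_op_def)

text \<open>For each \<open>z\<close> one of the two secrets differs from \<open>z\<close>. Exact
  recovery of it makes the output entry at \<open>z\<close> vanish, and by positivity the
  contribution of \<Theta> vanishes too. As \<Theta> is common to both secrets, its output has zero
  diagonal, although its trace is preserved.\<close>

lemma not_secret_recoverable:
  assumes Q: "finite Q" "x \<in> Q" "y \<in> Q" "x \<noteq> y"
    and \<Phi>: "\<And>m. m \<in> {x, y} \<Longrightarrow> \<Phi> (unit_op m m) = (\<lambda>a b. \<Theta> a b + \<Psi> m a b)"
    and pos: "positive_op Y \<Theta>" "\<And>m. m \<in> {x, y} \<Longrightarrow> positive_op Y (\<Psi> m)"
    and tr: "trace_on Y \<Theta> \<noteq> 0"
  shows "\<not> secret_recoverable Q Y \<Phi>"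
proof
  assume "secret_recoverable Q Y \<Phi>"
  then obtain R where R: "channel Y Q R" and
    rec: "\<And>\<rho>. state Q \<rho> \<Longrightarrow> R (\<Phi> \<rho>) = (\<lambda>m m'. trace_on Y (\<Phi> \<rho>) * \<rho> m m')"
    by (auto simp: secret_recoverable_def)
  have "R \<Theta> z z = 0" for z
  proof -
    define m where "m = (if z = x then y else x)"
    have m: "m \<in> {x, y}" "m \<in> Q" "m \<noteq> z" using Q by (auto simp: m_def)
    have "R (\<Phi> (unit_op m m)) = (\<lambda>a b. R \<Theta> a b + R (\<Psi> m) a b)"
      unfolding \<Phi>[OF m(1)] by (rule channel_add[OF R]) (use pos m positive_op_opers in auto)
    then have "R \<Theta> z z + R (\<Psi> m) z z = 0"
      using rec[OF state_unit_op[OF Q(1) m(2)]] m(3) by (simp add: unit_op_def fun_eq_iff)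
    moreover have "R \<Theta> z z \<in> \<real>\<^sub>\<ge>\<^sub>0" "R (\<Psi> m) z z \<in> \<real>\<^sub>\<ge>\<^sub>0"
      using channel_positive[OF R] pos m(1) Q(1) by (auto intro: positive_op_diag)
    ultimately show ?thesis by (auto simp: complex_nonneg_Reals_iff complex_eq_iff)
  qed
  then have "trace_on Q (R \<Theta>) = 0" by (simp add: trace_on_def)
  then show False using tr channel_trace[OF R positive_op_opers[OF pos(1)]] by simp
qed

text \<open>The encoding splits into a branch \<open>W1\<close> that is hidden from \<open>S\<close> and a remainder; exact recovery
  would have to succeed in each branch separately.\<close>

context
  fixes L :: "'b::finite \<Rightarrow> 'l set" and S :: "'b set" and E :: "'e set"
    and W W1 W2 :: "('b \<Rightarrow> 'l, 'e) lin" and \<omega>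
  assumes finE: "finite E" and finL: "\<And>p. finite (L p)"
    and W: "\<And>b e. W b e = W1 b e + W2 b e"
    and out: "\<And>b e. b \<notin> PiE UNIV L \<Longrightarrow> W1 b e = 0" "\<And>b e. b \<notin> PiE UNIV L \<Longrightarrow> W2 b e = 0"
    and cross: "\<And>f g h e e'. f \<in> PiE S L \<Longrightarrow> g \<in> PiE S L \<Longrightarrow> h \<in> PiE (- S) L \<Longrightarrow>
      W1 (override_on h f S) e * cnj (W2 (override_on h g S) e') = 0"
    and hidden: "decoupled (PiE (- S) L) (PiE S L) E (\<lambda>h f e. W1 (override_on h f S) e) \<omega>"
    and weight: "(\<Sum>f\<in>PiE S L. \<omega> f f) \<noteq> 0"
begin

text \<open>Cross terms disappear because the branches are orthogonal already on the shares outside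
  \<open>S\<close>, which are traced out.\<close>

lemma reduce_branches:
  "reduce L S (conj_by E W \<sigma>) f g = reduce L S (conj_by E W1 \<sigma>) f g + reduce L S (conj_by E W2 \<sigma>) f g"
proof -
  have "conj_by E W \<sigma> (override_on h f S) (override_on h g S) =
      conj_by E W1 \<sigma> (override_on h f S) (override_on h g S) + conj_by E W2 \<sigma> (override_on h f S) (override_on h g S)"
    if "f \<in> PiE S L" "g \<in> PiE S L" "h \<in> PiE (- S) L" for h
  proof -
    have "W (override_on h f S) e * \<sigma> e e' * cnj (W (override_on h g S) e')
        = W1 (override_on h f S) e * \<sigma> e e' * cnj (W1 (override_on h g S) e')
          + W2 (override_on h f S) e * \<sigma> e e' * cnj (W2 (override_on h g S) e')" for e e'
      using cross[OF that, of e e'] cross[OF that(2,1,3), of e' e]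
      by (auto simp: W algebra_simps)
    then show ?thesis by (simp add: conj_by_def sum.distrib)
  qed
  then show ?thesis by (simp add: reduce_def sum.distrib)
qed

text \<open>In the hidden branch the complement of \<open>S\<close> is the decoupled side, so
  \<open>S\<close> sees \<omega>, scaled only by the trace of the input.\<close>

lemma reduce_hidden:
  "reduce L S (conj_by E W1 \<sigma>) f g = (if f \<in> PiE S L \<and> g \<in> PiE S L then trace_on E \<sigma> * \<omega> f g else 0)"
proof (cases "f \<in> PiE S L \<and> g \<in> PiE S L")
  case True
  then have "reduce L S (conj_by E W1 \<sigma>) f g = (\<Sum>e\<in>E. \<Sum>e'\<in>E. \<Sum>h\<in>PiE (- S) L.
      W1 (override_on h f S) e * \<sigma> e e' * cnj (W1 (override_on h g S) e'))"
    unfolding reduce_def conj_by_def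
    by simp (subst sum.swap, intro sum.cong refl, rule sum.swap)
  also have "\<dots> = (\<Sum>e\<in>E. \<Sum>e'\<in>E. \<sigma> e e' * (\<Sum>h\<in>PiE (- S) L.
      W1 (override_on h f S) e * cnj (W1 (override_on h g S) e')))"
    by (simp add: sum_distrib_left mult_ac)
  also have "\<dots> = (\<Sum>e\<in>E. \<Sum>e'\<in>E. \<sigma> e e' * (if e = e' then \<omega> f g else 0))"
    using True decoupledD[OF hidden] by simp
  also have "\<dots> = trace_on E \<sigma> * \<omega> f g"
    using finE by (simp add: sum_delta_mult trace_on_def sum_distrib_right)
  finally show ?thesis using True by simp
qed (auto simp: reduce_def)

lemma reduce_branch_positive:
  assumes "V \<in> {W1, W2}" and pos: "positive_op (Z \<times> E) \<rho>" and Z: "finite Z"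
  shows "positive_op (Z \<times> PiE S L) (id_tensor (\<lambda>\<sigma>. reduce L S (conj_by E V \<sigma>)) \<rho>)"
proof -
  have "positive_op (Z \<times> PiE UNIV L) (id_tensor (conj_by E V) \<rho>)"
    using assms(1) by (intro id_tensor_conj_by_positive[OF pos]) (cases "V = W1"; simp add: out)
  from channel_positive_ancilla[OF channel_reduce[OF finL] this Z]
  show ?thesis by (simp add: id_tensor_def)
qed

text \<open>In the hidden branch the output is the product of the reduced state of the side system
  with \<omega>, and neither factor depends on the secret. The other branch adds a positive
  operator, so two secrets share a component of nonzero trace.\<close>

lemma not_can_extract:
  assumes Q: "finite Q" "x \<in> Q" "y \<in> Q" "x \<noteq> y"
  shows "\<not> can_extract Q E L W S"
proof
  assume "can_extract Q E L W S"
  then obtain r :: nat and J where J: "isometry Q ({..<r} \<times> E) J"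
    and none: "no_information Q (\<lambda>\<rho>. trace_snd E (conj_by Q J \<rho>))"
    and rec: "secret_recoverable Q ({..<r} \<times> PiE S L)
       (\<lambda>\<rho>. id_tensor (\<lambda>\<sigma>. reduce L S (conj_by E W \<sigma>)) (conj_by Q J \<rho>))"
    by (auto simp: can_extract_def)
  define N where "N V \<rho> = id_tensor (\<lambda>\<sigma>. reduce L S (conj_by E V \<sigma>)) (conj_by Q J \<rho>)" for V \<rho>
  have N1: "N W1 \<rho> = (\<lambda>(s, f) (s', g). if f \<in> PiE S L \<and> g \<in> PiE S L
      then trace_snd E (conj_by Q J \<rho>) s s' * \<omega> f g else 0)" for \<rho>
    by (simp add: N_def id_tensor_def reduce_hidden fun_eq_iff trace_snd_def trace_on_def)
  have pos: "positive_op ({..<r} \<times> PiE S L) (N V (unit_op m m))" if "V \<in> {W1, W2}" "m \<in> Q" for V m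
    unfolding N_def using isometry_outside[OF J] that
    by (intro reduce_branch_positive conj_by_positive unit_op_positive) auto
  have "trace_on ({..<r} \<times> PiE S L) (N W1 (unit_op x x))
     = (\<Sum>s<r. \<Sum>f\<in>PiE S L. trace_snd E (conj_by Q J (unit_op x x)) s s * \<omega> f f)"
    unfolding trace_on_def sum.cartesian_product' by (simp add: N1)
  also have "\<dots> = (\<Sum>s<r. trace_snd E (conj_by Q J (unit_op x x)) s s) * (\<Sum>f\<in>PiE S L. \<omega> f f)"
    by (simp add: sum_product)
  also have "(\<Sum>s<r. trace_snd E (conj_by Q J (unit_op x x)) s s) = trace_on ({..<r} \<times> E) (conj_by Q J (unit_op x x))"
    unfolding trace_on_def sum.cartesian_product' by (simp add: trace_snd_def)
  also have "\<dots> = 1"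
    using channel_trace[OF channel_isometry[OF J Q(1)] unit_op_opers[OF Q(2,2)]]
      state_unit_op[OF Q(1,2)] by (simp add: state_def)
  finally have tr: "trace_on ({..<r} \<times> PiE S L) (N W1 (unit_op x x)) \<noteq> 0" using weight by simp
  have same: "N W1 (unit_op m m) = N W1 (unit_op x x)" if "m \<in> {x, y}" for m
  proof -
    have "trace_snd E (conj_by Q J (unit_op m m)) = trace_snd E (conj_by Q J (unit_op x x))"
      using none state_unit_op[OF Q(1)] that Q unfolding no_information_def by blast
    then show ?thesis unfolding N1 by (simp only:)
  qed
  have "\<not> secret_recoverable Q ({..<r} \<times> PiE S L) (N W)"
  proof (rule not_secret_recoverable[OF Q _ pos[of W1 x] _ tr])
    fix m assume m: "m \<in> {x, y}"
    show "N W (unit_op m m) = (\<lambda>a b. N W1 (unit_op x x) a b + N W2 (unit_op m m) a b)"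
      unfolding same[OF m, symmetric] by (simp add: N_def id_tensor_def reduce_branches split_def)
    show "positive_op ({..<r} \<times> PiE S L) (N W2 (unit_op m m))" using m Q by (intro pos) auto
  qed (use Q in auto)
  then show False using rec by (simp add: N_def[abs_def])
qed

text \<open>The same obstruction without a side system, the secret being all of
  \<open>E\<close>.\<close>

lemma not_recovers:
  assumes iso: "isometry E (PiE UNIV L) W" and xy: "x \<in> E" "y \<in> E" "x \<noteq> y"
  shows "\<not> recovers L (lin_range E W) S"
proof
  assume "recovers L (lin_range E W) S"
  then obtain D where D: "channel (PiE S L) E D"
    "\<And>\<sigma>. \<sigma> \<in> opers E \<Longrightarrow> D (reduce L S (conj_by E W \<sigma>)) = \<sigma>"
    using recovers_iff_decoder[OF iso finE finL xy(1)] by auto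
  have "trace_on (PiE S L) (reduce L S (conj_by E W \<sigma>)) = 1" if "state E \<sigma>" for \<sigma>
    using channel_trace[OF channel_comp[OF channel_isometry[OF iso finE] channel_reduce[OF finL]]]
      that by (simp add: state_def positive_op_opers)
  then have "secret_recoverable E (PiE S L) (\<lambda>\<sigma>. reduce L S (conj_by E W \<sigma>))"
    unfolding secret_recoverable_def using D by (auto simp: state_def positive_op_opers)
  moreover have "\<not> secret_recoverable E (PiE S L) (\<lambda>\<sigma>. reduce L S (conj_by E W \<sigma>))"
  proof (rule not_secret_recoverable[OF finE xy])
    have tr: "trace_on E (unit_op m m) = 1" if "m \<in> E" for m
      using state_unit_op[OF finE that] by (simp add: state_def)
    fix m assume m: "m \<in> {x, y}"
    show "reduce L S (conj_by E W (unit_op m m)) = (\<lambda>a b. reduce L S (conj_by E W1 (unit_op x x)) a b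
        + reduce L S (conj_by E W2 (unit_op m m)) a b)"
      using m xy by (auto simp: reduce_branches reduce_hidden tr fun_eq_iff)
    show "positive_op (PiE S L) (reduce L S (conj_by E W2 (unit_op m m)))"
      using m xy out by (intro channel_positive[OF channel_reduce[OF finL]] conj_by_positive unit_op_positive) auto
  next
    show "positive_op (PiE S L) (reduce L S (conj_by E W1 (unit_op x x)))"
      using xy out by (intro channel_positive[OF channel_reduce[OF finL]] conj_by_positive unit_op_positive) auto
    show "trace_on (PiE S L) (reduce L S (conj_by E W1 (unit_op x x))) \<noteq> 0"
      using weight state_unit_op[OF finE xy(1)] by (simp add: trace_on_def[of "PiE S L"] reduce_hidden state_def)
  qed
  ultimately show False by blast
qed

end

text \<open>Codes whose codewords are uniform superpositions over disjoint sets of basis labels: \<open>S\<close>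
  recovers if its part of the label determines the secret and \<open>S\<close> can shift the secret without
  touching the other parties.\<close>

lemma decoupled_uniform:
  fixes L :: "'p::finite \<Rightarrow> 'l set" and X :: "nat \<Rightarrow> ('p \<Rightarrow> 'l) set"
  assumes finL: "\<And>p. finite (L p)"
    and sep: "\<And>f g h m m'. override_on f h S \<in> X m \<Longrightarrow> override_on g h S \<in> X m' \<Longrightarrow> m = m'"
    and sh_inj: "\<And>k p. inj_on (sh k p) (L p)" and sh_in: "\<And>k p n. n \<in> L p \<Longrightarrow> sh k p n \<in> L p"
    and shift: "\<And>k b m. b \<in> X m \<Longrightarrow> (\<lambda>p. sh k p (b p)) \<in> X ((m + k) mod d)"
    and fixed: "\<And>k b m p. b \<in> X m \<Longrightarrow> p \<notin> S \<Longrightarrow> sh k p (b p) = b p"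
  shows "\<exists>\<omega>. decoupled (PiE S L) (PiE (- S) L) {..<d}
     (\<lambda>h f m. if m < d \<and> override_on f h S \<in> X m then c else 0) \<omega>"
proof -
  \<comment> \<open>The completions that turn both environment labels into codewords of
    \<open>m\<close>; their number, times the squared modulus of the amplitude, is the entry of
    \<omega> at \<open>f\<close> and \<open>g\<close>.\<close>
  define N where "N f g m = {h \<in> PiE S L. override_on f h S \<in> X m \<and> override_on g h S \<in> X m}" for f g m
  have fin: "finite (PiE S L)" using finL by (rule finite_PiE_type)
  have le: "card (N f g m) \<le> card (N f g ((m + k) mod d))" for f g m k
  proof (rule card_inj_on_le)
    let ?\<sigma> = "\<lambda>h. \<lambda>p\<in>S. sh k p (h p)"
    show "inj_on ?\<sigma> (N f g m)"
    proof (rule inj_onI)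
      fix h h' assume h: "h \<in> N f g m" "h' \<in> N f g m" and eq: "?\<sigma> h = ?\<sigma> h'"
      have pie: "h \<in> PiE S L" "h' \<in> PiE S L" using h by (auto simp: N_def)
      show "h = h'"
      proof (rule PiE_ext[OF pie])
        fix p assume p: "p \<in> S"
        then show "h p = h' p"
          using fun_cong[OF eq, of p] inj_onD[OF sh_inj _ PiE_mem[OF pie(1) p] PiE_mem[OF pie(2) p]] by simp
      qed
    qed
    have "override_on x (?\<sigma> h) S \<in> X ((m + k) mod d)" if "override_on x h S \<in> X m" for x h
    proof -
      have "override_on x (?\<sigma> h) S = (\<lambda>p. sh k p (override_on x h S p))"
        using fixed[OF that, of _ k] by (auto simp: override_on_def fun_eq_iff)
      then show ?thesis using shift[OF that] by simp
    qed
    moreover have "?\<sigma> h \<in> PiE S L" if "h \<in> PiE S L" for h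
      using PiE_mem[OF that] by (auto intro: sh_in)
    ultimately show "?\<sigma> ` N f g m \<subseteq> N f g ((m + k) mod d)" unfolding N_def by blast
    show "finite (N f g ((m + k) mod d))" using fin by (simp add: N_def)
  qed
  \<comment> \<open>Shifting by \<open>d - m\<close> leads from \<open>m\<close> to 0 and shifting
    by \<open>m\<close> leads back, so the two inequalities give equality.\<close>
  have const: "card (N f g m) = card (N f g 0)" if "m < d" for f g m
    using le[of f g m "d - m"] le[of f g 0 m] that by simp
  have "decoupled (PiE S L) (PiE (- S) L) {..<d}
     (\<lambda>h f m. if m < d \<and> override_on f h S \<in> X m then c else 0) (\<lambda>f g. of_nat (card (N f g 0)) * (c * cnj c))"
    unfolding decoupled_def
  proof (intro ballI)
    fix f g m m' assume m: "m \<in> {..<d}" "m' \<in> {..<d}"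
    let ?J = "\<lambda>f h m. if m < d \<and> override_on f h S \<in> X m then c else 0"
    show "(\<Sum>h\<in>PiE S L. ?J f h m * cnj (?J g h m'))
       = (if m = m' then of_nat (card (N f g 0)) * (c * cnj c) else 0)"
    proof (cases "m = m'")
      case True
      have "(\<Sum>h\<in>PiE S L. ?J f h m * cnj (?J g h m')) = (\<Sum>h\<in>PiE S L. if h \<in> N f g m then c * cnj c else 0)"
        using m True by (intro sum.cong refl) (auto simp: N_def)
      also have "\<dots> = of_nat (card (N f g m)) * (c * cnj c)"
        using fin by (simp add: sum.If_cases) (simp add: N_def Int_def conj_ac)
      finally show ?thesis using const[of m f g] m True by simp
    next
      case False
      have "?J f h m * cnj (?J g h m') = 0" if "h \<in> PiE S L" for h
        using sep[of f h m g m'] False by auto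
      then show ?thesis using False by (simp add: sum.neutral)
    qed
  qed
  then show ?thesis by blast
qed

lemma decoupled_norm:
  assumes "decoupled (PiE S L) (PiE (- S) L) Q (split_code S J) \<omega>" "m \<in> Q" "m' \<in> Q"
  shows "(\<Sum>b\<in>PiE UNIV L. J b m * cnj (J b m')) = (if m = m' then \<Sum>f\<in>PiE (- S) L. \<omega> f f else 0)"
proof -
  have "(\<Sum>b\<in>PiE UNIV L. J b m * cnj (J b m')) = (\<Sum>f\<in>PiE (- S) L. if m = m' then \<omega> f f else 0)"
    unfolding sum_PiE_UNIV_split[of _ L S]
    by (subst sum.swap) (intro sum.cong refl, use decoupledD[OF assms(1) _ _ assms(2,3)] in auto)
  then show ?thesis by simp
qed

text \<open>Decoupling for any one set already makes the columns of \<open>J\<close> orthogonal and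
  of equal norm; only the norm of column 0 remains to be computed.\<close>

lemma isometry_uniform:
  fixes L :: "'p::finite \<Rightarrow> 'l set" and X :: "nat \<Rightarrow> ('p \<Rightarrow> 'l) set"
  assumes finL: "\<And>p. finite (L p)" and X: "\<And>m. X m \<subseteq> PiE UNIV L" "X 0 \<noteq> {}" and d: "0 < d"
    and dec: "decoupled (PiE S L) (PiE (- S) L) {..<d} (split_code S J) \<omega>"
    and J: "\<And>b m. J b m = (if m < d \<and> b \<in> X m then 1 / of_real (sqrt (card (X 0))) else 0)"
  shows "isometry {..<d} (PiE UNIV L) J"
  unfolding isometry_def
proof (intro conjI allI impI ballI)
  fix b m assume "b \<notin> PiE UNIV L \<or> m \<notin> {..<d}"
  then show "J b m = 0" using X(1)[of m] by (auto simp: J)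
next
  fix m m' assume m: "m \<in> {..<d}" "m' \<in> {..<d}"
  have fin: "finite (PiE UNIV L)" using finL by (rule finite_PiE_type)
  have K: "card (X 0) \<noteq> 0" using finite_subset[OF X(1) fin] X(2) by simp
  have "(\<Sum>b\<in>PiE UNIV L. J b 0 * cnj (J b 0)) = (\<Sum>b\<in>PiE UNIV L. if b \<in> X 0 then 1 / of_nat (card (X 0)) else 0)"
    using d by (intro sum.cong refl) (auto simp: J simp flip: of_real_mult)
  also have "\<dots> = (\<Sum>b\<in>X 0. 1 / of_nat (card (X 0)))"
    using X(1)[of 0] by (intro sum.mono_neutral_cong_right fin) auto
  also have "\<dots> = 1" using K by simp
  finally have "(\<Sum>f\<in>PiE (- S) L. \<omega> f f) = 1" using decoupled_norm[OF dec, of 0 0] d by simp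
  then show "(\<Sum>b\<in>PiE UNIV L. cnj (J b m) * J b m') = (if m = m' then 1 else 0)"
    using decoupled_norm[OF dec m(2,1)] by (auto simp: mult.commute)
qed

section \<open>Modular arithmetic on natural numbers, for shifting shares\<close>

lemma add_mod_inj:
  fixes x y k d :: nat
  assumes "x < d" "y < d" "(x + k) mod d = (y + k) mod d"
  shows "x = y"
proof -
  \<comment> \<open>\<open>d * k - k\<close> stands for the additive inverse of \<open>k\<close>
    modulo \<open>d\<close> on the naturals.\<close>
  have "((x + k) mod d + (d * k - k)) mod d = x" if "x < d" for x
  proof -
    have "((x + k) mod d + (d * k - k)) mod d = (x + k + (d * k - k)) mod d" by (rule mod_add_left_eq)
    also have "x + k + (d * k - k) = x + d * k" using that by (cases d) auto
    finally show ?thesis using that by simp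
  qed
  then show ?thesis using assms by metis
qed

lemma sum_mod_shift:
  fixes x :: "'p \<Rightarrow> nat"
  assumes "finite A" "s \<in> A"
  shows "(\<Sum>p\<in>A. if p = s then (x p + k) mod d else x p) mod d = ((\<Sum>p\<in>A. x p) mod d + k) mod d"
proof -
  have "(\<Sum>p\<in>A. if p = s then (x p + k) mod d else x p) = (x s + k) mod d + (\<Sum>p\<in>A - {s}. x p)"
    using assms by (subst sum.remove[of A s]) (auto intro!: sum.cong)
  then have "(\<Sum>p\<in>A. if p = s then (x p + k) mod d else x p) mod d = (x s + (\<Sum>p\<in>A - {s}. x p) + k) mod d"
    by (simp add: mod_add_left_eq algebra_simps)
  also have "x s + (\<Sum>p\<in>A - {s}. x p) = (\<Sum>p\<in>A. x p)"
    using assms by (simp add: sum.remove[of A s])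
  finally show ?thesis by (simp add: mod_add_left_eq)
qed

text \<open>The share of a party consists of a flag \<open>t \<notin> \<Gamma>\<close>, common to all parties, and of an element of
  \<open>\<int>\<^sub>d\<close> for every set of parties. In the branch of flag \<open>t\<close> the secret is the sum of the
  elements for \<open>A\<close> held by \<open>A\<close>, for every \<open>A\<close> in \<open>\<Gamma>\<close> and also for the complement of \<open>t\<close>. Hence the
  complement of \<open>t\<close> can recover in this branch and \<open>t\<close> learns nothing, while any two
  of these sets intersect.\<close>

locale flagged_code =
  fixes \<Gamma> :: "'b::finite set set" and d :: nat
  assumes UNIV_auth: "UNIV \<in> \<Gamma>"
    and mono: "\<And>S T. S \<in> \<Gamma> \<Longrightarrow> S \<subseteq> T \<Longrightarrow> T \<in> \<Gamma>"
    and meet: "\<And>S T. S \<in> \<Gamma> \<Longrightarrow> T \<in> \<Gamma> \<Longrightarrow> S \<inter> T \<noteq> {}"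
    and d2: "2 \<le> d"
begin

definition labels :: "('b set \<times> ('b set \<Rightarrow> nat)) set" where
  "labels = UNIV \<times> PiE UNIV (\<lambda>_. {..<d})"

definition dim :: nat where "dim = card labels"

definition dec :: "nat \<Rightarrow> 'b set \<times> ('b set \<Rightarrow> nat)" where
  "dec = (SOME f. bij_betw f {..<dim} labels)"

definition enc :: "'b set \<times> ('b set \<Rightarrow> nat) \<Rightarrow> nat" where
  "enc = the_inv_into {..<dim} dec"

abbreviation "flag n \<equiv> fst (dec n)"
abbreviation "piece n \<equiv> snd (dec n)"
abbreviation "loc \<equiv> (\<lambda>_ :: 'b. {..<dim})"

definition groups :: "'b set \<Rightarrow> 'b set set" where "groups t = insert (- t) \<Gamma>"

definition codewords :: "'b set set \<Rightarrow> nat \<Rightarrow> ('b \<Rightarrow> nat) set" where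
  "codewords T m = {b \<in> PiE UNIV loc. \<exists>t\<in>T. (\<forall>p. flag (b p) = t) \<and>
     (\<forall>A\<in>groups t. (\<Sum>p\<in>A. piece (b p) A) mod d = m)}"

lemma finite_labels: "finite labels"
  unfolding labels_def by (intro finite_cartesian_product finite_PiE) auto

lemma dec: "bij_betw dec {..<dim} labels"
  unfolding dec_def dim_def
  using someI_ex[OF ex_bij_betw_nat_finite[OF finite_labels]] by (simp add: atLeast0LessThan)

lemma enc_dec: "n < dim \<Longrightarrow> enc (dec n) = n"
  using dec by (simp add: enc_def bij_betw_def the_inv_into_f_f)

lemma dec_enc: "l \<in> labels \<Longrightarrow> dec (enc l) = l"
  unfolding enc_def using dec by (rule f_the_inv_into_f_bij_betw)

lemma enc_less: "l \<in> labels \<Longrightarrow> enc l < dim"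
  using bij_betw_the_inv_into[OF dec] by (auto simp: enc_def dest: bij_betwE)

lemma piece_less: "n < dim \<Longrightarrow> piece n A < d"
  using dec by (force simp: labels_def PiE_iff dest: bij_betwE)

definition sel :: "'b set \<Rightarrow> 'b set \<Rightarrow> 'b" where "sel S A = (SOME p. p \<in> A \<inter> S)"

text \<open>For every group one member is selected, in \<open>S\<close> when the group meets
  \<open>S\<close>, and only this member adds \<open>k\<close> to its element for the group. All
  sums move by \<open>k\<close> together, while no party outside \<open>S\<close> has to
  act.\<close>

definition shift :: "'b set \<Rightarrow> nat \<Rightarrow> 'b \<Rightarrow> nat \<Rightarrow> nat" where
  "shift S k p n = enc (flag n, \<lambda>A. if A \<in> groups (flag n) \<and> p = sel S A
     then (piece n A + k) mod d else piece n A)"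

lemma sel: "A \<inter> S \<noteq> {} \<Longrightarrow> sel S A \<in> A \<and> sel S A \<in> S"
  unfolding sel_def by (metis (mono_tags, lifting) Int_iff ex_in_conv someI_ex)

lemma shift:
  assumes "n < dim"
  shows shift_less: "shift S k p n < dim"
    and flag_shift: "flag (shift S k p n) = flag n"
    and piece_shift: "piece (shift S k p n) A =
      (if A \<in> groups (flag n) \<and> p = sel S A then (piece n A + k) mod d else piece n A)"
proof -
  have "(flag n, \<lambda>A. if A \<in> groups (flag n) \<and> p = sel S A then (piece n A + k) mod d else piece n A) \<in> labels"
    using piece_less[OF assms] d2 by (auto simp: labels_def)
  note l = enc_less[OF this] dec_enc[OF this]
  show "shift S k p n < dim" "flag (shift S k p n) = flag n" "piece (shift S k p n) A =
      (if A \<in> groups (flag n) \<and> p = sel S A then (piece n A + k) mod d else piece n A)"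
    using l by (simp_all add: shift_def)
qed

lemma shift_inj:
  assumes "n < dim" "n' < dim" "shift S k p n = shift S k p n'"
  shows "n = n'"
proof -
  have f: "flag n = flag n'" using assms flag_shift by metis
  have "piece n A = piece n' A" for A
  proof (cases "A \<in> groups (flag n) \<and> p = sel S A")
    case True
    then have "(piece n A + k) mod d = (piece n' A + k) mod d"
      using piece_shift[OF assms(1), of S k p A] piece_shift[OF assms(2), of S k p A] assms(3) f by simp
    then show ?thesis using add_mod_inj piece_less[OF assms(1)] piece_less[OF assms(2)] by blast
  next
    case False
    then show ?thesis
      using piece_shift[OF assms(1), of S k p A] piece_shift[OF assms(2), of S k p A] assms(3) f
      by (metis (full_types))
  qed
  then have "dec n = dec n'" using f by (simp add: prod_eq_iff fun_eq_iff)
  then show ?thesis using assms enc_dec by metis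
qed

text \<open>What lets \<open>S\<close> recover in every branch with flag in \<open>T\<close>: being
  a group, it reads the secret; meeting every group, it can shift the secret; being nonempty, it can
  read the flag.\<close>

definition hits :: "'b set set \<Rightarrow> 'b set \<Rightarrow> bool" where
  "hits T S \<longleftrightarrow> S \<noteq> {} \<and> (\<forall>t\<in>T. S \<in> groups t \<and> (\<forall>A\<in>groups t. A \<inter> S \<noteq> {}))"

lemma shift_outside:
  assumes "hits T S" "flag n \<in> T" "n < dim" "p \<notin> S"
  shows "shift S k p n = n"
proof -
  have "piece (shift S k p n) A = piece n A" for A
  proof -
    have "\<not> (A \<in> groups (flag n) \<and> p = sel S A)"
      using assms sel[of A S] unfolding hits_def by blast
    then show ?thesis unfolding piece_shift[OF assms(3)] by (simp only: if_False)
  qed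
  then have "piece (shift S k p n) = piece n" by blast
  then have "dec (shift S k p n) = dec n"
    using flag_shift[OF assms(3)] by (simp add: prod_eq_iff)
  then show ?thesis using enc_dec shift_less[OF assms(3)] assms(3) by metis
qed

lemma codewords_shift:
  assumes "hits T S" "b \<in> codewords T m"
  shows "(\<lambda>p. shift S k p (b p)) \<in> codewords T ((m + k) mod d)"
proof -
  obtain t where t': "t \<in> T" "\<forall>p. flag (b p) = t" "\<forall>A\<in>groups t. (\<Sum>p\<in>A. piece (b p) A) mod d = m"
    using assms(2) unfolding codewords_def by blast
  have "b p < dim" for p using assms(2) by (auto simp: codewords_def)
  note t = t'(1) t'(2)[rule_format] this t'(3)[rule_format]
  have "(\<Sum>p\<in>A. piece (shift S k p (b p)) A) mod d = (m + k) mod d" if A: "A \<in> groups t" for A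
  proof -
    have s: "sel S A \<in> A" using assms(1) t(1) A sel unfolding hits_def by blast
    have "piece (shift S k p (b p)) A = (if p = sel S A then (piece (b p) A + k) mod d else piece (b p) A)" for p
      using A by (simp add: piece_shift t)
    then show ?thesis using sum_mod_shift[OF _ s, of "\<lambda>p. piece (b p) A" k d] t(4)[OF A] by simp
  qed
  then show ?thesis using t by (auto simp: codewords_def shift_less flag_shift)
qed

text \<open>The normalisation is that of the full code for every \<open>T\<close>, so that the
  amplitudes of disjoint sets of flags add up; a single branch carries only a part of the norm in
  general.\<close>

definition amp :: "'b set set \<Rightarrow> ('b \<Rightarrow> nat, nat) lin" where
  "amp T b m = (if m < d \<and> b \<in> codewords T m
     then 1 / of_real (sqrt (card (codewords (- \<Gamma>) 0))) else 0)"

lemma codeword_secret: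
  assumes "hits T S" "override_on f h S \<in> codewords T m" "override_on g h S \<in> codewords T m'"
  shows "m = m'"
proof -
  obtain t where t: "t \<in> T" "\<And>p. flag (override_on f h S p) = t"
    "\<And>A. A \<in> groups t \<Longrightarrow> (\<Sum>p\<in>A. piece (override_on f h S p) A) mod d = m"
    using assms(2) by (auto simp: codewords_def)
  obtain t' where t': "t' \<in> T" "\<And>p. flag (override_on g h S p) = t'"
    "\<And>A. A \<in> groups t' \<Longrightarrow> (\<Sum>p\<in>A. piece (override_on g h S p) A) mod d = m'"
    using assms(3) by (auto simp: codewords_def)
  obtain p where p: "p \<in> S" using assms(1) by (auto simp: hits_def)
  have "t = t'" using t(2)[of p] t'(2)[of p] p by simp
  moreover have "S \<in> groups t" using assms(1) t(1) by (simp add: hits_def)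
  ultimately show ?thesis using t(3)[of S] t'(3)[of S] by simp
qed

lemma decoupled_amp:
  assumes hits: "hits T S"
  shows "\<exists>\<omega>. decoupled (PiE S loc) (PiE (- S) loc) {..<d} (\<lambda>h f m. amp T (override_on f h S) m) \<omega>"
  unfolding amp_def
proof (rule decoupled_uniform[where sh = "shift S"])
  show "inj_on (shift S k p) (loc p)" for k p using shift_inj by (auto simp: inj_on_def)
  show "shift S k p (b p) = b p" if "b \<in> codewords T m" "p \<notin> S" for k b m p
  proof (rule shift_outside[OF hits _ _ that(2)])
    show "flag (b p) \<in> T" "b p < dim" using that(1) by (auto simp: codewords_def)
  qed
qed (use codewords_shift[OF hits] in \<open>auto simp: shift_less intro: codeword_secret[OF hits]\<close>)

lemma codewords_0: "t \<in> T \<Longrightarrow> codewords T 0 \<noteq> {}"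
proof -
  assume t: "t \<in> T"
  have l: "(t, \<lambda>_. 0) \<in> labels" using d2 by (simp add: labels_def PiE_iff)
  have "(\<lambda>_. enc (t, \<lambda>_. 0)) \<in> codewords T 0"
    using enc_less[OF l] dec_enc[OF l] t by (auto simp: codewords_def)
  then show ?thesis by blast
qed

lemma finite_codewords: "finite (codewords T m)"
  unfolding codewords_def by (rule finite_subset[OF _ finite_PiE_type[of loc UNIV]]) auto

lemma empty_unauth: "{} \<notin> \<Gamma>" using meet by blast

text \<open>If \<open>S\<close> missed the complement of an unauthorized \<open>t\<close>, it would
  lie inside \<open>t\<close>, and monotonicity would authorize \<open>t\<close>.\<close>

lemma hits_auth: "S \<in> \<Gamma> \<Longrightarrow> hits (- \<Gamma>) S"
proof -
  assume S: "S \<in> \<Gamma>"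
  have "- t \<inter> S \<noteq> {}" if "t \<notin> \<Gamma>" for t
    using mono[OF S, of t] that by auto
  then show ?thesis using S meet[OF _ S] empty_unauth by (auto simp: hits_def groups_def)
qed

lemma hits_unauth: "S \<notin> \<Gamma> \<Longrightarrow> hits {S} (- S)"
proof -
  assume S: "S \<notin> \<Gamma>"
  have "A \<inter> - S \<noteq> {}" if "A \<in> \<Gamma>" for A using mono[OF that, of S] S by auto
  moreover have "- S \<noteq> {}" using S UNIV_auth by (metis Compl_empty_eq double_complement)
  ultimately show ?thesis by (auto simp: hits_def groups_def)
qed

lemma isometry_amp: "isometry {..<d} (PiE UNIV loc) (amp (- \<Gamma>))"
proof -
  obtain \<omega> where "decoupled (PiE UNIV loc) (PiE (- UNIV) loc) {..<d} (split_code UNIV (amp (- \<Gamma>))) \<omega>"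
    using decoupled_amp[OF hits_auth[OF UNIV_auth]] by blast
  then show ?thesis
    by (rule isometry_uniform[where X = "codewords (- \<Gamma>)", rotated 4])
      (use codewords_0[of "{}" "- \<Gamma>"] empty_unauth d2 in \<open>auto simp: amp_def codewords_def\<close>)
qed

text \<open>In the branch flagged \<open>S\<close> the roles are exchanged: \<open>- S\<close> is a
  group and recovers, so \<open>S\<close> is the environment of a decoupled code. The trace of
  \<omega> is the weight of this branch for secret 0, which is nonzero because the branch contains a
  codeword.\<close>

lemma unauth_branch:
  assumes "S \<notin> \<Gamma>"
  obtains \<omega> where "decoupled (PiE (- S) loc) (PiE S loc) {..<d} (\<lambda>h f e. amp {S} (override_on h f S) e) \<omega>"
    "(\<Sum>f\<in>PiE S loc. \<omega> f f) \<noteq> 0"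
proof -
  have ov: "override_on f h (- S) = override_on h f S" for f h :: "'b \<Rightarrow> nat"
    by (auto simp: override_on_def fun_eq_iff)
  obtain \<omega> where \<omega>: "decoupled (PiE (- S) loc) (PiE S loc) {..<d} (\<lambda>h f e. amp {S} (override_on h f S) e) \<omega>"
    using decoupled_amp[OF hits_unauth[OF assms]] by (auto simp: ov)
  have "(\<Sum>f\<in>PiE S loc. \<omega> f f) = (\<Sum>f\<in>PiE S loc. \<Sum>h\<in>PiE (- S) loc.
      amp {S} (override_on h f S) 0 * cnj (amp {S} (override_on h f S) 0))"
    using decoupledD[OF \<omega>] d2 by simp
  also have "\<dots> = (\<Sum>b\<in>PiE UNIV loc. amp {S} b 0 * cnj (amp {S} b 0))"
    by (rule sum_PiE_UNIV_split[symmetric])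
  finally have sum: "(\<Sum>f\<in>PiE S loc. \<omega> f f) = (\<Sum>b\<in>PiE UNIV loc. amp {S} b 0 * cnj (amp {S} b 0))" .
  obtain b where b: "b \<in> codewords {S} 0" using codewords_0[of S "{S}"] by auto
  then have b': "b \<in> PiE UNIV loc" by (simp add: codewords_def)
  have fin: "finite (PiE UNIV loc)" by (rule finite_PiE_type) simp
  have K: "card (codewords (- \<Gamma>) 0) \<noteq> 0" using codewords_0[of "{}" "- \<Gamma>"] empty_unauth finite_codewords by simp
  have "(\<Sum>f\<in>PiE S loc. \<omega> f f) \<noteq> 0"
  proof
    assume "(\<Sum>f\<in>PiE S loc. \<omega> f f) = 0"
    then have "amp {S} b 0 * cnj (amp {S} b 0) = 0"
      using nonneg_Reals_sum_0[OF fin _ _ b', of "\<lambda>b. amp {S} b 0 * cnj (amp {S} b 0)"] sum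
      by (simp add: cnj_mult_self_nonneg)
    then show False using b K d2 by (simp add: amp_def)
  qed
  then show ?thesis using \<omega> that by blast
qed

text \<open>Since \<open>UNIV\<close> is authorized, some party lies outside \<open>S\<close>. It
  holds the flag as well, and there the two branches disagree; hence the cross terms vanish.\<close>

lemma amp_split:
  assumes "S \<notin> \<Gamma>"
  shows "amp (- \<Gamma>) b m = amp {S} b m + amp (- \<Gamma> - {S}) b m"
    and "f \<in> PiE S loc \<Longrightarrow> g \<in> PiE S loc \<Longrightarrow> h \<in> PiE (- S) loc \<Longrightarrow>
      amp {S} (override_on h f S) m * cnj (amp (- \<Gamma> - {S}) (override_on h g S) m') = 0"
proof -
  show "amp (- \<Gamma>) b m = amp {S} b m + amp (- \<Gamma> - {S}) b m"
    using assms by (auto simp: amp_def codewords_def)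
  obtain p where p: "p \<notin> S" using assms UNIV_auth by (metis UNIV_eq_I)
  show "amp {S} (override_on h f S) m * cnj (amp (- \<Gamma> - {S}) (override_on h g S) m') = 0"
  proof (rule ccontr)
    assume "\<not> ?thesis"
    then have "override_on h f S \<in> codewords {S} m" "override_on h g S \<in> codewords (- \<Gamma> - {S}) m'"
      by (auto simp: amp_def split: if_splits)
    then have "flag (override_on h f S p) = S" "flag (override_on h g S p) \<noteq> S"
      by (auto simp: codewords_def)
    then show False using p by simp
  qed
qed

lemma amp_outside: "b \<notin> PiE UNIV loc \<Longrightarrow> amp T b m = 0"
  by (simp add: amp_def codewords_def)

lemma recovers_amp_iff: "recovers loc (lin_range {..<d} (amp (- \<Gamma>))) S \<longleftrightarrow> S \<in> \<Gamma>"
proof (cases "S \<in> \<Gamma>")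
  case True
  have ov: "(\<lambda>h f m. amp (- \<Gamma>) (override_on f h S) m) = split_code S (amp (- \<Gamma>))" ..
  show ?thesis
    using recovers_iff_decoupled[OF isometry_amp, of 0 S] decoupled_amp[OF hits_auth[OF True]] d2 True
    by simp
next
  case False
  obtain \<omega> where \<omega>: "decoupled (PiE (- S) loc) (PiE S loc) {..<d} (\<lambda>h f e. amp {S} (override_on h f S) e) \<omega>"
    "(\<Sum>f\<in>PiE S loc. \<omega> f f) \<noteq> 0" using unauth_branch[OF False] .
  have "\<not> recovers loc (lin_range {..<d} (amp (- \<Gamma>))) S"
    by (rule not_recovers[where ?W1.0 = "amp {S}" and ?W2.0 = "amp (- \<Gamma> - {S})" and x = 0 and y = 1,
          OF _ _ amp_split(1)[OF False] amp_outside amp_outside amp_split(2)[OF False] \<omega> isometry_amp])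
      (use d2 in auto)
  then show ?thesis using False by simp
qed

lemma not_can_extract_amp:
  assumes "S \<notin> \<Gamma>" "2 \<le> (q :: nat)"
  shows "\<not> can_extract {..<q} {..<d} loc (amp (- \<Gamma>)) S"
proof -
  obtain \<omega> where \<omega>: "decoupled (PiE (- S) loc) (PiE S loc) {..<d} (\<lambda>h f e. amp {S} (override_on h f S) e) \<omega>"
    "(\<Sum>f\<in>PiE S loc. \<omega> f f) \<noteq> 0" using unauth_branch[OF assms(1)] .
  show ?thesis
    by (rule not_can_extract[where ?W1.0 = "amp {S}" and ?W2.0 = "amp (- \<Gamma> - {S})" and x = 0 and y = 1,
          OF _ _ amp_split(1)[OF assms(1)] amp_outside amp_outside amp_split(2)[OF assms(1)] \<omega>])
      (use assms in auto)
qed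

end

text \<open>The dimension \<open>d\<close> is free, so that the code can be fitted to a given E_i.
  One code serves all \<open>q\<close>, because the obstruction only compares two secrets.\<close>

theorem tight_code_exists:
  fixes \<Gamma> :: "'b::finite set set"
  assumes "valid_access_structure \<Gamma>" "2 \<le> (d :: nat)"
  obtains dB :: "'b \<Rightarrow> nat" and W where "isometry {..<d} (cfg dB) W"
    "qss_code {..<d} (\<lambda>k. {..<dB k}) (lin_range {..<d} W) \<Gamma>"
    "\<And>(q :: nat) S. 2 \<le> q \<Longrightarrow> S \<notin> \<Gamma> \<Longrightarrow> \<not> can_extract {..<q} {..<d} (\<lambda>k. {..<dB k}) W S"
proof -
  interpret flagged_code \<Gamma> d
    using valid_access_structureD[OF assms(1)] assms(2) by unfold_locales auto
  have "qss_code {..<d} loc (lin_range {..<d} (amp (- \<Gamma>))) \<Gamma>"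
    using isometry_amp recovers_amp_iff by (auto simp: qss_code_def code_for_def)
  then show ?thesis using that[OF isometry_amp] not_can_extract_amp by auto
qed

section \<open>Existence of a first layer\<close>

lemma app_conj_by:
  "app Y (conj_by X K \<rho>) w = app X K (app X \<rho> (app Y (\<lambda>x y. cnj (K y x)) w))"
proof
  fix y
  have "app Y (conj_by X K \<rho>) w y = (\<Sum>y'\<in>Y. \<Sum>x\<in>X. \<Sum>x'\<in>X. K y x * (\<rho> x x' * (cnj (K y' x') * w y')))"
    by (simp add: app_def conj_by_def sum_distrib_right mult.assoc)
  also have "\<dots> = (\<Sum>x\<in>X. \<Sum>x'\<in>X. \<Sum>y'\<in>Y. K y x * (\<rho> x x' * (cnj (K y' x') * w y')))"
    by (subst sum.swap, intro sum.cong refl, rule sum.swap)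
  also have "\<dots> = app X K (app X \<rho> (app Y (\<lambda>x y. cnj (K y x)) w)) y"
    by (simp add: app_def sum_distrib_left)
  finally show "app Y (conj_by X K \<rho>) w y = app X K (app X \<rho> (app Y (\<lambda>x y. cnj (K y x)) w)) y" .
qed

lemma inner_on_adjoint_right:
  "inner_on Y w (app X K v) = inner_on X (app Y (\<lambda>x y. cnj (K y x)) w) v"
  by (simp add: inner_on_adjoint)

text \<open>The kernel of the conjugated operator is the preimage of the kernel of \<rho> under the
  adjoint of \<open>K\<close>. It contains everything orthogonal to the range of \<open>K\<close>,
  so the support lies inside the range.\<close>

lemma support_of_conj_by:
  assumes K: "isometry X Y K" and fin: "finite X" "finite Y" and \<rho>: "\<rho> \<in> opers X"
  shows "support_of Y (conj_by X K \<rho>) = app X K ` support_of X \<rho>"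
proof -
  let ?K' = "\<lambda>x y. cnj (K y x)"
  have K'_kets: "app Y ?K' w \<in> kets X" for w
    using isometry_outside[OF K] by (intro app_kets) auto
  have K_kets: "app X K v \<in> kets Y" for v
    using isometry_outside[OF K] by (intro app_kets) auto
  have \<rho>_kets: "app X \<rho> v \<in> kets X" for v
    using opers_outside[OF \<rho>] by (intro app_kets) auto
  have zero: "app Z M (\<lambda>_. 0) = (\<lambda>_. 0)" for Z and M :: "'c \<Rightarrow> 'd \<Rightarrow> complex" by (simp add: app_def)
  have inv: "app Y ?K' (app X K v) = v" if "v \<in> kets X" for v
    by (rule isometry_adjoint_app[OF K fin(1) that])
  have ker: "app Y (conj_by X K \<rho>) w = (\<lambda>_. 0) \<longleftrightarrow> app X \<rho> (app Y ?K' w) = (\<lambda>_. 0)" for w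
    unfolding app_conj_by using inv[OF \<rho>_kets, of "app Y ?K' w"] zero by metis
  show ?thesis
  proof (intro equalityI subsetI)
    fix v assume v: "v \<in> support_of Y (conj_by X K \<rho>)"
    let ?u = "app Y ?K' v"
    have "?u \<in> support_of X \<rho>"
      unfolding support_of_def
    proof (intro CollectI conjI ballI impI K'_kets)
      fix w assume w: "w \<in> kets X" "app X \<rho> w = (\<lambda>_. 0)"
      then have "app Y (conj_by X K \<rho>) (app X K w) = (\<lambda>_. 0)" by (simp add: ker inv)
      then show "inner_on X w ?u = 0"
        using v K_kets by (simp add: support_of_def inner_on_adjoint[symmetric])
    qed
    moreover have "v = app X K ?u"
    proof
      fix y
      show "v y = app X K ?u y"
      proof (cases "y \<in> Y")
        case True
        \<comment> \<open>The part of a basis ket orthogonal to the range of \<open>K\<close>.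
          Pairing \<open>v\<close> with it compares the coordinate of \<open>v\<close> with that of
          its projection.\<close>
        define w where "w = (\<lambda>z. basis_ket y z - app X K (app Y ?K' (basis_ket y)) z)"
        have sub: "app Y M w = (\<lambda>z. app Y M (basis_ket y) z - app Y M (app X K (app Y ?K' (basis_ket y))) z)" for M :: "('a, 'b) lin"
          by (simp add: w_def app_def right_diff_distrib sum_subtractf)
        have "app Y ?K' w = (\<lambda>_. 0)"
          unfolding sub by (simp add: inv[OF K'_kets])
        then have "app Y (conj_by X K \<rho>) w = (\<lambda>_. 0)" by (simp add: ker zero)
        moreover have "w \<in> kets Y"
          using basis_ket_kets[OF True] K_kets[of "app Y ?K' (basis_ket y)"] by (simp add: w_def kets_def)
        ultimately have "inner_on Y w v = 0" using v by (simp add: support_of_def)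
        then have "inner_on Y (basis_ket y) v = inner_on Y (app X K (app Y ?K' (basis_ket y))) v"
          by (simp add: w_def inner_on_def left_diff_distrib sum_subtractf)
        also have "\<dots> = inner_on Y (basis_ket y) (app X K ?u)"
          by (rule trans[OF inner_on_adjoint inner_on_adjoint_right[symmetric]])
        finally show ?thesis using True fin by (simp add: inner_on_basis_ket)
      next
        case False
        then show ?thesis using v K_kets[of ?u] by (simp add: support_of_def kets_def)
      qed
    qed
    ultimately show "v \<in> app X K ` support_of X \<rho>" by blast
  next
    fix v assume "v \<in> app X K ` support_of X \<rho>"
    then obtain u where u: "u \<in> support_of X \<rho>" "v = app X K u" by blast
    then show "v \<in> support_of Y (conj_by X K \<rho>)"
      using K_kets K'_kets by (auto simp: support_of_def ker inner_on_adjoint_right)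
  qed
qed

lemma id_op_opers: "id_op X \<in> opers X"
  by (auto simp: id_op_def opers_def)

lemma support_of_id_op: "finite X \<Longrightarrow> support_of X (id_op X) = kets X"
proof -
  assume "finite X"
  then have "app X (id_op X) w = w" if "w \<in> kets X" for w
    using app_identity[OF _ that] app_cong[of X "id_op X" "\<lambda>y x. if y = x then 1 else 0" w]
    by (auto simp: id_op_def)
  then show ?thesis by (auto simp: support_of_def inner_on_def)
qed

lemma support_of_code:
  assumes "isometry Q Y J" "finite Q" "finite Y"
  shows "support_of Y (conj_by Q J (id_op Q)) = lin_range Q J"
  using support_of_conj_by[OF assms id_op_opers] assms by (simp add: support_of_id_op lin_range_def)

lemma support_of_scale:
  assumes "c \<noteq> 0"
  shows "support_of Y (\<lambda>y y'. c * \<rho> y y') = support_of Y \<rho>"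
proof -
  have "app Y (\<lambda>y y'. c * \<rho> y y') w = (\<lambda>_. 0) \<longleftrightarrow> app Y \<rho> w = (\<lambda>_. 0)" for w
    using assms by (simp add: app_def fun_eq_iff mult.assoc sum_distrib_left[symmetric])
  then show ?thesis by (simp add: support_of_def)
qed

lemma decoupled_scale:
  assumes "decoupled S C Q J \<omega>"
  shows "decoupled S C Q (\<lambda>s c m. a * J s c m) (\<lambda>c c'. a * cnj a * \<omega> c c')"
  unfolding decoupled_def
proof (intro ballI)
  fix c c' m m' assume *: "c \<in> C" "c' \<in> C" "m \<in> Q" "m' \<in> Q"
  have "(\<Sum>s\<in>S. a * J s c m * cnj (a * J s c' m')) = a * cnj a * (\<Sum>s\<in>S. J s c m * cnj (J s c' m'))"
    by (simp add: sum_distrib_left mult_ac)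
  then show "(\<Sum>s\<in>S. a * J s c m * cnj (a * J s c' m')) = (if m = m' then a * cnj a * \<omega> c c' else 0)"
    using decoupledD[OF assms *] by simp
qed

lemma conj_by_scale: "conj_by X (\<lambda>y x. a * K y x) \<rho> = (\<lambda>y y'. a * cnj a * conj_by X K \<rho> y y')"
  by (simp add: conj_by_def sum_distrib_left mult_ac)

lemma reduce_scale: "reduce L S (\<lambda>b b'. a * \<rho> b b') = (\<lambda>f g. a * reduce L S \<rho> f g)"
  by (simp add: reduce_def sum_distrib_left fun_eq_iff)

lemma trace_reduce:
  fixes L :: "'p::finite \<Rightarrow> 'l set"
  shows "(\<And>p. finite (L p)) \<Longrightarrow> \<rho> \<in> opers (PiE UNIV L) \<Longrightarrow>
    trace_on (PiE S L) (reduce L S \<rho>) = trace_on (PiE UNIV L) \<rho>"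
  by (rule channel_trace[OF channel_reduce])

text \<open>Decoupling makes a single Kraus operator a multiple of an isometry \<open>J\<close>, so
  that the subspace and the state are governed by the same code. For rank-one measurements both
  clauses of classical assistance therefore follow together.\<close>

lemma pure_branch:
  fixes L :: "'p::finite \<Rightarrow> 'l set"
  assumes fin: "finite Q" "\<And>p. finite (L p)" and q0: "q0 \<in> Q"
    and out: "\<And>b m. b \<notin> PiE UNIV L \<or> m \<notin> Q \<Longrightarrow> Y b m = 0"
    and dec: "decoupled (PiE S L) (PiE (- S) L) Q (split_code S Y) \<omega>"
    and nz: "conj_by Q Y (id_op Q) \<noteq> (\<lambda>_ _. 0)"
  shows "authorizing_code Q L (support_of (PiE UNIV L) (conj_by Q Y (id_op Q))) {S}"
    and "secret_recoverable Q (PiE S L) (\<lambda>\<rho>. reduce L S (conj_by Q Y \<rho>))"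
proof -
  have finL: "finite (PiE UNIV L)" using fin(2) by (rule finite_PiE_type)
  define \<kappa> where "\<kappa> = (\<Sum>f\<in>PiE (- S) L. \<omega> f f)"
  have norm: "(\<Sum>b\<in>PiE UNIV L. Y b m * cnj (Y b m')) = (if m = m' then \<kappa> else 0)" if "m \<in> Q" "m' \<in> Q" for m m'
    unfolding \<kappa>_def by (rule decoupled_norm[OF dec that])
  have "\<kappa> \<in> \<real>\<^sub>\<ge>\<^sub>0"
    using norm[OF q0 q0] nonneg_Reals_sum[of "PiE UNIV L" "\<lambda>b. Y b q0 * cnj (Y b q0)"]
    by (simp add: cnj_mult_self_nonneg)
  then obtain r where r: "\<kappa> = of_real r" "0 \<le> r" by (auto elim: nonneg_Reals_cases)
  have "\<kappa> \<noteq> 0"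
  proof
    assume "\<kappa> = 0"
    have "Y b m = 0" for b m
    proof (cases "b \<in> PiE UNIV L \<and> m \<in> Q")
      case True
      then have "Y b m * cnj (Y b m) = 0"
        using norm[of m m] \<open>\<kappa> = 0\<close> nonneg_Reals_sum_0[OF finL, of "\<lambda>b. Y b m * cnj (Y b m)" b]
        by (simp add: cnj_mult_self_nonneg)
      then show ?thesis by simp
    qed (use out in blast)
    then show False using nz by (simp add: conj_by_def)
  qed
  define s where "s = complex_of_real (sqrt r)"
  have s: "s * cnj s = \<kappa>" "s \<noteq> 0" using r \<open>\<kappa> \<noteq> 0\<close> by (auto simp: s_def simp flip: of_real_mult)
  define J where "J b m = (1 / s) * Y b m" for b m
  have Y: "Y = (\<lambda>b m. s * J b m)" using s by (simp add: J_def fun_eq_iff)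
  have iso: "isometry Q (PiE UNIV L) J"
    unfolding isometry_def
  proof (intro conjI allI impI ballI)
    fix m m' assume m: "m \<in> Q" "m' \<in> Q"
    have "(\<Sum>b\<in>PiE UNIV L. cnj (J b m) * J b m') = (\<Sum>b\<in>PiE UNIV L. Y b m' * cnj (Y b m)) / \<kappa>"
      by (simp add: J_def sum_divide_distrib flip: s(1)) (simp add: mult_ac)
    then show "(\<Sum>b\<in>PiE UNIV L. cnj (J b m) * J b m') = (if m = m' then 1 else 0)"
      using norm[OF m(2,1)] \<open>\<kappa> \<noteq> 0\<close> by auto
  qed (use out in \<open>auto simp: J_def\<close>)
  have B: "conj_by Q Y \<rho> = (\<lambda>b b'. \<kappa> * conj_by Q J \<rho> b b')" for \<rho>
    unfolding Y conj_by_scale s(1) ..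
  have supp: "support_of (PiE UNIV L) (conj_by Q Y (id_op Q)) = lin_range Q J"
    unfolding B support_of_scale[OF \<open>\<kappa> \<noteq> 0\<close>] by (rule support_of_code[OF iso fin(1) finL])
  have "decoupled (PiE S L) (PiE (- S) L) Q (split_code S J) (\<lambda>c c'. (1 / s) * cnj (1 / s) * \<omega> c c')"
    unfolding J_def by (rule decoupled_scale[OF dec])
  then have rec: "recovers L (lin_range Q J) S"
    using recovers_iff_decoupled[OF iso fin q0] by blast
  then show "authorizing_code Q L (support_of (PiE UNIV L) (conj_by Q Y (id_op Q))) {S}"
    unfolding supp authorizing_code_def code_for_def using iso by blast
  obtain D where D: "channel (PiE S L) Q D" "\<And>\<sigma>. \<sigma> \<in> opers Q \<Longrightarrow> D (reduce L S (conj_by Q J \<sigma>)) = \<sigma>"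
    using rec recovers_iff_decoder[OF iso fin q0] by blast
  have "D (reduce L S (conj_by Q Y \<rho>)) = (\<lambda>m m'. trace_on (PiE S L) (reduce L S (conj_by Q Y \<rho>)) * \<rho> m m')"
    if "state Q \<rho>" for \<rho>
  proof -
    have \<rho>: "\<rho> \<in> opers Q" "trace_on Q \<rho> = 1" using that by (auto simp: state_def positive_op_opers)
    have J\<rho>: "conj_by Q J \<rho> \<in> opers (PiE UNIV L)" by (rule channel_opers[OF channel_isometry[OF iso fin(1)] \<rho>(1)])
    have "trace_on (PiE S L) (reduce L S (conj_by Q J \<rho>)) = 1"
      using trace_reduce[where L = L, OF fin(2) J\<rho>] channel_trace[OF channel_isometry[OF iso fin(1)] \<rho>(1)] \<rho>(2) by simp
    then show ?thesis
      using channel_scale[OF D(1) reduce_opers] D(2)[OF \<rho>(1)]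
      by (simp add: B reduce_scale trace_on_def sum_distrib_left[symmetric])
  qed
  then show "secret_recoverable Q (PiE S L) (\<lambda>\<rho>. reduce L S (conj_by Q Y \<rho>))"
    unfolding secret_recoverable_def using D(1) by blast
qed

text \<open>Each vector of a factored measurement operator contributes one Kraus operator: its
  partial inner product with the helper's part of \<open>V\<close>.\<close>

lemma helper_branch_factor:
  "helper_branch q dA V (\<lambda>x y. \<Sum>k\<in>I. \<xi> k x * cnj (\<xi> k y)) \<rho> =
   (\<lambda>e e'. \<Sum>k\<in>I. conj_by {..<q} (\<lambda>e m. \<Sum>a<dA. cnj (\<xi> k a) * V (join a e) m) \<rho> e e')"
proof (intro ext)
  fix e e'
  have "helper_branch q dA V (\<lambda>x y. \<Sum>k\<in>I. \<xi> k x * cnj (\<xi> k y)) \<rho> e e'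
     = (\<Sum>a<dA. \<Sum>a'<dA. \<Sum>k\<in>I. \<Sum>m<q. \<Sum>m'<q. cnj (\<xi> k a') * V (join a' e) m * \<rho> m m' * (\<xi> k a * cnj (V (join a e') m')))"
    by (simp only: helper_branch_def measured_def case_prod_conv sum_distrib_right)
      (simp add: conj_by_def sum_distrib_left mult_ac)
  also have "\<dots> = (\<Sum>k\<in>I. \<Sum>a<dA. \<Sum>a'<dA. \<Sum>m<q. \<Sum>m'<q. cnj (\<xi> k a') * V (join a' e) m * \<rho> m m' * (\<xi> k a * cnj (V (join a e') m')))"
    by (subst (2) sum.swap, rule sum.cong[OF refl], rule sum.swap)
  also have "\<dots> = (\<Sum>k\<in>I. conj_by {..<q} (\<lambda>e m. \<Sum>a<dA. cnj (\<xi> k a) * V (join a e) m) \<rho> e e')"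
  proof (rule sum.cong[OF refl])
    fix k
    have "(\<Sum>a<dA. \<Sum>a'<dA. \<Sum>m<q. \<Sum>m'<q. cnj (\<xi> k a') * V (join a' e) m * \<rho> m m' * (\<xi> k a * cnj (V (join a e') m')))
      = (\<Sum>m<q. \<Sum>m'<q. \<Sum>a<dA. \<Sum>a'<dA. cnj (\<xi> k a') * V (join a' e) m * \<rho> m m' * (\<xi> k a * cnj (V (join a e') m')))"
      by (rule sum_swap_pairs)
    also have "\<dots> = conj_by {..<q} (\<lambda>e m. \<Sum>a<dA. cnj (\<xi> k a) * V (join a e) m) \<rho> e e'"
      unfolding conj_by_def
      by (intro sum.cong refl) (subst sum.swap, simp add: sum_distrib_left sum_distrib_right mult_ac)
    finally show "(\<Sum>a<dA. \<Sum>a'<dA. \<Sum>m<q. \<Sum>m'<q. cnj (\<xi> k a') * V (join a' e) m * \<rho> m m' * (\<xi> k a * cnj (V (join a e') m')))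
      = conj_by {..<q} (\<lambda>e m. \<Sum>a<dA. cnj (\<xi> k a) * V (join a e) m) \<rho> e e'" .
  qed
  finally show "helper_branch q dA V (\<lambda>x y. \<Sum>k\<in>I. \<xi> k x * cnj (\<xi> k y)) \<rho> e e' =
    (\<Sum>k\<in>I. conj_by {..<q} (\<lambda>e m. \<Sum>a<dA. cnj (\<xi> k a) * V (join a e) m) \<rho> e e')" .
qed

section \<open>Residues and characters of the cyclic group of order \<open>q\<close>\<close>

lemma add_mod_eq_iff:
  fixes x e m q :: nat
  assumes "x < q" "e < q" "m < q"
  shows "(x + e) mod q = m \<longleftrightarrow> x = (m + (q - e)) mod q"
proof
  assume "(x + e) mod q = m"
  then have "(m + (q - e)) mod q = (x + e + (q - e)) mod q" by (metis mod_add_left_eq)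
  also have "x + e + (q - e) = x + q" using assms by simp
  finally show "x = (m + (q - e)) mod q" using assms by simp
next
  assume "x = (m + (q - e)) mod q"
  then have "(x + e) mod q = (m + (q - e) + e) mod q" by (metis mod_add_left_eq)
  also have "m + (q - e) + e = m + q" using assms by simp
  finally show "(x + e) mod q = m" using assms by simp
qed

lemma cis_2pi_of_int: "cis (2 * pi * of_int n) = 1"
  by (simp add: complex_eq_iff sin_times_pi_eq_0 cos_int_2pin sin_int_2pin)

lemma cis_mod:
  fixes w n q :: nat
  assumes "q > 0"
  shows "cis (2 * pi * real w * real (n mod q) / real q) = cis (2 * pi * real w * real n / real q)"
proof -
  have n: "real n = real q * real (n div q) + real (n mod q)"
    by (metis mult_div_mod_eq of_nat_add of_nat_mult)
  have "2 * pi * real w * real n / real q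
     = 2 * pi * real_of_int (int (w * (n div q))) + 2 * pi * real w * real (n mod q) / real q"
    using assms by (subst n) (simp add: field_simps)
  then have "cis (2 * pi * real w * real n / real q)
     = cis (2 * pi * real_of_int (int (w * (n div q)))) * cis (2 * pi * real w * real (n mod q) / real q)"
    by (simp only: cis_mult)
  then show ?thesis by (simp only: cis_2pi_of_int mult_1)
qed

lemma cis_sum_orthogonal:
  fixes a b q :: nat
  assumes "a < q" "b < q"
  shows "(\<Sum>x<q. cis (2 * pi * real x * real a / real q) * cnj (cis (2 * pi * real x * real b / real q)))
     = (if a = b then of_nat q else 0)"
proof (cases "a = b")
  case True
  then show ?thesis by (simp add: cis_cnj cis_mult)
next
  case False
  \<comment> \<open>The ratio of the two characters, a \<open>q\<close>-th root of unity other than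
    1, so that its geometric sum vanishes.\<close>
  define z where "z = cis (2 * pi * (real a - real b) / real q)"
  have q: "real q \<noteq> 0" using assms by simp
  have pow: "cis (2 * pi * real x * real a / real q) * cnj (cis (2 * pi * real x * real b / real q)) = z ^ x" for x
    using q by (simp add: z_def cis_cnj cis_mult Complex.DeMoivre field_simps)
  have "z \<noteq> 1"
  proof
    assume "z = 1"
    then have "cos (2 * pi * (real a - real b) / real q) = 1" by (simp add: z_def complex_eq_iff)
    then obtain n :: int where "2 * pi * (real a - real b) / real q = of_int n * 2 * pi"
      using cos_one_2pi_int by blast
    then have "2 * pi * (real a - real b) = 2 * pi * (of_int n * real q)" using q by (simp add: field_simps)
    then have "real a - real b = of_int n * real q" by (simp only: mult_cancel_left) simp
    then have "real_of_int (int a - int b) = real_of_int (n * int q)" by simp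
    then have n: "int a - int b = n * int q" by (simp only: of_int_eq_iff)
    then have "\<bar>n * int q\<bar> < int q" using assms by linarith
    moreover have "1 * int q \<le> \<bar>n\<bar> * int q" if "n \<noteq> 0" using that by (intro mult_right_mono) auto
    ultimately have "n = 0" by (cases "n = 0") (auto simp: abs_mult)
    then show False using n False by simp
  qed
  moreover have "z ^ q = 1"
    using q cis_2pi_of_int[of "int a - int b"] by (simp add: z_def Complex.DeMoivre)
  ultimately have "(\<Sum>x<q. z ^ x) = 0" by (simp add: geometric_sum)
  then show ?thesis using False by (simp add: pow)
qed

text \<open>The helper holds \<open>a\<^sub>l \<in> \<int>\<^sub>q\<close> for every \<open>l\<close>, and \<open>E\<^sub>l\<close> holds a pair \<open>(e\<^sub>l, f\<^sub>l)\<close>, stored as the number \<open>e\<^sub>l q + f\<^sub>l\<close>;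
  the secret is \<open>a\<^sub>l + e\<^sub>l\<close> for every \<open>l\<close> and also the sum of the \<open>f\<^sub>l\<close>. To let \<open>E\<^sub>i\<close> recover, the helper
  measures \<open>a\<^sub>i\<close> in the computational basis, which reveals the secret to \<open>E\<^sub>i\<close>, and the other \<open>a\<^sub>l\<close> in the Fourier
  basis, which reduces the other \<open>e\<^sub>l\<close> to a known phase.\<close>

locale helper_scheme =
  fixes q :: nat and parties :: "'i::finite itself"
  assumes q2: "2 \<le> q"
begin

definition addresses :: "('i \<Rightarrow> nat) set" where "addresses = PiE UNIV (\<lambda>_. {..<q})"

definition dim where "dim = card addresses"

definition dec :: "nat \<Rightarrow> 'i \<Rightarrow> nat" where
  "dec = (SOME f. bij_betw f {..<dim} addresses)"

definition enc :: "('i \<Rightarrow> nat) \<Rightarrow> nat" where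
  "enc = the_inv_into {..<dim} dec"

abbreviation "dims \<equiv> case_option dim (\<lambda>_ :: 'i. q * q)"
abbreviation "loc \<equiv> (\<lambda>p. {..<dims p})"

lemma dec: "bij_betw dec {..<dim} addresses"
proof -
  have "finite addresses" unfolding addresses_def by (rule finite_PiE_type) simp
  from someI_ex[OF ex_bij_betw_nat_finite[OF this]] show ?thesis
    by (simp add: dec_def dim_def atLeast0LessThan)
qed

lemma enc_dec: "n < dim \<Longrightarrow> enc (dec n) = n"
  using dec by (simp add: enc_def bij_betw_def the_inv_into_f_f)

lemma dec_enc: "(\<And>l. x l < q) \<Longrightarrow> dec (enc x) = x"
  unfolding enc_def using dec by (rule f_the_inv_into_f_bij_betw) (simp add: addresses_def PiE_iff)

lemma enc_less: "(\<And>l. x l < q) \<Longrightarrow> enc x < dim"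
  using bij_betw_the_inv_into[OF dec] by (auto simp: enc_def addresses_def PiE_iff dest: bij_betwE)

lemma dec_less: "n < dim \<Longrightarrow> dec n l < q"
  using dec by (force simp: addresses_def PiE_iff dest: bij_betwE)

definition bump :: "nat \<Rightarrow> nat \<Rightarrow> nat \<Rightarrow> nat" where
  "bump k k' n = ((n div q + k) mod q) * q + (n mod q + k') mod q"

lemma bump:
  shows bump_div: "bump k k' n div q = (n div q + k) mod q"
    and bump_mod: "bump k k' n mod q = (n mod q + k') mod q"
    and bump_less: "bump k k' n < q * q"
proof -
  have q0: "q > 0" using q2 by simp
  show "bump k k' n div q = (n div q + k) mod q" "bump k k' n mod q = (n mod q + k') mod q"
    using q0 by (simp_all add: bump_def)
  then show "bump k k' n < q * q"
    using q0 by (metis div_less_iff_less_mult mod_less_divisor)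
qed

lemma div_less: "n < q * q \<Longrightarrow> n div q < q"
  using q2 by (simp add: less_mult_imp_div_less)

lemma bump_inj: "n < q * q \<Longrightarrow> n' < q * q \<Longrightarrow> bump k k' n = bump k k' n' \<Longrightarrow> n = n'"
proof -
  assume n: "n < q * q" "n' < q * q" and eq: "bump k k' n = bump k k' n'"
  have q0: "q > 0" using q2 by simp
  have "n div q = n' div q"
    using n eq add_mod_inj[of "n div q" q "n' div q" k] div_less by (metis bump_div)
  moreover have "n mod q = n' mod q"
    using eq q0 add_mod_inj[of "n mod q" q "n' mod q" k'] by (metis bump_mod mod_less_divisor)
  ultimately show ?thesis by (metis mult_div_mod_eq)
qed

lemma bump_0: "n < q * q \<Longrightarrow> bump 0 0 n = n"
  by (simp add: bump_def div_less)

definition words :: "nat \<Rightarrow> ('i option \<Rightarrow> nat) set" where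
  "words m = {b \<in> PiE UNIV loc. (\<forall>l. (dec (b None) l + b (Some l) div q) mod q = m) \<and>
     (\<Sum>l\<in>UNIV. b (Some l) mod q) mod q = m}"

text \<open>The equation between the helper and E_l can be moved from either end: by the helper for
  \<open>l\<close> in \<open>Z\<close>, otherwise by E_l. The separate sum condition is moved by the
  single party \<open>s\<close>. The choice of \<open>Z\<close> and \<open>s\<close> adapts the
  shift to the recovering set.\<close>

definition shift :: "'i set \<Rightarrow> 'i \<Rightarrow> nat \<Rightarrow> 'i option \<Rightarrow> nat \<Rightarrow> nat" where
  "shift Z s k p n = (case p of None \<Rightarrow> enc (\<lambda>l. if l \<in> Z then (dec n l + k) mod q else dec n l)
     | Some l \<Rightarrow> bump (if l \<in> Z then 0 else k) (if l = s then k else 0) n)"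

lemma dec_shift:
  assumes "n < dim"
  shows "dec (shift Z s k None n) = (\<lambda>l. if l \<in> Z then (dec n l + k) mod q else dec n l)"
    and "shift Z s k None n < dim"
  unfolding shift_def option.case
  by (rule dec_enc, use dec_less[OF assms] q2 in simp) (rule enc_less, use dec_less[OF assms] q2 in simp)

lemma shift_less: "n < dims p \<Longrightarrow> shift Z s k p n < dims p"
  using dec_shift(2) by (cases p) (auto simp: bump_less, simp add: shift_def bump_less)

lemma shift_inj:
  assumes "n < dims p" "n' < dims p" "shift Z s k p n = shift Z s k p n'"
  shows "n = n'"
proof (cases p)
  case None
  then have n: "n < dim" "n' < dim" using assms by auto
  have eq: "(\<lambda>l. if l \<in> Z then (dec n l + k) mod q else dec n l) = (\<lambda>l. if l \<in> Z then (dec n' l + k) mod q else dec n' l)"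
  proof -
    have "dec (shift Z s k None n) = dec (shift Z s k None n')" using assms(3) None by simp
    then show ?thesis by (simp only: dec_shift(1)[OF n(1)] dec_shift(1)[OF n(2)])
  qed
  have "dec n l = dec n' l" for l
    using fun_cong[OF eq, of l] add_mod_inj[of "dec n l" q "dec n' l" k] dec_less n by (auto split: if_splits)
  then show ?thesis using enc_dec n by (metis ext)
next
  case (Some l)
  then show ?thesis using assms bump_inj by (simp add: shift_def)
qed

lemma words_shift:
  assumes "b \<in> words m"
  shows "(\<lambda>p. shift Z s k p (b p)) \<in> words ((m + k) mod q)"
proof -
  have b: "b p < dims p" for p using assms by (auto simp: words_def)
  have 1: "(dec (b None) l + b (Some l) div q) mod q = m" for l using assms by (simp add: words_def)
  have 2: "(\<Sum>l\<in>UNIV. b (Some l) mod q) mod q = m" using assms by (simp add: words_def)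
  have "b None < dim" using b[of None] by simp
  note d = dec_shift(1)[OF this]
  have "(dec (shift Z s k None (b None)) l + shift Z s k (Some l) (b (Some l)) div q) mod q = (m + k) mod q" for l
  proof -
    have "(dec (shift Z s k None (b None)) l + shift Z s k (Some l) (b (Some l)) div q) mod q
       = (dec (b None) l + b (Some l) div q + k) mod q"
      unfolding d by (simp add: shift_def bump_div mod_simps add_ac)
    also have "\<dots> = (m + k) mod q" using 1[of l] by (metis mod_add_left_eq)
    finally show ?thesis .
  qed
  moreover have "(\<Sum>l\<in>UNIV. shift Z s k (Some l) (b (Some l)) mod q) mod q = (m + k) mod q"
  proof -
    have "shift Z s k (Some l) (b (Some l)) mod q
       = (if l = s then (b (Some l) mod q + k) mod q else b (Some l) mod q)" for l
      by (simp add: shift_def bump_mod)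
    then show ?thesis using sum_mod_shift[of UNIV s "\<lambda>l. b (Some l) mod q" k q] 2 by simp
  qed
  ultimately show ?thesis using b shift_less by (auto simp: words_def)
qed

definition enc_map :: "('i option \<Rightarrow> nat, nat) lin" where
  "enc_map b m = (if m < q \<and> b \<in> words m then 1 / of_real (sqrt (card (words 0))) else 0)"

lemma decoupled_by_shift:
  assumes fixed: "\<And>k p n. p \<notin> S \<Longrightarrow> n < dims p \<Longrightarrow> shift Z s k p n = n"
    and sep: "\<And>f g h m m'. override_on f h S \<in> words m \<Longrightarrow> override_on g h S \<in> words m' \<Longrightarrow> m = m'"
  shows "\<exists>\<omega>. decoupled (PiE S loc) (PiE (- S) loc) {..<q} (split_code S enc_map) \<omega>"
  unfolding enc_map_def
proof (rule decoupled_uniform[where sh = "shift Z s"])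
  show "inj_on (shift Z s k p) (loc p)" for k p using shift_inj by (auto simp: inj_on_def)
  show "shift Z s k p (b p) = b p" if "b \<in> words m" "p \<notin> S" for k b m p
  proof (rule fixed[OF that(2)])
    show "b p < dims p" using that(1) by (auto simp: words_def)
  qed
qed (auto simp: shift_less words_shift intro: sep)

text \<open>The helper moves every equation except that of \<open>j\<close>, which E_j moves
  together with the sum, so no other party is touched. The secret is read from equation
  \<open>j\<close>.\<close>

lemma decoupled_helper:
  "\<exists>\<omega>. decoupled (PiE {None, Some j} loc) (PiE (- {None, Some j}) loc) {..<q} (split_code {None, Some j} enc_map) \<omega>"
proof (rule decoupled_by_shift[where Z = "- {j}" and s = j])
  fix k p n assume "p \<notin> {None, Some j}" "n < dims p"
  then show "shift (- {j}) j k p n = n" by (cases p) (auto simp: shift_def bump_0)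
next
  fix f g h m m' assume "override_on f h {None, Some j} \<in> words m" "override_on g h {None, Some j} \<in> words m'"
  then have "(dec (override_on f h {None, Some j} None) j + override_on f h {None, Some j} (Some j) div q) mod q = m"
    "(dec (override_on g h {None, Some j} None) j + override_on g h {None, Some j} (Some j) div q) mod q = m'"
    unfolding words_def by blast+
  then show "m = m'" by simp
qed

text \<open>The helper moves nothing, and the secret is read from the sum condition, which does not
  involve the helper. Any party may move the sum, hence \<open>undefined\<close>.\<close>

lemma decoupled_blind:
  "\<exists>\<omega>. decoupled (PiE (range Some) loc) (PiE (- range Some) loc) {..<q} (split_code (range Some) enc_map) \<omega>"
proof (rule decoupled_by_shift[where Z = "{}" and s = undefined])
  fix k p n assume "p \<notin> range (Some :: 'i \<Rightarrow> _)" "n < dims p"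
  then show "shift {} undefined k p n = n" by (cases p) (auto simp: shift_def enc_dec)
next
  fix f g h m m' assume "override_on f h (range (Some :: 'i \<Rightarrow> _)) \<in> words m" "override_on g h (range Some) \<in> words m'"
  then have "(\<Sum>l\<in>UNIV. override_on f h (range (Some :: 'i \<Rightarrow> _)) (Some l) mod q) mod q = m"
    "(\<Sum>l\<in>UNIV. override_on g h (range (Some :: 'i \<Rightarrow> _)) (Some l) mod q) mod q = m'"
    by (auto simp: words_def)
  then show "m = m'" by simp
qed

lemma words_0: "words 0 \<noteq> {}"
proof -
  have "(\<lambda>p. case p of None \<Rightarrow> enc (\<lambda>_. 0) | Some _ \<Rightarrow> 0) \<in> words 0"
    using enc_less[of "\<lambda>_. 0"] dec_enc[of "\<lambda>_. 0"] q2
    by (auto simp: words_def split: option.splits)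
  then show ?thesis by blast
qed

lemma isometry_enc_map: "isometry {..<q} (PiE UNIV loc) enc_map"
proof -
  obtain \<omega> where "decoupled (PiE (range Some) loc) (PiE (- range Some) loc) {..<q} (split_code (range Some) enc_map) \<omega>"
    using decoupled_blind by blast
  then show ?thesis
    by (rule isometry_uniform[where X = words, rotated 4])
      (use words_0 q2 in \<open>auto simp: enc_map_def words_def\<close>)
qed

text \<open>The access structure is taken to be everything that recovers. The helper alone is
  excluded by no-cloning, because the remaining parties recover.\<close>

lemma blind_helper_enc_map: "\<exists>\<Gamma>. blind_helper_code {..<q} loc (lin_range {..<q} enc_map) \<Gamma>"
proof -
  define \<Gamma> where "\<Gamma> = {S. recovers loc (lin_range {..<q} enc_map) S}"
  note fin = finite_lessThan[of q] finite_lessThan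
  have q0: "0 \<in> {..<q}" "1 \<in> {..<q}" "0 \<noteq> (1 :: nat)" using q2 by auto
  note iff = recovers_iff_decoupled[OF isometry_enc_map fin q0(1)]
  have pair: "recovers loc (lin_range {..<q} enc_map) {None, Some j}" for j
    using iff decoupled_helper by blast
  have blind: "recovers loc (lin_range {..<q} enc_map) (range Some)"
    using iff decoupled_blind by blast
  have "S \<in> \<Gamma>" if "None \<in> S" "Some j \<in> S" for S j
    using recovers_mono[OF isometry_enc_map fin pair, of j S] that by (simp add: \<Gamma>_def)
  moreover have "{None} \<notin> \<Gamma>"
    using no_cloning[OF isometry_enc_map fin blind _ _ q0, of "{None}"] by (auto simp: \<Gamma>_def)
  moreover have "range Some \<in> \<Gamma>" using blind by (simp add: \<Gamma>_def)
  ultimately show ?thesis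
    using isometry_enc_map unfolding blind_helper_code_def helper_code_def qss_code_def code_for_def
    by (intro exI[of _ \<Gamma>]) (auto simp: \<Gamma>_def)
qed

section \<open>The helper's product measurement and the branches it leaves\<close>

definition amp :: "'i \<Rightarrow> 'i \<Rightarrow> nat \<Rightarrow> nat \<Rightarrow> complex" where
  "amp i l x a = (if l = i then if x = a then 1 else 0
     else cis (2 * pi * real x * real a / real q) / of_real (sqrt q))"

definition outcome :: "'i \<Rightarrow> nat \<Rightarrow> nat ket" where
  "outcome i w a = (if a < dim then \<Prod>l\<in>UNIV. amp i l (dec w l) (dec a l) else 0)"

definition meas :: "'i \<Rightarrow> nat \<Rightarrow> nat oper" where "meas i w = ket_bra (outcome i w)"

lemma amp_orthogonal:
  assumes "a < q" "b < q"
  shows "(\<Sum>x<q. amp i l x a * cnj (amp i l x b)) = (if a = b then 1 else 0)"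
proof (cases "l = i")
  case True
  then have "(\<Sum>x<q. amp i l x a * cnj (amp i l x b)) = (\<Sum>x<q. if x = a then (if a = b then 1 else 0) else 0)"
    by (intro sum.cong) (auto simp: amp_def)
  then show ?thesis using assms by simp
next
  case False
  have "(of_real (sqrt q) * of_real (sqrt q) :: complex) = of_nat q" by (simp flip: of_real_mult)
  then have "(\<Sum>x<q. amp i l x a * cnj (amp i l x b))
     = (\<Sum>x<q. cis (2 * pi * real x * real a / real q) * cnj (cis (2 * pi * real x * real b / real q))) / of_nat q"
    using False by (simp add: amp_def sum_divide_distrib)
  then show ?thesis using cis_sum_orthogonal[OF assms] assms by auto
qed

text \<open>The outcomes are products of vectors from one orthonormal basis per position, and the
  sum over outcomes factorises over the positions.\<close>

lemma povm_meas: "povm {..<dim} {..<dim} (meas i)"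
  unfolding povm_def
proof (intro conjI ballI ext)
  fix w show "positive_op {..<dim} (meas i w)"
    unfolding meas_def by (rule ket_bra_positive) (simp add: kets_def outcome_def)
next
  fix a b
  show "(\<Sum>w<dim. meas i w a b) = id_op {..<dim} a b"
  proof (cases "a < dim \<and> b < dim")
    case True
    have "(\<Sum>w<dim. meas i w a b) = (\<Sum>w<dim. \<Prod>l\<in>UNIV. amp i l (dec w l) (dec a l) * cnj (amp i l (dec w l) (dec b l)))"
      using True by (simp add: meas_def ket_bra_def outcome_def prod.distrib)
    also have "\<dots> = (\<Sum>w\<in>addresses. \<Prod>l\<in>UNIV. amp i l (w l) (dec a l) * cnj (amp i l (w l) (dec b l)))"
      by (rule sum.reindex_bij_betw[OF dec])
    also have "\<dots> = (\<Prod>l\<in>UNIV. \<Sum>x<q. amp i l x (dec a l) * cnj (amp i l x (dec b l)))"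
      unfolding addresses_def by (rule prod_sum_PiE[symmetric]) auto
    also have "\<dots> = (\<Prod>l\<in>UNIV. if dec a l = dec b l then 1 else 0)"
      using True by (simp add: amp_orthogonal dec_less)
    also have "\<dots> = (if dec a = dec b then 1 else 0)" by (auto simp: fun_eq_iff)
    also have "dec a = dec b \<longleftrightarrow> a = b" using True enc_dec by metis
    finally show ?thesis using True by (simp add: id_op_def)
  qed (auto simp: meas_def ket_bra_def outcome_def id_op_def)
qed simp

abbreviation "eloc \<equiv> (\<lambda>_ :: 'i. {..<q * q})"

definition phase :: "'i \<Rightarrow> nat \<Rightarrow> nat \<Rightarrow> ('i \<Rightarrow> nat) \<Rightarrow> complex" where
  "phase i w m e = (\<Prod>l\<in>- {i}. cnj (amp i l (dec w l) ((m + (q - e l div q)) mod q)))"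

definition branch_words :: "'i \<Rightarrow> nat \<Rightarrow> nat \<Rightarrow> ('i \<Rightarrow> nat) set" where
  "branch_words i w m = {e \<in> PiE UNIV eloc. (dec w i + e i div q) mod q = m \<and>
     (\<Sum>l\<in>UNIV. e l mod q) mod q = m}"

definition branch :: "'i \<Rightarrow> nat \<Rightarrow> ('i \<Rightarrow> nat, nat) lin" where
  "branch i w e m = (\<Sum>a<dim. cnj (outcome i w a) * enc_map (join a e) m)"

text \<open>For given \<open>e\<close> and \<open>m\<close> at most one address completes a word, so
  the sum over the helper's labels has at most one term. The factor of position \<open>i\<close>
  becomes the indicator of \<open>branch_words\<close>, the other factors the phase.\<close>

lemma branch_eq:
  assumes w: "w < dim"
  shows "branch i w e m = (if m < q \<and> e \<in> branch_words i w m
     then 1 / of_real (sqrt (card (words 0))) else 0) * phase i w m e"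
proof (cases "e \<in> PiE UNIV eloc \<and> m < q \<and> (\<Sum>l\<in>UNIV. e l mod q) mod q = m")
  case False
  have "join a e \<in> words m \<Longrightarrow> e \<in> PiE UNIV eloc" for a
    by (auto simp: words_def PiE_iff split: option.splits dest: spec[of _ "Some _"])
  then have "enc_map (join a e) m = 0" for a
    using False by (auto simp: enc_map_def words_def)
  then show ?thesis using False by (auto simp: branch_def branch_words_def)
next
  case True
  then have e: "e l < q * q" for l by auto
  have q0: "q > 0" using q2 by simp
  define a0 where "a0 = enc (\<lambda>l. (m + (q - e l div q)) mod q)"
  have a0: "a0 < dim" "dec a0 = (\<lambda>l. (m + (q - e l div q)) mod q)"
    using q0 by (auto simp: a0_def enc_less dec_enc)
  have iff: "join a e \<in> words m \<longleftrightarrow> a = a0" if "a < dim" for a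
  proof -
    have "join a e \<in> PiE UNIV loc" using that True by (auto simp: PiE_iff split: option.splits)
    then have "join a e \<in> words m \<longleftrightarrow> (\<forall>l. (dec a l + e l div q) mod q = m)"
      using True by (simp add: words_def)
    also have "\<dots> \<longleftrightarrow> (\<forall>l. dec a l = (m + (q - e l div q)) mod q)"
      using add_mod_eq_iff[OF dec_less[OF that] div_less[OF e]] True by simp
    also have "\<dots> \<longleftrightarrow> dec a = dec a0" by (simp add: a0 fun_eq_iff)
    also have "\<dots> \<longleftrightarrow> a = a0" using that a0(1) enc_dec by metis
    finally show ?thesis .
  qed
  have "branch i w e m = (\<Sum>a<dim. if a = a0 then cnj (outcome i w a) * (1 / of_real (sqrt (card (words 0)))) else 0)"
    unfolding branch_def using iff True by (intro sum.cong) (auto simp: enc_map_def)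
  also have "\<dots> = cnj (outcome i w a0) / of_real (sqrt (card (words 0)))" using a0 by simp
  also have "cnj (outcome i w a0) = cnj (amp i i (dec w i) ((m + (q - e i div q)) mod q)) * phase i w m e"
    using a0 by (simp add: outcome_def phase_def prod.remove[of UNIV i] Compl_eq_Diff_UNIV)
  also have "cnj (amp i i (dec w i) ((m + (q - e i div q)) mod q)) = (if e \<in> branch_words i w m then 1 else 0)"
    using add_mod_eq_iff[OF dec_less[OF w] div_less[OF e], of m i i] True by (simp add: amp_def branch_words_def)
  finally show ?thesis using True by simp
qed

text \<open>A change of \<open>m\<close> multiplies the phases of all labels by the same number of
  modulus one, which cancels against its conjugate.\<close>

lemma phase_cancel:
  assumes "\<And>l. f l < q * q" "\<And>l. g l < q * q"
  shows "phase i w m f * cnj (phase i w m g) = phase i w 0 f * cnj (phase i w 0 g)"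
proof -
  have c: "cnj (amp i l (dec w l) ((m + (q - f l div q)) mod q)) * amp i l (dec w l) ((m + (q - g l div q)) mod q)
     = cis (2 * pi * real (dec w l) * (real (f l div q) - real (g l div q)) / real q) / of_nat q"
    if "l \<noteq> i" for l m
  proof -
    have q0: "q > 0" "f l div q \<le> q" "g l div q \<le> q" using q2 div_less assms by (auto intro: less_imp_le)
    have s: "(of_real (sqrt q) * of_real (sqrt q) :: complex) = of_nat q" by (simp flip: of_real_mult)
    let ?t = "\<lambda>n. 2 * pi * real (dec w l) * real n / real q"
    have t: "?t (m + (q - g l div q)) - ?t (m + (q - f l div q))
       = 2 * pi * real (dec w l) * (real (f l div q) - real (g l div q)) / real q"
      using q0 by (simp add: of_nat_diff diff_divide_distrib[symmetric] algebra_simps)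
    have "cnj (cis (?t (m + (q - f l div q)))) * cis (?t (m + (q - g l div q)))
       = cis (?t (m + (q - g l div q)) - ?t (m + (q - f l div q)))"
      by (simp only: cis_cnj cis_mult) simp
    then show ?thesis
      unfolding t using q0 that by (simp add: amp_def cis_mod s)
  qed
  then show ?thesis
    unfolding phase_def cnj_prod prod.distrib[symmetric] complex_cnj_cnj
  proof (intro prod.cong refl)
    fix l assume "l \<in> - {i}"
    then have "l \<noteq> i" by simp
    from c[OF this, of m] c[OF this, of 0]
    show "cnj (amp i l (dec w l) ((m + (q - f l div q)) mod q)) * amp i l (dec w l) ((m + (q - g l div q)) mod q)
       = cnj (amp i l (dec w l) ((0 + (q - f l div q)) mod q)) * amp i l (dec w l) ((0 + (q - g l div q)) mod q)"
      by (rule trans[OF _ sym])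
  qed
qed

text \<open>E_i alone shifts both components of its pair: the first moves the equation with the
  measured value, the second moves the sum.\<close>

lemma decoupled_branch_words:
  assumes w: "w < dim"
  shows "\<exists>\<omega>. decoupled (PiE {i} eloc) (PiE (- {i}) eloc) {..<q}
     (\<lambda>h f m. if m < q \<and> override_on f h {i} \<in> branch_words i w m then c else 0) \<omega>"
proof (rule decoupled_uniform[where sh = "\<lambda>k p n. if p = i then bump k k n else n"])
  fix k b m assume b: "b \<in> branch_words i w m"
  let ?b = "\<lambda>p. if p = i then bump k k (b p) else b p"
  have "(dec w i + ?b i div q) mod q = (dec w i + b i div q + k) mod q"
    by (simp add: bump_div mod_simps add_ac)
  also have "\<dots> = ((dec w i + b i div q) mod q + k) mod q" by (rule mod_add_left_eq[symmetric])
  also have "(dec w i + b i div q) mod q = m" using b by (simp add: branch_words_def)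
  finally have 1: "(dec w i + ?b i div q) mod q = (m + k) mod q" .
  have "?b l mod q = (if l = i then (b l mod q + k) mod q else b l mod q)" for l
    by (simp add: bump_mod)
  then have 2: "(\<Sum>l\<in>UNIV. ?b l mod q) mod q = (m + k) mod q"
    using sum_mod_shift[of UNIV i "\<lambda>l. b l mod q" k q] b by (simp add: branch_words_def)
  have "?b \<in> PiE UNIV eloc" using b by (auto simp: branch_words_def bump_less)
  with 1 2 show "?b \<in> branch_words i w ((m + k) mod q)" unfolding branch_words_def by blast
next
  show "inj_on (\<lambda>n. if p = i then bump k k n else n) (eloc p)" for k p
    using bump_inj by (auto simp: inj_on_def)
  fix f g h m m' assume "override_on f h {i} \<in> branch_words i w m" "override_on g h {i} \<in> branch_words i w m'"
  then have "(dec w i + override_on f h {i} i div q) mod q = m" "(dec w i + override_on g h {i} i div q) mod q = m'"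
    unfolding branch_words_def by blast+
  then show "m = m'" by simp
qed (simp_all add: bump_less)

lemma decoupled_branch:
  assumes w: "w < dim"
  shows "\<exists>\<omega>. decoupled (PiE {i} eloc) (PiE (- {i}) eloc) {..<q} (split_code {i} (branch i w)) \<omega>"
proof -
  let ?J = "\<lambda>h f m. if m < q \<and> override_on f h {i} \<in> branch_words i w m
     then 1 / of_real (sqrt (card (words 0))) else 0 :: complex"
  obtain \<omega> where \<omega>: "decoupled (PiE {i} eloc) (PiE (- {i}) eloc) {..<q} ?J \<omega>"
    using decoupled_branch_words[OF w] by blast
  \<comment> \<open>The product defining the phase omits position \<open>i\<close>, so the label of
    E_i can be replaced by 0 and the phase leaves the sum over E_i.\<close>
  have phase: "phase i w m (override_on f h {i}) = phase i w m (override_on f (\<lambda>_. 0) {i})" for m f h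
    unfolding phase_def by (intro prod.cong) auto
  let ?f = "\<lambda>f. override_on f (\<lambda>_. 0) {i}"
  have "decoupled (PiE {i} eloc) (PiE (- {i}) eloc) {..<q} (split_code {i} (branch i w))
     (\<lambda>f g. \<omega> f g * (phase i w 0 (?f f) * cnj (phase i w 0 (?f g))))"
    unfolding decoupled_def
  proof (intro ballI)
    fix f g m m' assume fg: "f \<in> PiE (- {i}) eloc" "g \<in> PiE (- {i}) eloc" and m: "m \<in> {..<q}" "m' \<in> {..<q}"
    have "(\<Sum>h\<in>PiE {i} eloc. branch i w (override_on f h {i}) m * cnj (branch i w (override_on g h {i}) m'))
       = (\<Sum>h\<in>PiE {i} eloc. ?J h f m * cnj (?J h g m') * (phase i w m (?f f) * cnj (phase i w m' (?f g))))"
    proof (rule sum.cong[OF refl])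
      fix h
      have "branch i w (override_on f h {i}) m = ?J h f m * phase i w m (?f f)" for f m
        unfolding branch_eq[OF w] by (rule arg_cong2[where f = times, OF refl phase])
      then show "branch i w (override_on f h {i}) m * cnj (branch i w (override_on g h {i}) m')
         = ?J h f m * cnj (?J h g m') * (phase i w m (?f f) * cnj (phase i w m' (?f g)))"
        by (simp only: complex_cnj_mult mult_ac)
    qed
    also have "\<dots> = (if m = m' then \<omega> f g else 0) * (phase i w m (?f f) * cnj (phase i w m' (?f g)))"
      unfolding sum_distrib_right[symmetric] decoupledD[OF \<omega> fg m] ..
    also have "\<dots> = (if m = m' then \<omega> f g * (phase i w 0 (?f f) * cnj (phase i w 0 (?f g))) else 0)"
    proof -
      have "?f f l < q * q" "?f g l < q * q" for l
        using fg q2 by (auto simp: override_on_def PiE_iff)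
      then have "phase i w m (?f f) * cnj (phase i w m (?f g)) = phase i w 0 (?f f) * cnj (phase i w 0 (?f g))"
        by (rule phase_cancel)
      then show ?thesis by auto
    qed
    finally show "(\<Sum>h\<in>PiE {i} eloc. branch i w (override_on f h {i}) m * cnj (branch i w (override_on g h {i}) m'))
       = (if m = m' then \<omega> f g * (phase i w 0 (?f f) * cnj (phase i w 0 (?f g))) else 0)" .
  qed
  then show ?thesis by blast
qed

lemma helper_branch_meas: "helper_branch q dim enc_map (meas i w) = conj_by {..<q} (branch i w)"
proof
  fix \<rho>
  have "meas i w = (\<lambda>x y. \<Sum>k\<in>{()}. outcome i w x * cnj (outcome i w y))"
    by (simp add: meas_def ket_bra_def fun_eq_iff)
  then show "helper_branch q dim enc_map (meas i w) \<rho> = conj_by {..<q} (branch i w) \<rho>"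
    using helper_branch_factor[of q dim enc_map "\<lambda>_. outcome i w" "{()}" \<rho>]
    by (simp add: branch_def[abs_def])
qed

lemma classically_assisted_meas: "classically_assisted q dim (\<lambda>_. q * q) enc_map {..<dim} (meas i) i"
  unfolding classically_assisted_def Let_def helper_branch_meas
proof (intro conjI ballI impI povm_meas)
  fix w assume w: "w \<in> {..<dim}" and nz: "conj_by {..<q} (branch i w) (id_op {..<q}) \<noteq> (\<lambda>_ _. 0)"
  obtain \<omega> where \<omega>: "decoupled (PiE {i} eloc) (PiE (- {i}) eloc) {..<q} (split_code {i} (branch i w)) \<omega>"
    using decoupled_branch w by blast
  have out: "branch i w b m = 0" if "b \<notin> PiE UNIV eloc \<or> m \<notin> {..<q}" for b m
    using that w by (auto simp: branch_eq branch_words_def)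
  note * = pure_branch[of "{..<q}" eloc 0 "branch i w", OF _ _ _ out \<omega> nz]
  show "authorizing_code {..<q} eloc (support_of (cfg (\<lambda>_. q * q)) (conj_by {..<q} (branch i w) (id_op {..<q}))) {{i}}"
    using q2 by (intro *) auto
  show "secret_recoverable {..<q} (PiE {i} eloc) (\<lambda>\<rho>. reduce eloc {i} (conj_by {..<q} (branch i w) \<rho>))"
    using q2 by (intro *) auto
qed

end

theorem first_layer_exists:
  assumes "2 \<le> q"
  shows "\<exists>dA (dE :: 'i::finite \<Rightarrow> nat) V Oc M. first_layer q dA dE V Oc M"
proof -
  interpret helper_scheme q "TYPE('i)" using assms by unfold_locales
  have "first_layer q dim (\<lambda>_ :: 'i. q * q) enc_map (\<lambda>_. {..<dim}) meas"
    unfolding first_layer_def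
    using isometry_enc_map blind_helper_enc_map classically_assisted_meas by blast
  then show ?thesis by blast
qed

section \<open>Branches of a first layer\<close>

lemma opers_singleton_eq:
  assumes "\<rho> \<in> opers X" "\<sigma> \<in> opers X" "\<And>x y. x \<in> X \<Longrightarrow> y \<in> X \<Longrightarrow> x = y"
    and "trace_on X \<rho> = trace_on X \<sigma>"
  shows "\<rho> = \<sigma>"
proof (rule opers_eqI[OF assms(1,2)])
  fix x y assume xy: "x \<in> X" "y \<in> X"
  have "X = {x}" using assms(3) xy by auto
  then show "\<rho> x y = \<sigma> x y" using assms(4) xy by (simp add: trace_on_def)
qed

lemma sesq_decomposed:
  "sesq X (\<lambda>x y. \<Sum>k\<in>I. v k x * cnj (v k y)) w w = (\<Sum>k\<in>I. inner_on X w (v k) * cnj (inner_on X w (v k)))"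
proof -
  have "sesq X (\<lambda>x y. \<Sum>k\<in>I. v k x * cnj (v k y)) w w
     = (\<Sum>x\<in>X. \<Sum>y\<in>X. \<Sum>k\<in>I. cnj (w x) * v k x * cnj (cnj (w y) * v k y))"
    by (simp add: sesq_def sum_distrib_left sum_distrib_right mult_ac)
  also have "\<dots> = (\<Sum>k\<in>I. \<Sum>x\<in>X. \<Sum>y\<in>X. cnj (w x) * v k x * cnj (cnj (w y) * v k y))"
    by (rule sym, subst sum.swap, intro sum.cong refl, rule sum.swap)
  also have "\<dots> = (\<Sum>k\<in>I. inner_on X w (v k) * cnj (inner_on X w (v k)))"
    unfolding inner_on_def cnj_sum sum_product ..
  finally show ?thesis .
qed

lemma isometry_preserves:
  assumes "isometry X Y K" "finite X"
  shows "(\<Sum>y\<in>Y. (\<Sum>x\<in>X. K y x * u x) * cnj (\<Sum>x\<in>X. K y x * v x)) = (\<Sum>x\<in>X. u x * cnj (v x))"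
proof -
  have "(\<Sum>y\<in>Y. (\<Sum>x\<in>X. K y x * u x) * cnj (\<Sum>x\<in>X. K y x * v x))
     = (\<Sum>y\<in>Y. \<Sum>x\<in>X. \<Sum>x'\<in>X. u x * cnj (v x') * (cnj (K y x') * K y x))"
    by (simp only: cnj_sum sum_product) (simp add: mult_ac)
  also have "\<dots> = (\<Sum>x\<in>X. \<Sum>x'\<in>X. u x * cnj (v x') * (\<Sum>y\<in>Y. cnj (K y x') * K y x))"
    unfolding sum_distrib_left by (subst sum.swap, intro sum.cong refl, rule sum.swap)
  also have "\<dots> = (\<Sum>x\<in>X. \<Sum>x'\<in>X. u x * cnj (v x') * (if x' = x then 1 else 0))"
    by (intro sum.cong refl) (simp add: isometry_inner[OF assms(1)])
  also have "\<dots> = (\<Sum>x\<in>X. u x * cnj (v x))" using assms(2) by (simp add: sum_delta_mult)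
  finally show ?thesis .
qed

text \<open>Recovery is only assumed on states. A matrix unit is a combination of four of them:
  \<open>ket_bra (v 1)\<close> plus \<i> times \<open>ket_bra (v \<i>)\<close> has no entry at
  \<open>r'\<close>, \<open>r\<close>, and multiples of the two diagonal units remove its
  diagonal.\<close>

lemma states_determine_unit_op:
  assumes Q: "finite Q" "r \<in> Q" "r' \<in> Q"
    and lin: "\<And>\<rho> \<sigma> c. \<rho> \<in> opers Q \<Longrightarrow> \<sigma> \<in> opers Q \<Longrightarrow>
      F (\<lambda>x y. c * \<rho> x y + \<sigma> x y) = (\<lambda>x y. c * F \<rho> x y + F \<sigma> x y)"
    and st: "\<And>\<rho>. state Q \<rho> \<Longrightarrow> F \<rho> = (\<lambda>x y. p * \<rho> x y)"
  shows "F (unit_op r r') = (\<lambda>x y. p * unit_op r r' x y)"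
proof (cases "r = r'")
  case True
  then show ?thesis using st[OF state_unit_op[OF Q(1,2)]] by simp
next
  case False
  define v where "v c x = (if x = r then 1 else if x = r' then c else 0) / of_real (sqrt 2)" for c :: complex and x
  have s2: "(of_real (sqrt 2) * of_real (sqrt 2) :: complex) = 2" by (simp flip: of_real_mult)
  have v: "state Q (ket_bra (v c))" if "c * cnj c = 1" for c
  proof -
    have "v c \<in> kets Q" using Q by (auto simp: v_def kets_def)
    moreover have "trace_on Q (ket_bra (v c)) = (\<Sum>x\<in>Q. (if x = r then 1 / 2 else 0) + (if x = r' then 1 / 2 else 0))"
      unfolding trace_on_def ket_bra_def using that False s2 by (intro sum.cong) (auto simp: v_def)
    ultimately show ?thesis using Q by (simp add: state_def ket_bra_positive sum.distrib)
  qed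
  let ?k = "- ((1 + \<i>) / 2)"
  let ?s = "\<lambda>c. ket_bra (v c)"
  have op: "?s 1 \<in> opers Q" "?s \<i> \<in> opers Q" "unit_op r r \<in> opers Q" "unit_op r' r' \<in> opers Q"
    using v[of 1] v[of \<i>] Q by (auto simp: state_def positive_op_opers unit_op_opers)
  have add: "(\<lambda>x y. c * \<rho> x y + \<sigma> x y) \<in> opers Q" if "\<rho> \<in> opers Q" "\<sigma> \<in> opers Q" for c \<rho> \<sigma>
    using that by (auto simp: opers_def)
  let ?t = "\<lambda>x y. ?k * unit_op r' r' x y + (\<lambda>_ _. 0) x y"
  let ?t' = "\<lambda>x y. ?k * unit_op r r x y + ?t x y"
  let ?t'' = "\<lambda>x y. \<i> * ?s \<i> x y + ?t' x y"
  have eq: "unit_op r r' = (\<lambda>x y. 1 * ?s 1 x y + ?t'' x y)"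
    using False s2 by (auto simp: fun_eq_iff unit_op_def ket_bra_def v_def field_simps)
  have F0: "F (\<lambda>_ _. 0) = (\<lambda>_ _. 0)"
    using lin[OF zero_opers zero_opers, of "- 1"] by (simp add: fun_eq_iff)
  have o0: "(\<lambda>_ _. 0) \<in> opers Q" by (rule zero_opers)
  have "F (unit_op r r') = (\<lambda>x y. 1 * F (?s 1) x y + (\<i> * F (?s \<i>) x y + (?k * F (unit_op r r) x y
      + (?k * F (unit_op r' r') x y + F (\<lambda>_ _. 0) x y))))"
    unfolding eq
    by (subst lin, rule op, intro add op o0, subst lin, rule op, intro add op o0,
        subst lin, rule op, intro add op o0, subst lin, rule op, rule o0, rule refl)
  also have "\<dots> = (\<lambda>x y. p * (1 * ?s 1 x y + ?t'' x y))"
    using st[OF v[of 1]] st[OF v[of \<i>]] st[OF state_unit_op[OF Q(1,2)]] st[OF state_unit_op[OF Q(1,3)]]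
    by (simp add: F0 algebra_simps)
  finally show ?thesis unfolding eq .
qed

lemma sum_join:
  "(\<Sum>b\<in>cfg (case_option dA dE). F b) = (\<Sum>a<dA. \<Sum>e\<in>cfg dE. F (join a e))"
proof -
  have "(\<Sum>a<dA. \<Sum>e\<in>cfg dE. F (join a e)) = (\<Sum>(a, e)\<in>{..<dA} \<times> cfg dE. F (join a e))"
    by (rule sum.cartesian_product)
  also have "\<dots> = (\<Sum>b\<in>cfg (case_option dA dE). F b)"
    by (rule sum.reindex_bij_witness[where i = "\<lambda>b. (b None, \<lambda>l. b (Some l))" and j = "\<lambda>(a, e). join a e"])
      (auto simp: PiE_iff fun_eq_iff split: option.splits)
  finally show ?thesis by simp
qed

lemma sum_PiE_singleton: "(\<Sum>f\<in>PiE {i} L. F f) = (\<Sum>x\<in>L i. F (\<lambda>j\<in>{i}. x))"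
  by (rule sum.reindex_bij_witness[where i = "\<lambda>x. \<lambda>j\<in>{i}. x" and j = "\<lambda>f. f i"])
    (auto simp: PiE_iff extensional_def fun_eq_iff intro!: arg_cong[where f = F])

locale first_layer_ctx =
  fixes q dA :: nat and dE :: "'i::finite \<Rightarrow> nat" and V Oc M
  assumes q2: "2 \<le> q" and first: "first_layer q dA dE V Oc M"
begin

abbreviation "LA \<equiv> (\<lambda>p. {..<case_option dA dE p})"
abbreviation "LE \<equiv> (\<lambda>i. {..<dE i})"
abbreviation "Q \<equiv> {..<q}"

lemma iso_V: "isometry Q (PiE UNIV LA) V"
  using first by (simp add: first_layer_def)

lemma V_outside: "a \<ge> dA \<or> e \<notin> cfg dE \<or> m \<ge> q \<Longrightarrow> V (join a e) m = 0"
proof -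
  assume "a \<ge> dA \<or> e \<notin> cfg dE \<or> m \<ge> q"
  moreover have "join a e \<notin> PiE UNIV LA" if "a \<ge> dA"
  proof
    assume "join a e \<in> PiE UNIV LA"
    from PiE_mem[OF this, of None] show False using that by simp
  qed
  moreover have "join a e \<notin> PiE UNIV LA" if "e \<notin> cfg dE"
  proof
    assume "join a e \<in> PiE UNIV LA"
    from PiE_mem[OF this, of "Some l" for l] show False using that by (simp add: PiE_iff)
  qed
  ultimately show ?thesis using isometry_outside[OF iso_V, of "join a e" m] by auto
qed

lemma finLA: "finite Q" "\<And>p. finite (LA p)" by auto
lemma finLE: "finite (PiE S LE)" by (rule finite_PiE_type) simp

lemma recovers_V:
  shows "recovers LA (lin_range Q V) (range Some)"
    and "recovers LA (lin_range Q V) {None, Some j}"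
proof -
  obtain \<Gamma> where \<Gamma>: "blind_helper_code Q LA (lin_range Q V) \<Gamma>"
    using first by (auto simp: first_layer_def)
  then have iff: "S \<in> \<Gamma> \<longleftrightarrow> recovers LA (lin_range Q V) S" for S
    by (simp add: blind_helper_code_def helper_code_def qss_code_def)
  show "recovers LA (lin_range Q V) (range Some)"
    using \<Gamma> by (simp add: blind_helper_code_def flip: iff)
  show "recovers LA (lin_range Q V) {None, Some j}"
    using \<Gamma> by (simp add: blind_helper_code_def helper_code_def flip: iff)
qed

lemma blind: "\<exists>\<omega>. decoupled (cfg dE) {..<dA} Q (\<lambda>e a m. V (join a e) m) \<omega>"
proof -
  have q0: "0 \<in> Q" using q2 by simp
  obtain \<omega> where \<omega>: "decoupled (PiE (range Some) LA) (PiE (- range Some) LA) Q (split_code (range Some) V) \<omega>"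
    using recovers_V(1) recovers_iff_decoupled[OF iso_V finLA q0] by blast
  have "decoupled (cfg dE) {..<dA} Q (\<lambda>e a m. V (join a e) m)
     (\<lambda>a a'. \<omega> (\<lambda>p\<in>- range Some. a) (\<lambda>p\<in>- range Some. a'))"
    unfolding decoupled_def
  proof (intro ballI)
    fix a a' m m' assume a: "a \<in> {..<dA}" "a' \<in> {..<dA}" and m: "m \<in> Q" "m' \<in> Q"
    let ?c = "\<lambda>a. \<lambda>p\<in>- range (Some :: 'i \<Rightarrow> _). a"
    have c: "?c x \<in> PiE (- range Some) LA" if "x < dA" for x
      using that by (auto simp: PiE_iff split: option.splits)
    have ov: "override_on (?c a) s (range Some) = join a (\<lambda>l. s (Some l))" for a s
      by (auto simp: override_on_def fun_eq_iff split: option.splits)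
    have "(\<Sum>e\<in>cfg dE. V (join a e) m * cnj (V (join a' e) m'))
       = (\<Sum>s\<in>PiE (range Some) LA. V (override_on (?c a) s (range Some)) m * cnj (V (override_on (?c a') s (range Some)) m'))"
      unfolding ov
      by (rule sum.reindex_bij_witness[where i = "\<lambda>s l. s (Some l)" and j = "\<lambda>e. \<lambda>p\<in>range Some. e (the p)"])
        (auto simp: PiE_iff extensional_def fun_eq_iff)
    also have "\<dots> = (if m = m' then \<omega> (?c a) (?c a') else 0)"
      using c a by (intro decoupledD[OF \<omega> _ _ m]) auto
    finally show "(\<Sum>e\<in>cfg dE. V (join a e) m * cnj (V (join a' e) m')) = (if m = m' then \<omega> (?c a) (?c a') else 0)" .
  qed
  then show ?thesis by blast
qed

lemma V_norm: "m \<in> Q \<Longrightarrow> (\<Sum>e\<in>cfg dE. \<Sum>a<dA. V (join a e) m * cnj (V (join a e) m)) = 1"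
  using isometry_inner[OF iso_V, of m m] unfolding sum_join
  by (subst sum.swap) (simp add: mult.commute)

text \<open>The factorisation is taken between all E_j and the helper; the index that purifies the
  helper's reduced state becomes the dealer's system.\<close>

lemma dealer_form_exists: "\<exists>dD \<psi> U. dealer_form q dA dE dD V \<psi> U"
proof -
  obtain \<omega> where \<omega>: "decoupled (cfg dE) {..<dA} Q (\<lambda>e a m. V (join a e) m) \<omega>" using blind by blast
  have q0: "0 \<in> Q" using q2 by simp
  obtain n :: nat and \<psi> U where "isometry ({..<n} \<times> Q) (cfg dE) U"
    "\<And>e a m. e \<in> cfg dE \<Longrightarrow> a \<in> {..<dA} \<Longrightarrow> m \<in> Q \<Longrightarrow> V (join a e) m = (\<Sum>x<n. \<psi> (a, x) * U e (x, m))"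
    "(\<Sum>a<dA. \<Sum>x<n. \<psi> (a, x) * cnj (\<psi> (a, x))) = 1" "\<psi> \<in> kets ({..<dA} \<times> {..<n})"
    by (rule decoupled_imp_factor[OF finLE _ _ q0 \<omega> V_norm[OF q0]]) auto
  moreover have "inner_on ({..<dA} \<times> {..<n}) \<psi> \<psi> = (\<Sum>a<dA. \<Sum>x<n. \<psi> (a, x) * cnj (\<psi> (a, x)))"
    unfolding inner_on_def sum.cartesian_product' by (simp add: mult.commute)
  ultimately show ?thesis unfolding dealer_form_def
    by (intro exI[of _ n] exI[of _ \<psi>] exI[of _ U]) auto
qed

text \<open>A product state of helper and dealer would let every \<open>E\<^sub>i\<close> recover without the helper, and
  \<open>E\<^sub>j\<close> recovers with the helper.\<close>

lemma dealer_entangled: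
  assumes dealer: "dealer_form q dA dE dD V \<psi> U" and card: "2 \<le> CARD('i)"
  shows "entangled {..<dA} {..<dD} \<psi>"
  unfolding entangled_def
proof
  assume "\<exists>\<alpha>\<in>kets {..<dA}. \<exists>\<beta>\<in>kets {..<dD}. \<forall>a\<in>{..<dA}. \<forall>d\<in>{..<dD}. \<psi> (a, d) = \<alpha> a * \<beta> d"
  then obtain \<alpha> \<beta> where prod: "\<And>a d. a < dA \<Longrightarrow> d < dD \<Longrightarrow> \<psi> (a, d) = \<alpha> a * \<beta> d" by auto
  have q0: "0 \<in> Q" "1 \<in> Q" "0 \<noteq> (1 :: nat)" using q2 by auto
  obtain i j :: 'i where ij: "i \<noteq> j"
    using card by (metis card_2_iff' ex_card UNIV_I)
  \<comment> \<open>For a product state the helper's amplitude splits off \<open>V\<close>;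
    \<open>Y\<close> is what the dealer sends to the systems E_l.\<close>
  define Y where "Y b m = (\<Sum>d<dD. \<beta> d * U (\<lambda>l. b (Some l)) (d, m))" for b m
  have V: "V b m = \<alpha> (b None) * Y b m" if b: "b \<in> PiE UNIV LA" and m: "m \<in> Q" for b m
  proof -
    have j: "b = join (b None) (\<lambda>l. b (Some l))" by (auto simp: fun_eq_iff split: option.splits)
    have "b None < dA" using PiE_mem[OF b, of None] by simp
    moreover have "(\<lambda>l. b (Some l)) \<in> cfg dE" using PiE_mem[OF b, of "Some l" for l] by (simp add: PiE_iff)
    ultimately have "V (join (b None) (\<lambda>l. b (Some l))) m = (\<Sum>x<dD. \<psi> (b None, x) * U (\<lambda>l. b (Some l)) (x, m))"
      using dealer m by (simp add: dealer_form_def)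
    also have "\<dots> = \<alpha> (b None) * Y b m"
      using \<open>b None < dA\<close> by (simp add: prod Y_def sum_distrib_left mult.assoc)
    finally show ?thesis using j by simp
  qed
  let ?T = "{None, Some i}"
  obtain \<omega> where \<omega>: "decoupled (PiE ?T LA) (PiE (- ?T) LA) Q (split_code ?T V) \<omega>"
    using recovers_V(2) recovers_iff_decoupled[OF iso_V finLA q0(1)] by blast
  define nrm where "nrm = (\<Sum>a<dA. \<alpha> a * cnj (\<alpha> a))"
  have "nrm \<noteq> 0"
  proof
    assume "nrm = 0"
    have "\<alpha> a = 0" if "a < dA" for a
      using nonneg_Reals_sum_0[of "{..<dA}" "\<lambda>a. \<alpha> a * cnj (\<alpha> a)" a] \<open>nrm = 0\<close> that
      by (simp add: nrm_def cnj_mult_self_nonneg)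
    then have "\<psi> (a, d) = 0" if "a < dA" "d < dD" for a d using prod that by simp
    then have "inner_on ({..<dA} \<times> {..<dD}) \<psi> \<psi> = 0"
      unfolding inner_on_def by (intro sum.neutral) auto
    then show False using dealer by (simp add: dealer_form_def)
  qed
  let ?r = "\<lambda>f. restrict f (- ?T)"
  \<comment> \<open>The helper's share enters the decoupling of the pair only through the factor
    \<open>nrm\<close>; dividing by it leaves the decoupling for E_i alone.\<close>
  have "decoupled (PiE {Some i} LA) (PiE (- {Some i}) LA) Q (split_code {Some i} V)
     (\<lambda>f g. \<alpha> (f None) * cnj (\<alpha> (g None)) * (\<omega> (?r f) (?r g) / nrm))"
    unfolding decoupled_def
  proof (intro ballI)
    fix f g m m' assume fg: "f \<in> PiE (- {Some i}) LA" "g \<in> PiE (- {Some i}) LA" and m: "m \<in> Q" "m' \<in> Q"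
    have inT: "override_on x h {Some i} \<in> PiE UNIV LA" if "x \<in> PiE (- {Some i}) LA" "h \<in> PiE {Some i} LA" for x h
      using that by (auto simp: override_on_def PiE_iff)
    have rT: "?r x \<in> PiE (- ?T) LA" if "x \<in> PiE (- {Some i}) LA" for x
      using that by (auto simp: PiE_iff)
    let ?J = "\<lambda>x h0 h. override_on (?r x) (override_on h h0 {None}) ?T"
    have inJ: "?J x h0 h \<in> PiE UNIV LA"
      if "x \<in> PiE (- {Some i}) LA" "h0 \<in> PiE {None} LA" "h \<in> PiE {Some i} LA" for x h0 h
    proof (rule PiE_I)
      fix p show "?J x h0 h p \<in> LA p"
        using PiE_mem[OF that(1), of p] PiE_mem[OF that(2), of p] PiE_mem[OF that(3), of p]
        by (cases "p = None"; cases "p = Some i") (auto simp: override_on_def)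
    qed simp
    have YJ: "Y (?J x h0 h) m = Y (override_on x h {Some i}) m" for x h0 h m
    proof -
      have "(\<lambda>l. ?J x h0 h (Some l)) = (\<lambda>l. override_on x h {Some i} (Some l))"
        by (auto simp: override_on_def fun_eq_iff)
      then show ?thesis by (simp add: Y_def)
    qed
    let ?G = "\<Sum>h\<in>PiE {Some i} LA. Y (override_on f h {Some i}) m * cnj (Y (override_on g h {Some i}) m')"
    have un: "{None} \<union> {Some i} = ?T" by auto
    have "(\<Sum>h\<in>PiE ?T LA. V (override_on (?r f) h ?T) m * cnj (V (override_on (?r g) h ?T) m'))
       = (\<Sum>h0\<in>PiE {None} LA. \<Sum>h\<in>PiE {Some i} LA. V (?J f h0 h) m * cnj (V (?J g h0 h) m'))"
      unfolding un[symmetric] by (rule sum_PiE_split) simp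
    also have "\<dots> = (\<Sum>h0\<in>PiE {None} LA. \<Sum>h\<in>PiE {Some i} LA. (\<alpha> (h0 None) * cnj (\<alpha> (h0 None)))
        * (Y (override_on f h {Some i}) m * cnj (Y (override_on g h {Some i}) m')))"
    proof (intro sum.cong refl)
      fix h0 h assume "h0 \<in> PiE {None} LA" "h \<in> PiE {Some i} LA"
      then have "V (?J x h0 h) m = \<alpha> (h0 None) * Y (override_on x h {Some i}) m"
        if "x \<in> PiE (- {Some i}) LA" "m \<in> Q" for x m
        using V[OF inJ[OF that(1)] that(2)] unfolding YJ by (simp add: override_on_def)
      then show "V (?J f h0 h) m * cnj (V (?J g h0 h) m') = (\<alpha> (h0 None) * cnj (\<alpha> (h0 None)))
        * (Y (override_on f h {Some i}) m * cnj (Y (override_on g h {Some i}) m'))"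
        using fg m by simp
    qed
    also have "\<dots> = (\<Sum>h0\<in>PiE {None} LA. \<alpha> (h0 None) * cnj (\<alpha> (h0 None))) * ?G"
      by (simp only: sum_product)
    also have "(\<Sum>h0\<in>PiE {None} LA. \<alpha> (h0 None) * cnj (\<alpha> (h0 None))) = nrm"
      unfolding sum_PiE_singleton nrm_def by simp
    finally have "nrm * ?G = (if m = m' then \<omega> (?r f) (?r g) else 0)"
      unfolding decoupledD[OF \<omega> rT[OF fg(1)] rT[OF fg(2)] m] by (rule sym)
    then have G: "?G = (if m = m' then \<omega> (?r f) (?r g) / nrm else 0)"
      using \<open>nrm \<noteq> 0\<close> by (auto simp: field_simps)
    have "(\<Sum>h\<in>PiE {Some i} LA. V (override_on f h {Some i}) m * cnj (V (override_on g h {Some i}) m'))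
       = (\<Sum>h\<in>PiE {Some i} LA. (\<alpha> (f None) * cnj (\<alpha> (g None)))
          * (Y (override_on f h {Some i}) m * cnj (Y (override_on g h {Some i}) m')))"
      using V[OF inT] fg m by (intro sum.cong refl) simp
    also have "\<dots> = \<alpha> (f None) * cnj (\<alpha> (g None)) * ?G" by (rule sum_distrib_left[symmetric])
    finally show "(\<Sum>h\<in>PiE {Some i} LA. V (override_on f h {Some i}) m * cnj (V (override_on g h {Some i}) m'))
       = (if m = m' then \<alpha> (f None) * cnj (\<alpha> (g None)) * (\<omega> (?r f) (?r g) / nrm) else 0)"
      unfolding G by simp
  qed
  then have "recovers LA (lin_range Q V) {Some i}"
    using recovers_iff_decoupled[OF iso_V finLA q0(1)] by blast
  then show False
    using no_cloning[OF iso_V finLA _ recovers_V(2)[of j] _ q0, of "{Some i}"] ij by auto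
qed

lemma assisted: "classically_assisted q dA dE V (Oc i) (M i) i"
  using first by (simp add: first_layer_def)

lemma povm_M: "povm {..<dA} (Oc i) (M i)"
  using assisted by (simp add: classically_assisted_def)

abbreviation "B i a \<equiv> helper_branch q dA V (M i a)"

text \<open>By blindness the helper's reduced operator is the same for all secrets and has no
  coherence between different ones, so one constant \<open>p\<close> gives the probability of the
  outcome for every secret.\<close>

lemma branch_kraus:
  assumes "a \<in> Oc i"
  shows "\<exists>(n::nat) Y p. (\<forall>k e m. e \<notin> cfg dE \<or> m \<ge> q \<longrightarrow> Y k e m = 0) \<and>
     (\<forall>\<rho>. B i a \<rho> = (\<lambda>e e'. \<Sum>k<n. conj_by Q (Y k) \<rho> e e')) \<and>
     (\<forall>m\<in>Q. \<forall>m'\<in>Q. (\<Sum>k<n. \<Sum>e\<in>cfg dE. Y k e m * cnj (Y k e m')) = (if m = m' then p else 0))"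
proof -
  have "positive_op {..<dA} (M i a)" using povm_M assms by (simp add: povm_def)
  from positive_op_factor[OF _ this] obtain n :: nat and \<xi> where
    M: "M i a = (\<lambda>x y. \<Sum>k<n. \<xi> k x * cnj (\<xi> k y))" by auto
  define Y where "Y k e m = (\<Sum>x<dA. cnj (\<xi> k x) * V (join x e) m)" for k e m
  have B: "B i a \<rho> = (\<lambda>e e'. \<Sum>k<n. conj_by Q (Y k) \<rho> e e')" for \<rho>
    unfolding M helper_branch_factor by (simp add: Y_def[abs_def])
  have out: "Y k e m = 0" if "e \<notin> cfg dE \<or> m \<ge> q" for k e m
    using V_outside that by (auto simp: Y_def intro!: sum.neutral)
  obtain \<omega> where \<omega>: "decoupled (cfg dE) {..<dA} Q (\<lambda>e a m. V (join a e) m) \<omega>" using blind by blast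
  define p where "p = (\<Sum>k<n. \<Sum>x<dA. \<Sum>x'<dA. cnj (\<xi> k x) * \<xi> k x' * \<omega> x x')"
  have "(\<Sum>k<n. \<Sum>e\<in>cfg dE. Y k e m * cnj (Y k e m')) = (if m = m' then p else 0)" if m: "m \<in> Q" "m' \<in> Q" for m m'
  proof -
    have "(\<Sum>e\<in>cfg dE. Y k e m * cnj (Y k e m')) = (\<Sum>x<dA. \<Sum>x'<dA. cnj (\<xi> k x) * \<xi> k x' * (if m = m' then \<omega> x x' else 0))" for k
    proof -
      have "(\<Sum>e\<in>cfg dE. Y k e m * cnj (Y k e m'))
         = (\<Sum>e\<in>cfg dE. \<Sum>x<dA. \<Sum>x'<dA. cnj (\<xi> k x) * \<xi> k x' * (V (join x e) m * cnj (V (join x' e) m')))"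
        unfolding Y_def by (simp only: cnj_sum sum_product) (simp add: mult_ac)
      also have "\<dots> = (\<Sum>x<dA. \<Sum>x'<dA. cnj (\<xi> k x) * \<xi> k x' * (\<Sum>e\<in>cfg dE. V (join x e) m * cnj (V (join x' e) m')))"
        unfolding sum_distrib_left by (subst sum.swap, intro sum.cong refl, rule sum.swap)
      finally show ?thesis using decoupledD[OF \<omega> _ _ m] by simp
    qed
    then show ?thesis by (auto simp: p_def)
  qed
  with B out show ?thesis by blast
qed

text \<open>The branches of all outcomes add up to an operator of trace \<open>q\<close>. One
  possible outcome for each \<open>i\<close> is needed to bound the dimension of E_i from
  below.\<close>

lemma possible_outcome_exists: "\<exists>a\<in>Oc i. B i a (id_op Q) \<noteq> (\<lambda>_ _. 0)"
proof (rule ccontr)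
  assume "\<not> ?thesis"
  then have zero: "B i a (id_op Q) e e' = 0" if "a \<in> Oc i" for a e e' using that by (simp add: fun_eq_iff)
  have sum: "(\<Sum>a\<in>Oc i. M i a x y) = id_op {..<dA} x y" for x y
    using povm_M[of i] by (simp add: povm_def fun_eq_iff)
  let ?T = "\<lambda>x e y e'. conj_by Q V (id_op Q) (join x e) (join y e')"
  have "(\<Sum>x<dA. ?T x e x e) = (\<Sum>a\<in>Oc i. B i a (id_op Q) e e)" for e
  proof -
    have "(\<Sum>a\<in>Oc i. B i a (id_op Q) e e) = (\<Sum>x<dA. \<Sum>y<dA. (\<Sum>a\<in>Oc i. M i a x y) * ?T y e x e)"
      unfolding helper_branch_def measured_def sum_distrib_right
      by simp (subst sum.swap, rule sum.cong[OF refl], rule sum.swap)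
    also have "\<dots> = (\<Sum>x<dA. \<Sum>y<dA. (if x = y then 1 else 0) * ?T y e x e)"
      unfolding sum by (intro sum.cong refl) (simp add: id_op_def)
    also have "\<dots> = (\<Sum>x<dA. ?T x e x e)" by (simp add: sum_delta_mult)
    finally show ?thesis by simp
  qed
  then have "(\<Sum>e\<in>cfg dE. \<Sum>x<dA. ?T x e x e) = 0" by (simp add: zero)
  also have "(\<Sum>e\<in>cfg dE. \<Sum>x<dA. ?T x e x e) = trace_on (PiE UNIV LA) (conj_by Q V (id_op Q))"
    unfolding trace_on_def sum_join by (rule sum.swap)
  also have "\<dots> = of_nat q"
    using channel_trace[OF channel_isometry[OF iso_V finLA(1)] id_op_opers]
    by (simp add: trace_on_def id_op_def)
  finally show False using q2 by simp
qed

end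

text \<open>One outcome that can occur, with Kraus operators for its branch; the index
  \<open>k\<close> plays the part of a purifying system.\<close>

locale possible_branch = first_layer_ctx q dA dE V Oc M
  for q dA :: nat and dE :: "'i::finite \<Rightarrow> nat" and V Oc M +
  fixes i :: 'i and a n :: nat and Y :: "nat \<Rightarrow> ('i \<Rightarrow> nat, nat) lin" and p :: complex
  assumes outcome: "a \<in> Oc i" and possible: "B i a (id_op Q) \<noteq> (\<lambda>_ _. 0)"
    and Y_outside: "\<And>k e m. e \<notin> cfg dE \<or> m \<ge> q \<Longrightarrow> Y k e m = 0"
    and B_kraus: "\<And>\<rho>. B i a \<rho> = (\<lambda>e e'. \<Sum>k<n. conj_by Q (Y k) \<rho> e e')"
    and Y_norm: "\<And>m m'. m \<in> Q \<Longrightarrow> m' \<in> Q \<Longrightarrow>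
      (\<Sum>k<n. \<Sum>e\<in>cfg dE. Y k e m * cnj (Y k e m')) = (if m = m' then p else 0)"
begin

lemma B_opers: "B i a \<rho> \<in> opers (cfg dE)"
  unfolding B_kraus using Y_outside by (intro opers_sum conj_by_opers) auto

lemma trace_B: "trace_on (cfg dE) (B i a \<rho>) = p * trace_on Q \<rho>"
proof -
  have "trace_on (cfg dE) (B i a \<rho>) = (\<Sum>k<n. trace_on (cfg dE) (conj_by Q (Y k) \<rho>))"
    unfolding B_kraus trace_on_def by (rule sum.swap)
  also have "\<dots> = (\<Sum>k<n. \<Sum>m\<in>Q. \<Sum>m'\<in>Q. \<Sum>e\<in>cfg dE. \<rho> m m' * (Y k e m * cnj (Y k e m')))"
    by (simp add: trace_conj_by sum_distrib_left sum_distrib_right mult_ac)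
  also have "\<dots> = (\<Sum>m\<in>Q. \<Sum>m'\<in>Q. \<rho> m m' * (\<Sum>k<n. \<Sum>e\<in>cfg dE. Y k e m * cnj (Y k e m')))"
    unfolding sum_distrib_left by (subst sum.swap, rule sum.cong[OF refl], rule sum.swap)
  also have "\<dots> = (\<Sum>m\<in>Q. \<Sum>m'\<in>Q. \<rho> m m' * (if m = m' then p else 0))"
    by (intro sum.cong refl) (simp add: Y_norm)
  finally show ?thesis by (simp add: sum_delta_mult trace_on_def sum_distrib_left sum_distrib_right mult.commute)
qed

lemma p_pos: "\<exists>r>0. p = of_real r"
proof -
  have q0: "0 \<in> Q" using q2 by simp
  have nn: "(\<Sum>e\<in>cfg dE. Y k e m * cnj (Y k e m)) \<in> \<real>\<^sub>\<ge>\<^sub>0" for k m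
    by (intro nonneg_Reals_sum cnj_mult_self_nonneg)
  have "(\<Sum>k<n. \<Sum>e\<in>cfg dE. Y k e 0 * cnj (Y k e 0)) \<in> \<real>\<^sub>\<ge>\<^sub>0"
    by (rule nonneg_Reals_sum) (rule nn)
  then have "p \<in> \<real>\<^sub>\<ge>\<^sub>0" using Y_norm[OF q0 q0] by simp
  then obtain r where r: "p = of_real r" "0 \<le> r" by (auto elim: nonneg_Reals_cases)
  have "p \<noteq> 0"
  proof
    assume "p = 0"
    have "Y k e m = 0" if "k < n" for k e m
    proof (cases "e \<in> cfg dE \<and> m \<in> Q")
      case True
      then have "(\<Sum>e\<in>cfg dE. Y k e m * cnj (Y k e m)) = 0"
        using nonneg_Reals_sum_0[of "{..<n}", OF _ nn[of _ m]] Y_norm[of m m] \<open>p = 0\<close> that by auto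
      then have "Y k e m * cnj (Y k e m) = 0"
        by (rule nonneg_Reals_sum_0[OF finLE, rotated]) (use True in \<open>auto intro: cnj_mult_self_nonneg\<close>)
      then show ?thesis by simp
    qed (use Y_outside in auto)
    then have "B i a (id_op Q) = (\<lambda>_ _. 0)" by (simp add: B_kraus conj_by_def)
    then show False using possible by simp
  qed
  then show ?thesis using r by (intro exI[of _ r]) auto
qed

lemma authorizing_i: "authorizing_code Q LE (support_of (cfg dE) (B i a (id_op Q))) {{i}}"
  and recoverable_i: "secret_recoverable Q (PiE {i} LE) (\<lambda>\<rho>. reduce LE {i} (B i a \<rho>))"
  using assisted[of i] outcome possible by (auto simp: classically_assisted_def Let_def)

lemma B_linear: "B i a (\<lambda>x y. c * \<rho> x y + \<sigma> x y) = (\<lambda>x y. c * B i a \<rho> x y + B i a \<sigma> x y)"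
  unfolding B_kraus conj_by_linear by (simp add: sum.distrib sum_distrib_left)

lemma reduce_linear: "reduce L S (\<lambda>x y. c * \<rho> x y + \<sigma> x y) = (\<lambda>x y. c * reduce L S \<rho> x y + reduce L S \<sigma> x y)"
  by (auto simp: reduce_def sum.distrib sum_distrib_left fun_eq_iff)

lemma trace_reduce_B: "trace_on (PiE S LE) (reduce LE S (B i a \<rho>)) = p * trace_on Q \<rho>"
  using trace_reduce[where L = LE, OF _ B_opers] trace_B by simp

lemma decoder_i:
  obtains D where "channel (PiE {i} LE) Q D" "\<And>\<rho>. state Q \<rho> \<Longrightarrow> D (reduce LE {i} (B i a \<rho>)) = (\<lambda>m m'. p * \<rho> m m')"
  using recoverable_i by (auto simp: secret_recoverable_def trace_reduce_B state_def)

text \<open>On a system of dimension at most 1 the reduced operator is determined by its trace, so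
  the secrets 0 and 1 would be decoded alike. The tight codes of the second layer require this
  bound.\<close>

lemma two_le_dE: "2 \<le> dE i"
proof (rule ccontr)
  assume small: "\<not> ?thesis"
  have single: "x = y" if "x \<in> PiE {i} LE" "y \<in> PiE {i} LE" for x y
  proof (rule PiE_ext[OF that])
    fix j assume "j \<in> {i}"
    then show "x j = y j"
      using PiE_mem[OF that(1), of i] PiE_mem[OF that(2), of i] small by simp
  qed
  obtain D where D: "\<And>\<rho>. state Q \<rho> \<Longrightarrow> D (reduce LE {i} (B i a \<rho>)) = (\<lambda>m m'. p * \<rho> m m')"
    using decoder_i by blast
  have st: "state Q (unit_op 0 0)" "state Q (unit_op 1 1)" using q2 by (auto intro: state_unit_op)
  then have "reduce LE {i} (B i a (unit_op 0 0)) = reduce LE {i} (B i a (unit_op 1 1))"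
    by (intro opers_singleton_eq[OF reduce_opers reduce_opers single]) (simp_all add: trace_reduce_B state_def)
  from arg_cong[OF this, of D]
  have "(\<lambda>m m'. p * unit_op 0 (0 :: nat) m m') = (\<lambda>m m'. p * unit_op 1 1 m m')"
    unfolding D[OF st(1)] D[OF st(2)] .
  from fun_cong[OF fun_cong[OF this, of 0], of 0] show False using p_pos by (auto simp: unit_op_def)
qed

text \<open>\<open>E\<^sub>i\<close> decodes the secret, hence the purification of the branch on the other systems does not
  depend on it.\<close>

lemma decoupled_rest:
  "\<exists>\<omega>. decoupled (PiE {i} LE) ({..<n} \<times> PiE (- {i}) LE) Q (\<lambda>s (k, \<epsilon>) m. Y k (override_on \<epsilon> s {i}) m) \<omega>"
proof -
  obtain D where D: "channel (PiE {i} LE) Q D"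
    "\<And>\<rho>. state Q \<rho> \<Longrightarrow> D (reduce LE {i} (B i a \<rho>)) = (\<lambda>m m'. p * \<rho> m m')"
    using decoder_i by blast
  obtain r where r: "0 < r" "p = of_real r" using p_pos by auto
  \<comment> \<open>The branch of a state has trace \<open>p\<close>, not 1; dividing the amplitudes
    by \<open>c\<close> makes the decoder exact on matrix units.\<close>
  define c where "c = complex_of_real (sqrt r)"
  have c: "c * cnj c = p" "c \<noteq> 0" using r by (auto simp: c_def simp flip: of_real_mult)
  let ?J = "\<lambda>s (k, \<epsilon>) m. Y k (override_on \<epsilon> s {i}) m"
  let ?C = "{..<n} \<times> PiE (- {i}) LE"
  have red: "reduce LE {i} (B i a \<rho>) = reduced_op (PiE {i} LE) ?C Q ?J \<rho>" for \<rho>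
  proof (intro ext)
    fix s s'
    show "reduce LE {i} (B i a \<rho>) s s' = reduced_op (PiE {i} LE) ?C Q ?J \<rho> s s'"
    proof (cases "s \<in> PiE {i} LE \<and> s' \<in> PiE {i} LE")
      case True
      then show ?thesis
        unfolding reduce_def reduced_op_def B_kraus sum.cartesian_product'
        by (simp add: conj_by_def) (rule sum.swap)
    qed (auto simp: reduce_def reduced_op_def)
  qed
  have unit: "D (reduced_op (PiE {i} LE) ?C Q ?J (unit_op x x')) = (\<lambda>y y'. p * unit_op x x' y y')"
    if "x \<in> Q" "x' \<in> Q" for x x'
    unfolding red[symmetric]
  proof (rule states_determine_unit_op[OF finLA(1) that])
    fix \<rho> \<sigma> :: "nat oper" and k
    show "D (reduce LE {i} (B i a (\<lambda>x y. k * \<rho> x y + \<sigma> x y)))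
       = (\<lambda>x y. k * D (reduce LE {i} (B i a \<rho>)) x y + D (reduce LE {i} (B i a \<sigma>)) x y)"
      unfolding B_linear reduce_linear by (rule channel_linear[OF D(1) reduce_opers reduce_opers])
  qed (rule D(2))
  let ?J' = "\<lambda>s c' m. (1 / c) * ?J s c' m"
  have scaled: "reduced_op (PiE {i} LE) ?C Q ?J' \<sigma> = (\<lambda>s s'. (1 / p) * reduced_op (PiE {i} LE) ?C Q ?J \<sigma> s s')" for \<sigma>
    unfolding reduced_op_def conj_by_scale using c
    by (auto simp: fun_eq_iff sum_divide_distrib)
  have "D (reduced_op (PiE {i} LE) ?C Q ?J' (unit_op x x')) = unit_op x x'" if "x \<in> Q" "x' \<in> Q" for x x'
    unfolding scaled channel_scale[OF D(1) reduced_op_opers] unit[OF that] using r by simp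
  then obtain \<omega> where "decoupled (PiE {i} LE) ?C Q ?J' \<omega>"
    using decoder_imp_decoupled[OF finLE _ finLA(1) _ D(1), of ?C 0 ?J'] q2 finLE by fastforce
  from decoupled_scale[OF this, of c] c(2) show ?thesis
    by (intro exI) (simp add: split_def)
qed

text \<open>The other systems belong to the environment of E_i; forgetting the purifying index
  leaves a fixed operator scaled by the trace.\<close>

lemma reduce_rest_constant:
  assumes "trace_on Q \<rho> = trace_on Q \<rho>'"
  shows "reduce LE (- {i}) (B i a \<rho>) = reduce LE (- {i}) (B i a \<rho>')"
proof -
  obtain \<omega> where \<omega>: "decoupled (PiE {i} LE) ({..<n} \<times> PiE (- {i}) LE) Q
      (\<lambda>s (k, \<epsilon>) m. Y k (override_on \<epsilon> s {i}) m) \<omega>" using decoupled_rest by blast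
  have ov: "override_on h f (- {i}) = override_on f h {i}" for f h :: "'i \<Rightarrow> nat"
    by (auto simp: override_on_def fun_eq_iff)
  have "reduce LE (- {i}) (B i a \<rho>) f g = (if f \<in> PiE (- {i}) LE \<and> g \<in> PiE (- {i}) LE
     then (\<Sum>k<n. \<omega> (k, f) (k, g)) * trace_on Q \<rho> else 0)" for \<rho> f g
  proof (cases "f \<in> PiE (- {i}) LE \<and> g \<in> PiE (- {i}) LE")
    case True
    have "reduce LE (- {i}) (B i a \<rho>) f g = (\<Sum>h\<in>PiE {i} LE. \<Sum>k<n. \<Sum>m\<in>Q. \<Sum>m'\<in>Q.
        \<rho> m m' * (Y k (override_on f h {i}) m * cnj (Y k (override_on g h {i}) m')))"
      using True by (simp add: reduce_def B_kraus ov conj_by_def mult_ac)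
    also have "\<dots> = (\<Sum>k<n. \<Sum>m\<in>Q. \<Sum>m'\<in>Q. \<rho> m m' * (\<Sum>h\<in>PiE {i} LE.
        Y k (override_on f h {i}) m * cnj (Y k (override_on g h {i}) m')))"
      unfolding sum_distrib_left
      by (subst sum.swap, intro sum.cong refl, subst sum.swap, intro sum.cong refl, rule sum.swap)
    also have "\<dots> = (\<Sum>k<n. \<Sum>m\<in>Q. \<Sum>m'\<in>Q. \<rho> m m' * (if m = m' then \<omega> (k, f) (k, g) else 0))"
      using True decoupledD[OF \<omega>, of "(k, f)" "(k, g)" for k] by simp
    also have "\<dots> = (\<Sum>k<n. \<omega> (k, f) (k, g)) * trace_on Q \<rho>"
      by (simp add: sum_delta_mult trace_on_def sum_product mult.commute) (rule sum.swap)
    finally show ?thesis using True by simp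
  qed (auto simp: reduce_def)
  then show ?thesis using assms by (simp add: fun_eq_iff)
qed

end

lemma (in first_layer_ctx) possible_branch_exists:
  assumes "a \<in> Oc i" "B i a (id_op Q) \<noteq> (\<lambda>_ _. 0)"
  obtains n Y p where "possible_branch q dA dE V Oc M i a n Y p"
proof -
  obtain n :: nat and Y p where "\<forall>k e m. e \<notin> cfg dE \<or> m \<ge> q \<longrightarrow> Y k e m = 0"
    "\<forall>\<rho>. B i a \<rho> = (\<lambda>e e'. \<Sum>k<n. conj_by Q (Y k) \<rho> e e')"
    "\<forall>m\<in>Q. \<forall>m'\<in>Q. (\<Sum>k<n. \<Sum>e\<in>cfg dE. Y k e m * cnj (Y k e m')) = (if m = m' then p else 0)"
    using branch_kraus[OF assms(1)] by (elim exE conjE) (rule that)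
  then have "possible_branch q dA dE V Oc M i a n Y p"
    using assms by unfold_locales auto
  then show ?thesis by (rule that)
qed

lemma (in first_layer_ctx) two_le_dE: "2 \<le> dE i"
proof -
  obtain a where "a \<in> Oc i" "B i a (id_op Q) \<noteq> (\<lambda>_ _. 0)" using possible_outcome_exists by blast
  then obtain n Y p where "possible_branch q dA dE V Oc M i a n Y p" by (rule possible_branch_exists)
  then show ?thesis by (rule possible_branch.two_le_dE)
qed

section \<open>The second layer\<close>

lemma sandwich:
  "(\<Sum>x\<in>X. \<Sum>x'\<in>X. k x * (\<Sum>m\<in>Q. \<Sum>m'\<in>Q. j x m * \<rho> m m' * cnj (j' x' m')) * cnj (k' x'))
   = (\<Sum>m\<in>Q. \<Sum>m'\<in>Q. (\<Sum>x\<in>X. k x * j x m) * \<rho> m m' * cnj (\<Sum>x\<in>X. k' x * j' x m'))"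
proof -
  have "(\<Sum>x\<in>X. \<Sum>x'\<in>X. k x * (\<Sum>m\<in>Q. \<Sum>m'\<in>Q. j x m * \<rho> m m' * cnj (j' x' m')) * cnj (k' x'))
     = (\<Sum>x\<in>X. \<Sum>x'\<in>X. \<Sum>m\<in>Q. \<Sum>m'\<in>Q. \<rho> m m' * ((k x * j x m) * cnj (k' x' * j' x' m')))"
    by (simp add: sum_distrib_left sum_distrib_right mult_ac)
  also have "\<dots> = (\<Sum>m\<in>Q. \<Sum>m'\<in>Q. \<Sum>x\<in>X. \<Sum>x'\<in>X. \<rho> m m' * ((k x * j x m) * cnj (k' x' * j' x' m')))"
    by (rule sum_swap_pairs)
  also have "\<dots> = (\<Sum>m\<in>Q. \<Sum>m'\<in>Q. \<rho> m m' * ((\<Sum>x\<in>X. k x * j x m) * cnj (\<Sum>x\<in>X. k' x * j' x m')))"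
    by (simp only: cnj_sum sum_product) (simp only: sum_distrib_left)
  finally show ?thesis by (simp only: mult_ac)
qed

lemma id_tensor_conj_by_conj_by:
  "id_tensor (conj_by X K) (conj_by Q J \<rho>) = conj_by Q (\<lambda>(z, y) m. \<Sum>x\<in>X. K y x * J (z, x) m) \<rho>"
proof (intro ext, clarify)
  fix z y z' y'
  show "id_tensor (conj_by X K) (conj_by Q J \<rho>) (z, y) (z', y')
     = conj_by Q (\<lambda>(z, y) m. \<Sum>x\<in>X. K y x * J (z, x) m) \<rho> (z, y) (z', y')"
    unfolding id_tensor_def case_prod_conv conj_by_def by (rule sandwich)
qed

lemma conj_by_sum: "conj_by X K (\<lambda>x y. \<Sum>k\<in>I. \<rho> k x y) = (\<lambda>x y. \<Sum>k\<in>I. conj_by X K (\<rho> k) x y)"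
proof (intro ext)
  fix y y'
  have "conj_by X K (\<lambda>x y. \<Sum>k\<in>I. \<rho> k x y) y y' = (\<Sum>x\<in>X. \<Sum>x'\<in>X. \<Sum>k\<in>I. K y x * \<rho> k x x' * cnj (K y' x'))"
    by (simp add: conj_by_def sum_distrib_left sum_distrib_right)
  also have "\<dots> = (\<Sum>k\<in>I. conj_by X K (\<rho> k) y y')"
    unfolding conj_by_def by (rule sym, subst sum.swap, rule sum.cong[OF refl], rule sum.swap)
  finally show "conj_by X K (\<lambda>x y. \<Sum>k\<in>I. \<rho> k x y) y y' = (\<Sum>k\<in>I. conj_by X K (\<rho> k) y y')" .
qed

definition prod_map ::
  "'i set \<Rightarrow> ('i \<Rightarrow> ('y, 'x) lin) \<Rightarrow> ('i \<Rightarrow> 'x set) \<Rightarrow> ('i \<Rightarrow> 'y set) \<Rightarrow> ('i \<Rightarrow> 'y, 'i \<Rightarrow> 'x) lin" where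
  "prod_map S W LE LG f \<epsilon> = (if f \<in> PiE S LG \<and> \<epsilon> \<in> PiE S LE then \<Prod>j\<in>S. W j (f j) (\<epsilon> j) else 0)"

context
  fixes W :: "'i::finite \<Rightarrow> ('y, 'x) lin" and LE :: "'i \<Rightarrow> 'x set" and LG :: "'i \<Rightarrow> 'y set"
  assumes iso: "\<And>i. isometry (LE i) (LG i) (W i)"
    and finE: "\<And>i. finite (LE i)" and finG: "\<And>i. finite (LG i)"
begin

abbreviation "PM S \<equiv> prod_map S W LE LG"

lemma isometry_prod_map: "isometry (PiE S LE) (PiE S LG) (PM S)"
  unfolding isometry_def
proof (intro conjI allI impI ballI)
  fix \<eta> \<eta>' assume \<eta>: "\<eta> \<in> PiE S LE" "\<eta>' \<in> PiE S LE"
  have "(\<Sum>h\<in>PiE S LG. cnj (PM S h \<eta>) * PM S h \<eta>') = (\<Sum>h\<in>PiE S LG. \<Prod>j\<in>S. cnj (W j (h j) (\<eta> j)) * W j (h j) (\<eta>' j))"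
    using \<eta> by (simp add: prod_map_def prod.distrib)
  also have "\<dots> = (\<Prod>j\<in>S. \<Sum>y\<in>LG j. cnj (W j y (\<eta> j)) * W j y (\<eta>' j))"
    using finG by (intro prod_sum_PiE[symmetric]) auto
  also have "\<dots> = (\<Prod>j\<in>S. if \<eta> j = \<eta>' j then 1 else 0)"
    using \<eta> by (intro prod.cong refl isometry_inner[OF iso]) (auto dest: PiE_mem)
  also have "\<dots> = (if \<eta> = \<eta>' then 1 else 0)"
    using PiE_ext[OF \<eta>] by auto
  finally show "(\<Sum>h\<in>PiE S LG. cnj (PM S h \<eta>) * PM S h \<eta>') = (if \<eta> = \<eta>' then 1 else 0)" .
qed (auto simp: prod_map_def)

lemma prod_map_split:
  assumes "f \<in> PiE S LG" "h \<in> PiE (- S) LG" "\<epsilon> \<in> PiE S LE" "\<eta> \<in> PiE (- S) LE"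
  shows "PM UNIV (override_on h f S) (override_on \<eta> \<epsilon> S) = PM S f \<epsilon> * PM (- S) h \<eta>"
proof -
  have "override_on h f S \<in> PiE UNIV LG" "override_on \<eta> \<epsilon> S \<in> PiE UNIV LE"
    using assms by (auto simp: override_on_def PiE_iff)
  moreover have "(\<Prod>j\<in>UNIV. W j (override_on h f S j) (override_on \<eta> \<epsilon> S j))
     = (\<Prod>j\<in>S. W j (override_on h f S j) (override_on \<eta> \<epsilon> S j)) * (\<Prod>j\<in>- S. W j (override_on h f S j) (override_on \<eta> \<epsilon> S j))"
    by (subst prod.union_disjoint[symmetric]) auto
  ultimately show ?thesis using assms by (simp add: prod_map_def)
qed

text \<open>Isometries on the systems outside \<open>S\<close> disappear under their partial trace,
  and those on \<open>S\<close> act on the reduced operator.\<close>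

lemma reduce_prod_map:
  "reduce LG S (conj_by (PiE UNIV LE) (PM UNIV) \<sigma>) = conj_by (PiE S LE) (PM S) (reduce LE S \<sigma>)"
proof (intro ext)
  fix f g
  show "reduce LG S (conj_by (PiE UNIV LE) (PM UNIV) \<sigma>) f g = conj_by (PiE S LE) (PM S) (reduce LE S \<sigma>) f g"
  proof (cases "f \<in> PiE S LG \<and> g \<in> PiE S LG")
    case True
    let ?X = "\<lambda>\<epsilon> \<eta> \<epsilon>' \<eta>'. PM S f \<epsilon> * \<sigma> (override_on \<eta> \<epsilon> S) (override_on \<eta>' \<epsilon>' S) * cnj (PM S g \<epsilon>')"
    have "reduce LG S (conj_by (PiE UNIV LE) (PM UNIV) \<sigma>) f g
       = (\<Sum>h\<in>PiE (- S) LG. \<Sum>\<epsilon>\<in>PiE S LE. \<Sum>\<eta>\<in>PiE (- S) LE. \<Sum>\<epsilon>'\<in>PiE S LE. \<Sum>\<eta>'\<in>PiE (- S) LE.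
           ?X \<epsilon> \<eta> \<epsilon>' \<eta>' * (cnj (PM (- S) h \<eta>') * PM (- S) h \<eta>))"
      using True unfolding reduce_def conj_by_def sum_PiE_UNIV_split[of _ LE S]
      by (simp add: prod_map_split cong: sum.cong) (simp add: mult_ac)
    also have "\<dots> = (\<Sum>\<epsilon>\<in>PiE S LE. \<Sum>\<eta>\<in>PiE (- S) LE. \<Sum>\<epsilon>'\<in>PiE S LE. \<Sum>\<eta>'\<in>PiE (- S) LE.
         ?X \<epsilon> \<eta> \<epsilon>' \<eta>' * (\<Sum>h\<in>PiE (- S) LG. cnj (PM (- S) h \<eta>') * PM (- S) h \<eta>))"
      unfolding sum_distrib_left
      by (subst sum.swap, rule sum.cong[OF refl], subst sum.swap, rule sum.cong[OF refl],
          subst sum.swap, rule sum.cong[OF refl], rule sum.swap)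
    also have "\<dots> = (\<Sum>\<epsilon>\<in>PiE S LE. \<Sum>\<eta>\<in>PiE (- S) LE. \<Sum>\<epsilon>'\<in>PiE S LE. \<Sum>\<eta>'\<in>PiE (- S) LE.
         ?X \<epsilon> \<eta> \<epsilon>' \<eta>' * (if \<eta>' = \<eta> then 1 else 0))"
      by (intro sum.cong refl) (simp add: isometry_inner[OF isometry_prod_map])
    also have "\<dots> = (\<Sum>\<epsilon>\<in>PiE S LE. \<Sum>\<epsilon>'\<in>PiE S LE. \<Sum>\<eta>\<in>PiE (- S) LE. ?X \<epsilon> \<eta> \<epsilon>' \<eta>)"
      using finE by (simp add: sum_delta_mult finite_PiE_type)
        (rule sum.cong[OF refl], rule sum.swap)
    also have "\<dots> = conj_by (PiE S LE) (PM S) (reduce LE S \<sigma>) f g"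
      by (simp add: conj_by_def reduce_def sum_distrib_left sum_distrib_right)
    finally show ?thesis .
  next
    case False
    have z: "PM S f x * r * cnj (PM S g y) = 0" for x y r
      using False by (cases "f \<in> PiE S LG") (simp_all add: prod_map_def)
    have "reduce LG S (conj_by (PiE UNIV LE) (PM UNIV) \<sigma>) f g = 0"
      unfolding reduce_def by (rule if_not_P[OF False])
    then show ?thesis by (simp only: conj_by_def[of "PiE S LE"] z sum.neutral_const)
  qed
qed

end

text \<open>The branch of the identity is the sum of the rank-one operators of the columns, so a ket
  in its kernel is orthogonal to each column.\<close>

lemma (in possible_branch) Y_column:
  assumes "k < n" "m \<in> Q"
  shows "(\<lambda>e. Y k e m) \<in> support_of (cfg dE) (B i a (id_op Q))"
  unfolding support_of_def
proof (intro CollectI conjI ballI impI)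
  show "(\<lambda>e. Y k e m) \<in> kets (cfg dE)" using Y_outside by (auto simp: kets_def)
  fix w assume "app (cfg dE) (B i a (id_op Q)) w = (\<lambda>_. 0)"
  then have "sesq (cfg dE) (B i a (id_op Q)) w w = 0"
    by (simp add: inner_on_app[symmetric] inner_on_def)
  moreover have "B i a (id_op Q) = (\<lambda>e e'. \<Sum>z\<in>{..<n} \<times> Q. (\<lambda>e. Y (fst z) e (snd z)) e * cnj ((\<lambda>e. Y (fst z) e (snd z)) e'))"
  proof (intro ext)
    fix e e'
    have "conj_by Q (Y k) (id_op Q) e e' = (\<Sum>m\<in>Q. Y k e m * cnj (Y k e' m))" for k
    proof -
      have "conj_by Q (Y k) (id_op Q) e e' = (\<Sum>m\<in>Q. \<Sum>m'\<in>Q. (Y k e m * cnj (Y k e' m')) * (if m = m' then 1 else 0))"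
        unfolding conj_by_def by (intro sum.cong refl) (auto simp: id_op_def)
      then show ?thesis by (simp add: sum_delta_mult)
    qed
    then show "B i a (id_op Q) e e' = (\<Sum>z\<in>{..<n} \<times> Q. (\<lambda>e. Y (fst z) e (snd z)) e * cnj ((\<lambda>e. Y (fst z) e (snd z)) e'))"
      unfolding B_kraus sum.cartesian_product' by simp
  qed
  ultimately have "(\<Sum>z\<in>{..<n} \<times> Q. inner_on (cfg dE) w (\<lambda>e. Y (fst z) e (snd z))
      * cnj (inner_on (cfg dE) w (\<lambda>e. Y (fst z) e (snd z)))) = 0"
    by (simp only: sesq_decomposed)
  then have "inner_on (cfg dE) w (\<lambda>e. Y (fst (k, m)) e (snd (k, m)))
      * cnj (inner_on (cfg dE) w (\<lambda>e. Y (fst (k, m)) e (snd (k, m)))) = 0"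
    by (rule nonneg_Reals_sum_0[rotated 2]) (use assms in \<open>auto intro: cnj_mult_self_nonneg\<close>)
  then show "inner_on (cfg dE) w (\<lambda>e. Y k e m) = 0" by simp
qed

text \<open>All Kraus columns lie in the post-measurement subspace, hence so does every branch
  operator. This links recovery of the subspace to recovery of the secret from the state.\<close>

lemma (in possible_branch) B_in_code:
  assumes J: "isometry Q (cfg dE) J" and supp: "lin_range Q J = support_of (cfg dE) (B i a (id_op Q))"
  shows "\<exists>\<sigma>\<in>opers Q. B i a \<rho> = conj_by Q J \<sigma>"
proof
  let ?\<sigma> = "conj_by (cfg dE) (\<lambda>m e. cnj (J e m)) (B i a \<rho>)"
  show "?\<sigma> \<in> opers Q" using isometry_outside[OF J] by (intro conj_by_opers) auto
  have PY: "(\<Sum>e\<in>cfg dE. range_proj Q J z e * Y k e m) = Y k z m" if k: "k < n" and m: "m \<in> Q" for z k m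
  proof -
    obtain u where u: "u \<in> kets Q" "(\<lambda>e. Y k e m) = app Q J u"
      using Y_column[OF k m] supp by (auto simp: lin_range_def)
    have "app (cfg dE) (range_proj Q J) w = app Q J (app (cfg dE) (\<lambda>m e. cnj (J e m)) w)" for w
      by (simp add: app_app range_proj_def)
    then have "app (cfg dE) (range_proj Q J) (app Q J u) = app Q J (app (cfg dE) (\<lambda>m e. cnj (J e m)) (app Q J u))" .
    also have "\<dots> = app Q J u" using isometry_adjoint_app[OF J finLA(1) u(1)] by simp
    finally show ?thesis unfolding u(2)[symmetric] by (simp add: app_def fun_eq_iff)
  qed
  have "conj_by Q J ?\<sigma> = conj_by (cfg dE) (range_proj Q J) (B i a \<rho>)"
    by (simp add: conj_by_range_proj)
  also have "\<dots> = (\<lambda>e e'. \<Sum>k<n. conj_by (cfg dE) (range_proj Q J) (conj_by Q (Y k) \<rho>) e e')"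
    unfolding B_kraus conj_by_sum ..
  also have "\<dots> = (\<lambda>e e'. \<Sum>k<n. conj_by Q (Y k) \<rho> e e')"
  proof (intro ext sum.cong refl)
    fix e e' k assume k: "k \<in> {..<n}"
    have "conj_by Q (\<lambda>z m. \<Sum>e\<in>cfg dE. range_proj Q J z e * Y k e m) \<rho> = conj_by Q (Y k) \<rho>"
      by (intro conj_by_cong refl PY) (use k in auto)
    then show "conj_by (cfg dE) (range_proj Q J) (conj_by Q (Y k) \<rho>) e e' = conj_by Q (Y k) \<rho> e e'"
      unfolding conj_by_conj_by by simp
  qed
  finally show "B i a \<rho> = conj_by Q J ?\<sigma>" by (simp add: B_kraus)
qed

locale two_layers = first_layer_ctx q dA dE V Oc M
  for q dA :: nat and dE :: "'i::finite \<Rightarrow> nat" and V Oc M +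
  fixes dD :: nat and \<psi> U and dB :: "'b::finite \<Rightarrow> 'i \<Rightarrow> nat" and W \<Gamma>
  assumes dealer: "dealer_form q dA dE dD V \<psi> U" and second: "second_layer dE dB W \<Gamma>"
begin

abbreviation "LB \<equiv> (\<lambda>k. cfg (dB k))"
abbreviation "Lsh i \<equiv> (\<lambda>k. {..<dB k i})"
abbreviation "LG \<equiv> (\<lambda>i. cfg (\<lambda>k. dB k i))"
abbreviation "WT \<equiv> W_tot W"
abbreviation "WP S \<equiv> prod_map S W LE LG"

lemma iso_W: "isometry {..<dE i} (LG i) (W i)"
  and code_W: "qss_code {..<dE i} (Lsh i) (lin_range {..<dE i} (W i)) (\<Gamma> i)"
  using second by (auto simp: second_layer_def)

lemma finG: "finite (LG i)" by (rule finite_PiE_type) simp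
lemma finB: "finite (LB k)" by (rule finite_PiE_type) simp
lemma finLB: "finite (PiE S LB)" by (rule finite_PiE_type) (rule finB)
lemma finLG: "finite (PiE S LG)" by (rule finite_PiE_type) (rule finG)
lemma finsh: "finite (PiE S (Lsh i))" by (rule finite_PiE_type) simp

lemmas iso_WP = isometry_prod_map[where W = W and LE = LE and LG = LG, OF iso_W finite_lessThan finG]
lemmas reduce_WP = reduce_prod_map[where W = W and LE = LE and LG = LG, OF iso_W finite_lessThan finG]

lemma WT_eq: "e \<in> cfg dE \<Longrightarrow> WT b e = WP UNIV (\<lambda>i k. b k i) e"
proof (cases "(\<lambda>i k. b k i) \<in> PiE UNIV LG")
  case False
  then obtain i where "(\<lambda>k. b k i) \<notin> LG i" by (metis (no_types, lifting) PiE_I UNIV_I)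
  then have "W i (\<lambda>k. b k i) (e i) = 0" by (intro isometry_outside[OF iso_W] disjI1)
  then show ?thesis using False by (auto simp: W_tot_def prod_map_def)
qed (simp add: W_tot_def prod_map_def)

lemma iso_WT: "isometry (cfg dE) (PiE UNIV LB) WT"
  unfolding isometry_def
proof (intro conjI allI impI ballI)
  fix b e assume out: "b \<notin> PiE UNIV LB \<or> e \<notin> cfg dE"
  have "\<exists>i. W i (\<lambda>k. b k i) (e i) = 0"
  proof (cases "e \<in> cfg dE")
    case True
    then obtain k where "b k \<notin> LB k" using out by (auto simp: PiE_iff)
    then obtain i where "b k i \<notin> {..<dB k i}" unfolding PiE_iff by auto
    then have "(\<lambda>k. b k i) \<notin> LG i" by (auto simp: PiE_iff)
    then have "W i (\<lambda>k. b k i) (e i) = 0" by (intro isometry_outside[OF iso_W] disjI1)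
    then show ?thesis by blast
  next
    case False
    then obtain i where "e i \<notin> {..<dE i}" by (auto simp: PiE_iff)
    then have "W i (\<lambda>k. b k i) (e i) = 0" by (intro isometry_outside[OF iso_W] disjI2)
    then show ?thesis by blast
  qed
  then show "WT b e = 0" by (auto simp: W_tot_def)
next
  fix e e' assume e: "e \<in> cfg dE" "e' \<in> cfg dE"
  have "(\<Sum>b\<in>PiE UNIV LB. cnj (WT b e) * WT b e') = (\<Sum>\<beta>\<in>PiE UNIV LG. cnj (WP UNIV \<beta> e) * WP UNIV \<beta> e')"
    by (rule sum.reindex_bij_witness[where i = "\<lambda>\<beta> k i. \<beta> i k" and j = "\<lambda>b i k. b k i"])
      (use e in \<open>auto simp: PiE_iff WT_eq\<close>)
  then show "(\<Sum>b\<in>PiE UNIV LB. cnj (WT b e) * WT b e') = (if e = e' then 1 else 0)"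
    using isometry_inner[OF iso_WP e] by simp
qed

lemma group_WT: "group_by_system (conj_by (cfg dE) WT \<sigma>) = conj_by (cfg dE) (WP UNIV) \<sigma>"
  unfolding group_by_system_def conj_by_def
  by (intro ext sum.cong refl) (simp add: WT_eq)

text \<open>The complete encoding of the secret into the helper's system and all shares, before any
  measurement.\<close>

definition Vt :: "(nat \<times> ('b \<Rightarrow> 'i \<Rightarrow> nat), nat) lin" where
  "Vt = (\<lambda>(a, b) m. \<Sum>e\<in>cfg dE. WT b e * V (join a e) m)"

lemma iso_Vt: "isometry Q ({..<dA} \<times> PiE UNIV LB) Vt"
  unfolding isometry_def
proof (intro conjI allI impI ballI)
  fix p m assume "p \<notin> {..<dA} \<times> PiE UNIV LB \<or> m \<notin> Q"
  moreover obtain a b where p: "p = (a, b)" by (cases p)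
  ultimately consider "b \<notin> PiE UNIV LB" | "a \<ge> dA \<or> m \<ge> q" by fastforce
  then show "Vt p m = 0"
  proof cases
    case 1
    then have "WT b e = 0" for e using isometry_outside[OF iso_WT, of b e] by blast
    then show ?thesis by (simp add: p Vt_def)
  next
    case 2
    then have "V (join a e) m = 0" for e using V_outside by blast
    then show ?thesis by (simp add: p Vt_def)
  qed
next
  fix m m' assume m: "m \<in> Q" "m' \<in> Q"
  have "(\<Sum>p\<in>{..<dA} \<times> PiE UNIV LB. cnj (Vt p m) * Vt p m')
     = (\<Sum>a<dA. \<Sum>b\<in>PiE UNIV LB. (\<Sum>e\<in>cfg dE. WT b e * V (join a e) m') * cnj (\<Sum>e\<in>cfg dE. WT b e * V (join a e) m))"
    unfolding sum.cartesian_product' by (simp add: Vt_def mult.commute)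
  also have "\<dots> = (\<Sum>a<dA. \<Sum>e\<in>cfg dE. V (join a e) m' * cnj (V (join a e) m))"
    by (simp only: isometry_preserves[OF iso_WT finLE])
  also have "\<dots> = (\<Sum>b\<in>PiE UNIV LA. cnj (V b m) * V b m')"
    unfolding sum_join by (simp add: mult.commute)
  finally show "(\<Sum>p\<in>{..<dA} \<times> PiE UNIV LB. cnj (Vt p m) * Vt p m') = (if m = m' then 1 else 0)"
    using isometry_inner[OF iso_V m] by simp
qed

lemma iso_U: "isometry ({..<dD} \<times> Q) (cfg dE) U"
  using dealer by (simp add: dealer_form_def)

lemma iso_U_tot: "isometry ({..<dD} \<times> Q) (PiE UNIV LB) (U_tot dE W U)"
  unfolding U_tot_def by (rule isometry_comp[OF iso_U iso_WT finLE])

lemma V_dealer: "V (join a e) m = (\<Sum>x<dD. \<psi> (a, x) * U e (x, m))" if "m \<in> Q"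
proof (cases "a < dA \<and> e \<in> cfg dE")
  case True
  then show ?thesis using dealer that by (simp add: dealer_form_def)
next
  case False
  then have "\<psi> (a, x) * U e (x, m) = 0" for x
    using dealer isometry_outside[OF iso_U] by (auto simp: dealer_form_def kets_def)
  then have "(\<Sum>x<dD. \<psi> (a, x) * U e (x, m)) = 0" by (intro sum.neutral) blast
  moreover have "V (join a e) m = 0" using V_outside False by (meson not_le)
  ultimately show ?thesis by simp
qed

text \<open>Arbitrary \<rho> are covered, since the identity yields the operator in
  \<open>programmable\<close> and states yield the encodings whose recovery is discussed.\<close>

lemma tau_eq:
  "id_tensor (conj_by ({..<dD} \<times> Q) (U_tot dE W U))
     (\<lambda>(a, d, m) (a', d', m'). ket_bra \<psi> (a, d) (a', d') * \<rho> m m') = conj_by Q Vt \<rho>"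
proof (intro ext, clarify)
  fix a b a' b'
  have K: "(\<Sum>d<dD. U_tot dE W U b (d, m) * \<psi> (a, d)) = Vt (a, b) m" if "m \<in> Q" for a b m
  proof -
    have "(\<Sum>d<dD. U_tot dE W U b (d, m) * \<psi> (a, d)) = (\<Sum>e\<in>cfg dE. \<Sum>d<dD. WT b e * (\<psi> (a, d) * U e (d, m)))"
      unfolding U_tot_def sum_distrib_right by (subst sum.swap) (simp add: mult_ac)
    then show ?thesis using V_dealer[OF that] by (simp add: Vt_def sum_distrib_left)
  qed
  have "id_tensor (conj_by ({..<dD} \<times> Q) (U_tot dE W U))
      (\<lambda>(a, d, m) (a', d', m'). ket_bra \<psi> (a, d) (a', d') * \<rho> m m') (a, b) (a', b')
     = (\<Sum>d<dD. \<Sum>m<q. \<Sum>d'<dD. \<Sum>m'<q. \<rho> m m' * ((U_tot dE W U b (d, m) * \<psi> (a, d)) * cnj (U_tot dE W U b' (d', m') * \<psi> (a', d'))))"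
    unfolding id_tensor_def conj_by_def sum.cartesian_product' by (simp add: ket_bra_def mult_ac)
  also have "\<dots> = (\<Sum>m<q. \<Sum>m'<q. \<Sum>d<dD. \<Sum>d'<dD. \<rho> m m' * ((U_tot dE W U b (d, m) * \<psi> (a, d)) * cnj (U_tot dE W U b' (d', m') * \<psi> (a', d'))))"
    by (subst sum.swap, rule sum.cong[OF refl], rule sym, subst sum.swap, rule sum.cong[OF refl], rule sum.swap)
  also have "\<dots> = (\<Sum>m<q. \<Sum>m'<q. \<rho> m m' * ((\<Sum>d<dD. U_tot dE W U b (d, m) * \<psi> (a, d)) * cnj (\<Sum>d<dD. U_tot dE W U b' (d, m') * \<psi> (a', d))))"
    by (simp only: cnj_sum sum_product) (simp only: sum_distrib_left)
  also have "\<dots> = conj_by Q Vt \<rho> (a, b) (a', b')"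
    unfolding conj_by_def by (intro sum.cong refl, simp only: K, simp only: mult_ac)
  finally show "id_tensor (conj_by ({..<dD} \<times> Q) (U_tot dE W U))
      (\<lambda>(a, d, m) (a', d', m'). ket_bra \<psi> (a, d) (a', d') * \<rho> m m') (a, b) (a', b') = conj_by Q Vt \<rho> (a, b) (a', b')" .
qed

text \<open>The measurement acts on \<open>A\<close> and \<open>W_tot\<close> on the E_j, so they
  commute: the first layer may be measured before its output is encoded.\<close>

lemma measured_eq:
  "measured {..<dA} N (conj_by Q Vt \<rho>) = conj_by (cfg dE) WT (helper_branch q dA V N \<rho>)"
proof (intro ext)
  fix b b'
  have K: "conj_by Q Vt \<rho> (a, b) (a', b') = (\<Sum>e\<in>cfg dE. \<Sum>e'\<in>cfg dE.
      WT b e * conj_by Q V \<rho> (join a e) (join a' e') * cnj (WT b' e'))" for a a'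
    unfolding conj_by_def Vt_def case_prod_conv by (rule sandwich[symmetric])
  have "measured {..<dA} N (conj_by Q Vt \<rho>) b b' = (\<Sum>a<dA. \<Sum>a'<dA. \<Sum>e\<in>cfg dE. \<Sum>e'\<in>cfg dE.
      WT b e * (N a a' * conj_by Q V \<rho> (join a' e) (join a e')) * cnj (WT b' e'))"
    unfolding measured_def K by (simp add: sum_distrib_left mult_ac)
  also have "\<dots> = (\<Sum>e\<in>cfg dE. \<Sum>e'\<in>cfg dE. \<Sum>a<dA. \<Sum>a'<dA.
      WT b e * (N a a' * conj_by Q V \<rho> (join a' e) (join a e')) * cnj (WT b' e'))"
    by (rule sum_swap_pairs)
  also have "\<dots> = conj_by (cfg dE) WT (helper_branch q dA V N \<rho>) b b'"
    by (simp add: conj_by_def[of "cfg dE"] helper_branch_def measured_def sum_distrib_left sum_distrib_right)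
  finally show "measured {..<dA} N (conj_by Q Vt \<rho>) b b' = conj_by (cfg dE) WT (helper_branch q dA V N \<rho>) b b'" .
qed

end

section \<open>Separation of the shares of one E_i from those of the other systems\<close>

context two_layers
begin

definition full :: "'i \<Rightarrow> ('i \<Rightarrow> 'b \<Rightarrow> nat) \<Rightarrow> ('b \<Rightarrow> nat) \<Rightarrow> 'b \<Rightarrow> 'i \<Rightarrow> nat" where
  "full i \<beta> x = (\<lambda>k j. if j = i then x k else \<beta> j k)"

abbreviation "others i \<equiv> (\<lambda>k. PiE (- {i}) (\<lambda>j. {..<dB k j}))"

lemma fin_others: "finite (PiE S (others i))"
  by (intro finite_PiE_type finite_PiE) auto

definition insert_share :: "'i \<Rightarrow> 'b set \<Rightarrow> ('b \<Rightarrow> nat) \<Rightarrow> ('b \<Rightarrow> 'i \<Rightarrow> nat) \<Rightarrow> 'b \<Rightarrow> 'i \<Rightarrow> nat" where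
  "insert_share i S s r = (\<lambda>k\<in>S. \<lambda>j. if j = i then s k else r k j)"

lemma bij_insert_share:
  "bij_betw (\<lambda>(s, r). insert_share i S s r) (PiE S (Lsh i) \<times> PiE S (others i)) (PiE S LB)"
proof (rule bij_betwI[where g = "\<lambda>b. (\<lambda>k\<in>S. b k i, \<lambda>k\<in>S. \<lambda>j\<in>- {i}. b k j)"])
  show "(\<lambda>(s, r). insert_share i S s r) \<in> PiE S (Lsh i) \<times> PiE S (others i) \<rightarrow> PiE S LB"
    by (auto simp: insert_share_def PiE_iff)
  show "(\<lambda>b. (\<lambda>k\<in>S. b k i, \<lambda>k\<in>S. \<lambda>j\<in>- {i}. b k j)) \<in> PiE S LB \<rightarrow> PiE S (Lsh i) \<times> PiE S (others i)"
    by (auto simp: PiE_iff)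
next
  fix p assume "p \<in> PiE S (Lsh i) \<times> PiE S (others i)"
  then show "(\<lambda>k\<in>S. (case p of (s, r) \<Rightarrow> insert_share i S s r) k i,
      \<lambda>k\<in>S. \<lambda>j\<in>- {i}. (case p of (s, r) \<Rightarrow> insert_share i S s r) k j) = p"
    by (auto simp: insert_share_def PiE_iff extensional_def fun_eq_iff)
next
  fix b assume "b \<in> PiE S LB"
  then show "(case (\<lambda>k\<in>S. b k i, \<lambda>k\<in>S. \<lambda>j\<in>- {i}. b k j) of (s, r) \<Rightarrow> insert_share i S s r) = b"
    by (auto simp: insert_share_def PiE_iff extensional_def fun_eq_iff)
qed

text \<open>The discarded shares are sorted in two ways. By party: the foreign shares of
  \<open>S\<close> and all shares of \<open>- S\<close>. By system: the shares of E_i outside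
  \<open>S\<close> and all shares of the other systems. \<open>G\<close> receives the full label as
  a function of the retained share, which covers rows and columns at once.\<close>

lemma sum_shares:
  "(\<Sum>r\<in>PiE S (others i). \<Sum>c\<in>PiE (- S) LB. G (\<lambda>s. override_on c (insert_share i S s r) S))
   = (\<Sum>h\<in>PiE (- S) (Lsh i). \<Sum>\<beta>\<in>PiE (- {i}) LG. G (\<lambda>s. full i \<beta> (override_on h s S)))"
  unfolding sum.cartesian_product
proof (rule sum.reindex_bij_witness[where
      i = "\<lambda>(h, \<beta>). (\<lambda>k\<in>S. \<lambda>j\<in>- {i}. \<beta> j k, \<lambda>k\<in>- S. \<lambda>j. if j = i then h k else \<beta> j k)" and
      j = "\<lambda>(r, c). (\<lambda>k\<in>- S. c k i, \<lambda>j\<in>- {i}. \<lambda>k. if k \<in> S then r k j else c k j)"])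
  fix x assume "x \<in> PiE S (others i) \<times> PiE (- S) LB"
  then show "(case case x of (r, c) \<Rightarrow> (\<lambda>k\<in>- S. c k i, \<lambda>j\<in>- {i}. \<lambda>k. if k \<in> S then r k j else c k j) of
      (h, \<beta>) \<Rightarrow> (\<lambda>k\<in>S. \<lambda>j\<in>- {i}. \<beta> j k, \<lambda>k\<in>- S. \<lambda>j. if j = i then h k else \<beta> j k)) = x"
    by (auto simp: PiE_iff extensional_def fun_eq_iff)
next
  fix x assume "x \<in> PiE S (others i) \<times> PiE (- S) LB"
  then show "(case x of (r, c) \<Rightarrow> (\<lambda>k\<in>- S. c k i, \<lambda>j\<in>- {i}. \<lambda>k. if k \<in> S then r k j else c k j))
      \<in> PiE (- S) (Lsh i) \<times> PiE (- {i}) LG"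
    by (auto simp: PiE_iff extensional_def)
next
  fix y assume "y \<in> PiE (- S) (Lsh i) \<times> PiE (- {i}) LG"
  then show "(case case y of (h, \<beta>) \<Rightarrow> (\<lambda>k\<in>S. \<lambda>j\<in>- {i}. \<beta> j k, \<lambda>k\<in>- S. \<lambda>j. if j = i then h k else \<beta> j k) of
      (r, c) \<Rightarrow> (\<lambda>k\<in>- S. c k i, \<lambda>j\<in>- {i}. \<lambda>k. if k \<in> S then r k j else c k j)) = y"
    by (auto simp: PiE_iff extensional_def fun_eq_iff)
next
  fix y assume "y \<in> PiE (- S) (Lsh i) \<times> PiE (- {i}) LG"
  then show "(case y of (h, \<beta>) \<Rightarrow> (\<lambda>k\<in>S. \<lambda>j\<in>- {i}. \<beta> j k, \<lambda>k\<in>- S. \<lambda>j. if j = i then h k else \<beta> j k))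
      \<in> PiE S (others i) \<times> PiE (- S) LB"
    by (auto simp: PiE_iff extensional_def)
next
  fix x assume "x \<in> PiE S (others i) \<times> PiE (- S) LB"
  obtain r c where x: "x = (r, c)" by (cases x)
  have "full i (\<lambda>j\<in>- {i}. \<lambda>k. if k \<in> S then r k j else c k j) (override_on (\<lambda>k\<in>- S. c k i) s S)
     = override_on c (insert_share i S s r) S" for s
    by (auto simp: full_def insert_share_def override_on_def fun_eq_iff)
  then show "(case case x of (r, c) \<Rightarrow> (\<lambda>k\<in>- S. c k i, \<lambda>j\<in>- {i}. \<lambda>k. if k \<in> S then r k j else c k j) of
      (h, \<beta>) \<Rightarrow> G (\<lambda>s. full i \<beta> (override_on h s S))) = (case x of (r, c) \<Rightarrow> G (\<lambda>s. override_on c (insert_share i S s r) S))"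
    by (simp add: x)
qed

definition local_op :: "'i \<Rightarrow> ('i \<Rightarrow> nat) oper \<Rightarrow> nat oper" where
  "local_op i \<sigma> = (\<lambda>n n'. reduce LE {i} \<sigma> (\<lambda>j\<in>{i}. n) (\<lambda>j\<in>{i}. n'))"

lemma local_op_opers: "local_op i \<sigma> \<in> opers {..<dE i}"
  unfolding local_op_def by (auto simp: reduce_def opers_def PiE_iff)

lemma reduce_group_single:
  assumes "y \<in> LG i" "y' \<in> LG i"
  shows "reduce LG {i} (conj_by (cfg dE) (WP UNIV) \<sigma>) (\<lambda>j\<in>{i}. y) (\<lambda>j\<in>{i}. y')
     = conj_by {..<dE i} (W i) (local_op i \<sigma>) y y'"
proof -
  have "WP {i} (\<lambda>j\<in>{i}. y) (\<lambda>j\<in>{i}. n) = W i y n" if "y \<in> LG i" "n < dE i" for y n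
    using that by (simp add: prod_map_def PiE_iff)
  then show ?thesis
    unfolding reduce_WP
    unfolding conj_by_def[of "PiE {i} LE"] conj_by_def[of "{..<dE i}"] sum_PiE_singleton local_op_def
    using assms by (intro sum.cong refl) simp
qed

lemma group_full: "group_by_system \<rho> (override_on \<beta> (\<lambda>j\<in>{i}. y) {i}) (override_on \<beta> (\<lambda>j\<in>{i}. y') {i})
   = \<rho> (full i \<beta> y) (full i \<beta> y')"
proof -
  have "(\<lambda>k j. override_on \<beta> (\<lambda>j\<in>{i}. y) {i} j k) = full i \<beta> y" for y
    by (auto simp: full_def override_on_def fun_eq_iff)
  then show ?thesis by (simp add: group_by_system_def)
qed

text \<open>Once the foreign shares are dropped, \<open>S\<close> holds its shares of an E_i encoded
  on its own, because the isometries on the other systems vanish in the trace.\<close>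

lemma discard_others:
  "ptr (insert_share i S) (PiE S (Lsh i)) (PiE S (others i)) (reduce LB S (conj_by (cfg dE) WT \<sigma>))
   = reduce (Lsh i) S (conj_by {..<dE i} (W i) (local_op i \<sigma>))"
proof (intro ext)
  fix s s'
  let ?\<rho> = "conj_by (cfg dE) WT \<sigma>"
  show "ptr (insert_share i S) (PiE S (Lsh i)) (PiE S (others i)) (reduce LB S ?\<rho>) s s'
     = reduce (Lsh i) S (conj_by {..<dE i} (W i) (local_op i \<sigma>)) s s'"
  proof (cases "s \<in> PiE S (Lsh i) \<and> s' \<in> PiE S (Lsh i)")
    case True
    have ins: "insert_share i S x r \<in> PiE S LB" if "x \<in> PiE S (Lsh i)" "r \<in> PiE S (others i)" for x r
      using bspec[OF bij_betwE[OF bij_insert_share], of "(x, r)"] that by simp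
    have y: "override_on h x S \<in> LG i" if "x \<in> PiE S (Lsh i)" "h \<in> PiE (- S) (Lsh i)" for x h
    proof (rule PiE_I)
      fix k show "override_on h x S k \<in> {..<dB k i}"
        using PiE_mem[OF that(1), of k] PiE_mem[OF that(2), of k] by (cases "k \<in> S") auto
    qed simp
    have lab: "(\<lambda>j\<in>{i}. z) \<in> PiE {i} LG" if "z \<in> LG i" for z using that by (auto simp: PiE_iff)
    have "ptr (insert_share i S) (PiE S (Lsh i)) (PiE S (others i)) (reduce LB S ?\<rho>) s s'
       = (\<Sum>r\<in>PiE S (others i). \<Sum>c\<in>PiE (- S) LB. ?\<rho> (override_on c (insert_share i S s r) S) (override_on c (insert_share i S s' r) S))"
      using True ins by (simp add: ptr_def reduce_def)
    also have "\<dots> = (\<Sum>h\<in>PiE (- S) (Lsh i). \<Sum>\<beta>\<in>PiE (- {i}) LG.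
        ?\<rho> (full i \<beta> (override_on h s S)) (full i \<beta> (override_on h s' S)))"
      using sum_shares[where G = "\<lambda>g. ?\<rho> (g s) (g s')" and S = S and i = i] by simp
    also have "\<dots> = (\<Sum>h\<in>PiE (- S) (Lsh i). reduce LG {i} (group_by_system ?\<rho>)
        (\<lambda>j\<in>{i}. override_on h s S) (\<lambda>j\<in>{i}. override_on h s' S))"
    proof (rule sum.cong[OF refl])
      fix h assume "h \<in> PiE (- S) (Lsh i)"
      then show "(\<Sum>\<beta>\<in>PiE (- {i}) LG. ?\<rho> (full i \<beta> (override_on h s S)) (full i \<beta> (override_on h s' S)))
         = reduce LG {i} (group_by_system ?\<rho>) (\<lambda>j\<in>{i}. override_on h s S) (\<lambda>j\<in>{i}. override_on h s' S)"
        using lab[OF y] True unfolding reduce_def group_full by (simp only: if_True simp_thms)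
    qed
    also have "\<dots> = reduce (Lsh i) S (conj_by {..<dE i} (W i) (local_op i \<sigma>)) s s'"
      using True y unfolding group_WT by (simp add: reduce_group_single reduce_def[of "Lsh i"])
    finally show ?thesis .
  next
    case False
    show ?thesis
      unfolding ptr_def reduce_def[of "Lsh i"] if_not_P[OF False] by (rule refl)
  qed
qed

lemma share_decoder:
  assumes S: "S \<in> \<Gamma> i"
  shows "\<exists>R. channel (PiE S LB) (PiE {i} LE) R \<and>
     (\<forall>\<sigma>\<in>opers (cfg dE). R (reduce LB S (conj_by (cfg dE) WT \<sigma>)) = reduce LE {i} \<sigma>)"
proof -
  have "recovers (Lsh i) (lin_range {..<dE i} (W i)) S"
    using code_W S by (simp add: qss_code_def)
  moreover have "0 \<in> {..<dE i}" using two_le_dE[of i] by simp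
  ultimately obtain D where D: "channel (PiE S (Lsh i)) {..<dE i} D"
    "\<And>\<sigma>. \<sigma> \<in> opers {..<dE i} \<Longrightarrow> D (reduce (Lsh i) S (conj_by {..<dE i} (W i) \<sigma>)) = \<sigma>"
    using recovers_iff_decoder[OF iso_W finite_lessThan finite_lessThan] by blast
  let ?T = "ptr (insert_share i S) (PiE S (Lsh i)) (PiE S (others i))"
  have T: "channel (PiE S LB) (PiE S (Lsh i)) ?T"
    by (rule channel_ptr[OF bij_insert_share finLB fin_others])
  \<comment> \<open>Only a relabelling: numbers below \<open>dE i\<close> become functions on
    \<open>{i}\<close>.\<close>
  let ?L = "ptr (\<lambda>f (_ :: unit). f i) (PiE {i} LE) {()}"
  have "bij_betw (\<lambda>(f, _ :: unit). f i) (PiE {i} LE \<times> {()}) {..<dE i}"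
    by (rule bij_betwI[where g = "\<lambda>n. (\<lambda>j\<in>{i}. n, ())"]) (auto simp: PiE_iff extensional_def fun_eq_iff)
  then have L: "channel {..<dE i} (PiE {i} LE) ?L" by (rule channel_ptr) auto
  have "?L (D (?T (reduce LB S (conj_by (cfg dE) WT \<sigma>)))) = reduce LE {i} \<sigma>" for \<sigma>
  proof (intro ext)
    fix f g
    have single: "(\<lambda>j\<in>{i}. f i) = f" if "f \<in> PiE {i} LE" for f
      using that by (auto simp: PiE_iff extensional_def fun_eq_iff)
    have "D (?T (reduce LB S (conj_by (cfg dE) WT \<sigma>))) = local_op i \<sigma>"
      by (simp only: discard_others D(2)[OF local_op_opers])
    then show "?L (D (?T (reduce LB S (conj_by (cfg dE) WT \<sigma>)))) f g = reduce LE {i} \<sigma> f g"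
      using single opers_outside[OF reduce_opers[of LE "{i}" \<sigma>], of f g]
      by (auto simp: ptr_def[of _ "PiE {i} LE"] local_op_def)
  qed
  then show ?thesis using channel_comp[OF channel_comp[OF T D(1)] L] by blast
qed

abbreviation "Br i a \<rho> \<equiv> conj_by (cfg dE) WT (B i a \<rho>)"

text \<open>Only the structure of the branches depends on \<open>code\<close>. Erasure of
  \<open>A\<close> is corrected because \<open>W_tot\<close>, an isometry on the E_j, preserves the
  decoupling of the helper.\<close>

lemma programmableI:
  assumes "\<And>i a. a \<in> Oc i \<Longrightarrow> B i a (id_op Q) \<noteq> (\<lambda>_ _. 0) \<Longrightarrow>
    code Q LB (support_of (PiE UNIV LB) (Br i a (id_op Q))) (\<Gamma> i)"
  shows "programmable code Q LB {..<dA} {..<dD} \<Gamma> (ket_bra \<psi>) (conj_by ({..<dD} \<times> Q) (U_tot dE W U)) Oc M"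
  unfolding programmable_def tau_eq Let_def
proof (intro conjI allI ballI impI)
  have "\<psi> \<in> kets ({..<dA} \<times> {..<dD})" "inner_on ({..<dA} \<times> {..<dD}) \<psi> \<psi> = 1"
    using dealer by (auto simp: dealer_form_def)
  then show "state ({..<dA} \<times> {..<dD}) (ket_bra \<psi>)"
    by (simp add: state_def ket_bra_positive) (simp add: trace_on_def inner_on_def ket_bra_def mult.commute)
  show "channel ({..<dD} \<times> Q) (PiE UNIV LB) (conj_by ({..<dD} \<times> Q) (U_tot dE W U))"
    by (intro channel_isometry iso_U_tot) simp
  show "povm {..<dA} (Oc i) (M i)" for i by (rule povm_M)
next
  fix i a assume a: "a \<in> Oc i" and nz: "measured {..<dA} (M i a) (conj_by Q Vt (id_op Q)) \<noteq> (\<lambda>_ _. 0)"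
  have "B i a (id_op Q) \<noteq> (\<lambda>_ _. 0)"
    using nz unfolding measured_eq by (auto simp: conj_by_def)
  then show "code Q LB (support_of (PiE UNIV LB) (measured {..<dA} (M i a) (conj_by Q Vt (id_op Q)))) (\<Gamma> i)"
    unfolding measured_eq by (rule assms[OF a])
next
  let ?Y = "{..<dA} \<times> PiE UNIV LB"
  have finY: "finite ?Y" using finLB by simp
  have supp: "support_of ?Y (conj_by Q Vt (id_op Q)) = lin_range Q Vt"
    by (rule support_of_code[OF iso_Vt _ finY]) simp
  show "code_for Q ?Y (support_of ?Y (conj_by Q Vt (id_op Q)))"
    unfolding supp code_for_def using iso_Vt by blast
  have q0: "0 \<in> Q" using q2 by simp
  obtain \<omega> where \<omega>: "decoupled (cfg dE) {..<dA} Q (\<lambda>e a m. V (join a e) m) \<omega>" using blind by blast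
  have dec: "decoupled (PiE UNIV LB) {..<dA} Q (\<lambda>b a m. Vt (a, b) m) \<omega>"
    unfolding decoupled_def
  proof (intro ballI)
    fix a a' m m' assume *: "a \<in> {..<dA}" "a' \<in> {..<dA}" "m \<in> Q" "m' \<in> Q"
    have "(\<Sum>b\<in>PiE UNIV LB. Vt (a, b) m * cnj (Vt (a', b) m')) = (\<Sum>e\<in>cfg dE. V (join a e) m * cnj (V (join a' e) m'))"
      unfolding Vt_def case_prod_conv by (rule isometry_preserves[OF iso_WT finLE])
    then show "(\<Sum>b\<in>PiE UNIV LB. Vt (a, b) m * cnj (Vt (a', b) m')) = (if m = m' then \<omega> a a' else 0)"
      using decoupledD[OF \<omega> *] by simp
  qed
  have norm: "(\<Sum>b\<in>PiE UNIV LB. \<Sum>a<dA. Vt (a, b) 0 * cnj (Vt (a, b) 0)) = 1"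
    using isometry_inner[OF iso_Vt q0 q0] unfolding sum.cartesian_product'
    by (subst sum.swap) (simp add: mult.commute)
  obtain D where D: "channel (PiE UNIV LB) Q D"
    "\<And>\<sigma>. \<sigma> \<in> opers Q \<Longrightarrow> D (reduced_op (PiE UNIV LB) {..<dA} Q (\<lambda>b a m. Vt (a, b) m) \<sigma>) = \<sigma>"
    using decoupled_imp_decoder[OF finLB _ finLA(1) q0 dec norm] by auto
  have red: "trace_fst {..<dA} (conj_by Q Vt \<sigma>) = reduced_op (PiE UNIV LB) {..<dA} Q (\<lambda>b a m. Vt (a, b) m) \<sigma>" for \<sigma>
  proof (intro ext)
    fix b b'
    show "trace_fst {..<dA} (conj_by Q Vt \<sigma>) b b' = reduced_op (PiE UNIV LB) {..<dA} Q (\<lambda>b a m. Vt (a, b) m) \<sigma> b b'"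
    proof (cases "b \<in> PiE UNIV LB \<and> b' \<in> PiE UNIV LB")
      case False
      then have "Vt (a, b) m * \<sigma> m m' * cnj (Vt (a, b') m') = 0" for a m m'
        using isometry_outside[OF iso_Vt, of "(a, b)"] isometry_outside[OF iso_Vt, of "(a, b')"] by auto
      moreover have "reduced_op (PiE UNIV LB) {..<dA} Q (\<lambda>b a m. Vt (a, b) m) \<sigma> b b' = 0"
        unfolding reduced_op_def by (rule if_not_P[OF False])
      ultimately show ?thesis by (simp only: trace_fst_def conj_by_def sum.neutral_const)
    next
      case True
      then show ?thesis unfolding reduced_op_def by (simp only: trace_fst_def conj_by_def if_True simp_thms)
    qed
  qed
  let ?R = "\<lambda>\<rho>. conj_by Q Vt (D \<rho>)"
  have R: "channel (PiE UNIV LB) ?Y ?R" by (rule channel_comp[OF D(1) channel_isometry[OF iso_Vt finLA(1)]])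
  have "\<forall>\<sigma>\<in>opers Q. ?R (trace_fst {..<dA} (conj_by Q Vt \<sigma>)) = conj_by Q Vt \<sigma>"
    using D(2) by (simp add: red)
  then have "\<forall>\<rho>\<in>opers ?Y. ?R (trace_fst {..<dA} (conj_by ?Y (projector ?Y (lin_range Q Vt)) \<rho>))
      = conj_by ?Y (projector ?Y (lin_range Q Vt)) \<rho>"
    unfolding all_projected_iff[OF iso_Vt finLA(1) finY, of "\<lambda>\<pi>. ?R (trace_fst {..<dA} \<pi>) = \<pi>"] .
  with R show "\<exists>R. channel (PiE UNIV LB) ?Y R \<and>
      (\<forall>\<rho>\<in>opers ?Y. R (trace_fst {..<dA} (conj_by ?Y (projector ?Y (support_of ?Y (conj_by Q Vt (id_op Q)))) \<rho>))
         = conj_by ?Y (projector ?Y (support_of ?Y (conj_by Q Vt (id_op Q)))) \<rho>)"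
    unfolding supp by (intro exI[of _ ?R] conjI)
qed

end

section \<open>A single possible outcome under both layers\<close>

locale possible_two_layers =
  two_layers q dA dE V Oc M dD \<psi> U dB W \<Gamma> + possible_branch q dA dE V Oc M i a n Y p
  for q dA :: nat and dE :: "'i::finite \<Rightarrow> nat" and V Oc M dD \<psi> U
    and dB :: "'b::finite \<Rightarrow> 'i \<Rightarrow> nat" and W \<Gamma> i a n Y p
begin

lemma trace_reduce_branch: "trace_on (PiE S LB) (reduce LB S (Br i a \<rho>)) = p * trace_on Q \<rho>"
  using trace_reduce[where L = LB, OF finB channel_opers[OF channel_isometry[OF iso_WT finLE] B_opers]]
    channel_trace[OF channel_isometry[OF iso_WT finLE] B_opers] trace_B by simp

lemma recover_Q_iff:
  "secret_recoverable Q (PiE S LB) (\<lambda>\<rho>. reduce LB S (Br i a \<rho>)) \<longleftrightarrow>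
   (\<exists>R. channel (PiE S LB) Q R \<and> (\<forall>\<rho>. state Q \<rho> \<longrightarrow> R (reduce LB S (Br i a \<rho>)) = (\<lambda>m m'. p * \<rho> m m')))"
  by (auto simp: secret_recoverable_def trace_reduce_branch state_def)

lemma authorized_recover_Q:
  assumes "S \<in> \<Gamma> i"
  shows "secret_recoverable Q (PiE S LB) (\<lambda>\<rho>. reduce LB S (Br i a \<rho>))"
proof -
  obtain R where R: "channel (PiE S LB) (PiE {i} LE) R"
    "\<And>\<sigma>. \<sigma> \<in> opers (cfg dE) \<Longrightarrow> R (reduce LB S (conj_by (cfg dE) WT \<sigma>)) = reduce LE {i} \<sigma>"
    using share_decoder[OF assms] by blast
  obtain D where D: "channel (PiE {i} LE) Q D"
    "\<And>\<rho>. state Q \<rho> \<Longrightarrow> D (reduce LE {i} (B i a \<rho>)) = (\<lambda>m m'. p * \<rho> m m')"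
    using decoder_i by blast
  show ?thesis
    unfolding recover_Q_iff
    using channel_comp[OF R(1) D(1)] R(2)[OF B_opers] D(2) by (intro exI[of _ "\<lambda>\<rho>. D (R \<rho>)"]) simp
qed

text \<open>Taking the support commutes with the isometry \<open>W_tot\<close>, so the code on the
  shares is the encoded post-measurement code of the first layer.\<close>

lemma branch_code:
  obtains J where "isometry Q (cfg dE) J" "lin_range Q J = support_of (cfg dE) (B i a (id_op Q))"
    "recovers LE (lin_range Q J) {i}"
    "isometry Q (PiE UNIV LB) (\<lambda>b m. \<Sum>e\<in>cfg dE. WT b e * J e m)"
    "support_of (PiE UNIV LB) (Br i a (id_op Q)) = lin_range Q (\<lambda>b m. \<Sum>e\<in>cfg dE. WT b e * J e m)"
proof -
  obtain J where J: "isometry Q (cfg dE) J" "lin_range Q J = support_of (cfg dE) (B i a (id_op Q))"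
    using authorizing_i by (auto simp: authorizing_code_def code_for_def)
  have "recovers LE (lin_range Q J) {i}"
    using authorizing_i J(2) by (simp add: authorizing_code_def)
  moreover have "support_of (PiE UNIV LB) (Br i a (id_op Q)) = lin_range Q (\<lambda>b m. \<Sum>e\<in>cfg dE. WT b e * J e m)"
    unfolding support_of_conj_by[OF iso_WT finLE finLB B_opers] J(2)[symmetric]
    by (simp add: lin_range_def image_image app_app)
  ultimately show ?thesis using that[OF J _ isometry_comp[OF J(1) iso_WT finLE]] by blast
qed

text \<open>\<open>S\<close> restores the reduced operator on E_i, from which the first-layer code
  restores the joint state of all E_j; encoding this anew gives the codeword.\<close>

lemma branch_authorizing: "authorizing_code Q LB (support_of (PiE UNIV LB) (Br i a (id_op Q))) (\<Gamma> i)"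
proof -
  obtain J where J: "isometry Q (cfg dE) J" "lin_range Q J = support_of (cfg dE) (B i a (id_op Q))"
    "recovers LE (lin_range Q J) {i}"
    and J': "isometry Q (PiE UNIV LB) (\<lambda>b m. \<Sum>e\<in>cfg dE. WT b e * J e m)"
    and supp: "support_of (PiE UNIV LB) (Br i a (id_op Q)) = lin_range Q (\<lambda>b m. \<Sum>e\<in>cfg dE. WT b e * J e m)"
    by (rule branch_code)
  let ?J' = "\<lambda>b m. \<Sum>e\<in>cfg dE. WT b e * J e m"
  obtain R1 where R1: "channel (PiE {i} LE) (cfg dE) R1"
    "\<And>\<sigma>. \<sigma> \<in> opers Q \<Longrightarrow> R1 (reduce LE {i} (conj_by Q J \<sigma>)) = conj_by Q J \<sigma>"
    using J(3) recovers_iff_channel[OF J(1) finLA(1), of "{i}"] by auto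
  have "recovers LB (lin_range Q ?J') S" if S: "S \<in> \<Gamma> i" for S
  proof -
    obtain R where R: "channel (PiE S LB) (PiE {i} LE) R"
      "\<And>\<sigma>. \<sigma> \<in> opers (cfg dE) \<Longrightarrow> R (reduce LB S (conj_by (cfg dE) WT \<sigma>)) = reduce LE {i} \<sigma>"
      using share_decoder[OF S] by blast
    have "conj_by (cfg dE) WT (R1 (R (reduce LB S (conj_by Q ?J' \<sigma>)))) = conj_by Q ?J' \<sigma>" if "\<sigma> \<in> opers Q" for \<sigma>
      unfolding conj_by_conj_by[symmetric]
      using R(2)[OF channel_opers[OF channel_isometry[OF J(1) finLA(1)] that]] R1(2)[OF that] by simp
    then show ?thesis
      unfolding recovers_iff_channel[OF J' finLA(1) finB]
      using channel_comp[OF channel_comp[OF R(1) R1(1)] channel_isometry[OF iso_WT finLE]] by blast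
  qed
  then show ?thesis unfolding supp authorizing_code_def code_for_def using J' by blast
qed

text \<open>The branch state lies in the code, so a recovery of the code restores it; then
  \<open>W_tot\<close> is undone and E_i decodes. With tightness this keeps unauthorized sets from
  recovering even the subspace.\<close>

lemma recovers_imp_recover_Q:
  assumes rec: "recovers LB (support_of (PiE UNIV LB) (Br i a (id_op Q))) S"
  shows "secret_recoverable Q (PiE S LB) (\<lambda>\<rho>. reduce LB S (Br i a \<rho>))"
proof -
  obtain J where J: "isometry Q (cfg dE) J" "lin_range Q J = support_of (cfg dE) (B i a (id_op Q))"
    "recovers LE (lin_range Q J) {i}"
    and J': "isometry Q (PiE UNIV LB) (\<lambda>b m. \<Sum>e\<in>cfg dE. WT b e * J e m)"
    and supp: "support_of (PiE UNIV LB) (Br i a (id_op Q)) = lin_range Q (\<lambda>b m. \<Sum>e\<in>cfg dE. WT b e * J e m)"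
    by (rule branch_code)
  let ?J' = "\<lambda>b m. \<Sum>e\<in>cfg dE. WT b e * J e m"
  obtain R where R: "channel (PiE S LB) (PiE UNIV LB) R"
    "\<And>\<sigma>. \<sigma> \<in> opers Q \<Longrightarrow> R (reduce LB S (conj_by Q ?J' \<sigma>)) = conj_by Q ?J' \<sigma>"
    using rec unfolding supp recovers_iff_channel[OF J' finLA(1) finB] by blast
  \<comment> \<open>Inverting the isometry needs a label to which the complement of its range is
    sent.\<close>
  have "(\<lambda>_. 0) \<in> cfg dE" using two_le_dE first_layer_ctx.two_le_dE[OF first_layer_ctx_axioms]
    by (auto simp: PiE_iff intro: less_le_trans[of 0 2])
  then obtain K where K: "channel (PiE UNIV LB) (cfg dE) K"
    "\<And>\<sigma>. \<sigma> \<in> opers (cfg dE) \<Longrightarrow> K (conj_by (cfg dE) WT \<sigma>) = \<sigma>"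
    using isometry_left_inverse[OF iso_WT finLE finLB] by blast
  obtain D where D: "channel (PiE {i} LE) Q D"
    "\<And>\<rho>. state Q \<rho> \<Longrightarrow> D (reduce LE {i} (B i a \<rho>)) = (\<lambda>m m'. p * \<rho> m m')"
    using decoder_i by blast
  have red: "channel (cfg dE) (PiE {i} LE) (reduce LE {i})" by (rule channel_reduce) simp
  have "D (reduce LE {i} (K (R (reduce LB S (Br i a \<rho>))))) = (\<lambda>m m'. p * \<rho> m m')" if \<rho>: "state Q \<rho>" for \<rho>
  proof -
    obtain \<sigma> where \<sigma>: "\<sigma> \<in> opers Q" "B i a \<rho> = conj_by Q J \<sigma>" using B_in_code[OF J(1,2)] by blast
    have "Br i a \<rho> = conj_by Q ?J' \<sigma>" unfolding \<sigma>(2) by (rule conj_by_conj_by)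
    then have "R (reduce LB S (Br i a \<rho>)) = Br i a \<rho>" using R(2)[OF \<sigma>(1)] by simp
    then show ?thesis using K(2)[OF B_opers] D(2)[OF \<rho>] by simp
  qed
  then show ?thesis
    unfolding recover_Q_iff
    using channel_comp[OF channel_comp[OF channel_comp[OF R(1) K(1)] red] D(1)] by blast
qed

lemma other_shares_no_information:
  "no_information Q (\<lambda>\<rho>. reduce LG (- {i}) (group_by_system (Br i a \<rho>)))"
proof -
  have "reduce LG (- {i}) (group_by_system (Br i a \<rho>)) = reduce LG (- {i}) (group_by_system (Br i a \<rho>'))"
    if "state Q \<rho>" "state Q \<rho>'" for \<rho> \<rho>'
    unfolding group_WT reduce_WP
    using reduce_rest_constant[of \<rho> \<rho>'] that by (simp add: state_def)
  then show ?thesis unfolding no_information_def by blast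
qed

end

section \<open>Extraction from a recoverable branch\<close>

context possible_two_layers
begin

definition Z :: "('b \<Rightarrow> 'i \<Rightarrow> nat) \<Rightarrow> nat \<Rightarrow> nat \<Rightarrow> complex" where
  "Z b k m = (\<Sum>e\<in>cfg dE. WT b e * Y k e m)"

text \<open>The branch amplitude with every system except E_i encoded: \<open>k\<close> is the
  purifying index, \<beta> the foreign shares, \<open>x\<close> the label of the bare E_i.\<close>

definition side_ket :: "nat \<times> ('i \<Rightarrow> 'b \<Rightarrow> nat) \<Rightarrow> nat \<Rightarrow> nat \<Rightarrow> complex" where
  "side_ket = (\<lambda>(k, \<beta>) x m. \<Sum>\<epsilon>\<in>PiE (- {i}) LE. WP (- {i}) \<beta> \<epsilon> * Y k (override_on \<epsilon> (\<lambda>j\<in>{i}. x) {i}) m)"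

definition sides :: "(nat \<times> ('i \<Rightarrow> 'b \<Rightarrow> nat)) set" where
  "sides = {..<n} \<times> PiE (- {i}) LG"

lemma finite_sides: "finite sides"
  unfolding sides_def by (intro finite_cartesian_product finLG) simp

lemma Br_eq: "Br i a \<rho> = (\<lambda>b b'. \<Sum>k<n. conj_by Q (\<lambda>b m. Z b k m) \<rho> b b')"
  unfolding B_kraus conj_by_sum conj_by_conj_by Z_def ..

lemma Z_full:
  assumes \<beta>: "\<beta> \<in> PiE (- {i}) LG" and y: "y \<in> LG i"
  shows "Z (full i \<beta> y) k m = (\<Sum>x<dE i. W i y x * side_ket (k, \<beta>) x m)"
proof -
  have lab: "(\<lambda>j\<in>{i}. y) \<in> PiE {i} LG" using y by (auto simp: PiE_iff)
  have W: "WT (full i \<beta> y) (override_on \<epsilon> (\<lambda>j\<in>{i}. x) {i}) = W i y x * WP (- {i}) \<beta> \<epsilon>"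
    if x: "x < dE i" and \<epsilon>: "\<epsilon> \<in> PiE (- {i}) LE" for x \<epsilon>
  proof -
    have labx: "(\<lambda>j\<in>{i}. x) \<in> PiE {i} LE" using x by (auto simp: PiE_iff)
    have "override_on \<epsilon> (\<lambda>j\<in>{i}. x) {i} \<in> cfg dE"
    proof (rule PiE_I)
      fix j show "override_on \<epsilon> (\<lambda>j\<in>{i}. x) {i} j \<in> {..<dE j}"
        using x PiE_mem[OF \<epsilon>, of j] by (cases "j = i") auto
    qed simp
    moreover have "(\<lambda>j k. full i \<beta> y k j) = override_on \<beta> (\<lambda>j\<in>{i}. y) {i}"
      by (auto simp: full_def override_on_def fun_eq_iff)
    moreover have "WP {i} (\<lambda>j\<in>{i}. y) (\<lambda>j\<in>{i}. x) = W i y x"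
      using lab labx by (simp add: prod_map_def)
    ultimately show ?thesis
      using prod_map_split[where W = W and LE = LE and LG = LG, OF iso_W finite_lessThan finG lab \<beta> labx \<epsilon>]
      by (simp add: WT_eq)
  qed
  have "Z (full i \<beta> y) k m = (\<Sum>x<dE i. \<Sum>\<epsilon>\<in>PiE (- {i}) LE.
      W i y x * (WP (- {i}) \<beta> \<epsilon> * Y k (override_on \<epsilon> (\<lambda>j\<in>{i}. x) {i}) m))"
    unfolding Z_def sum_PiE_UNIV_split[of _ LE "{i}"] sum_PiE_singleton
    by (intro sum.cong refl) (simp add: W)
  then show ?thesis by (simp add: side_ket_def sum_distrib_left)
qed

lemma side_ket_norm:
  assumes "m \<in> Q" "m' \<in> Q"
  shows "(\<Sum>z\<in>sides. \<Sum>x<dE i. side_ket z x m * cnj (side_ket z x m')) = (if m = m' then p else 0)"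
proof -
  have "(\<Sum>z\<in>sides. \<Sum>x<dE i. side_ket z x m * cnj (side_ket z x m'))
     = (\<Sum>k<n. \<Sum>x<dE i. \<Sum>\<beta>\<in>PiE (- {i}) LG. side_ket (k, \<beta>) x m * cnj (side_ket (k, \<beta>) x m'))"
    unfolding sides_def sum.cartesian_product' by (rule sum.cong[OF refl], rule sum.swap)
  also have "\<dots> = (\<Sum>k<n. \<Sum>x<dE i. \<Sum>\<epsilon>\<in>PiE (- {i}) LE.
      Y k (override_on \<epsilon> (\<lambda>j\<in>{i}. x) {i}) m * cnj (Y k (override_on \<epsilon> (\<lambda>j\<in>{i}. x) {i}) m'))"
    unfolding side_ket_def case_prod_conv isometry_preserves[OF iso_WP finLE] ..
  also have "\<dots> = (\<Sum>k<n. \<Sum>e\<in>cfg dE. Y k e m * cnj (Y k e m'))"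
    unfolding sum_PiE_UNIV_split[of _ LE "{i}"] sum_PiE_singleton ..
  finally show ?thesis using Y_norm[OF assms] by simp
qed

text \<open>E_i decodes the secret, so it decouples the purifying index and the other systems;
  encoding the latter only conjugates their constant operator.\<close>

lemma side_ket_constant:
  "\<exists>c. \<forall>z\<in>sides. \<forall>z'\<in>sides. \<forall>m\<in>Q. \<forall>m'\<in>Q.
     (\<Sum>x<dE i. side_ket z x m * cnj (side_ket z' x m')) = (if m = m' then c z z' else 0)"
proof -
  obtain \<omega> where \<omega>: "decoupled (PiE {i} LE) ({..<n} \<times> PiE (- {i}) LE) Q
      (\<lambda>s (k, \<epsilon>) m. Y k (override_on \<epsilon> s {i}) m) \<omega>" using decoupled_rest by blast
  define c where "c = (\<lambda>(k, \<beta>) (k', \<beta>'). \<Sum>\<epsilon>\<in>PiE (- {i}) LE. \<Sum>\<epsilon>'\<in>PiE (- {i}) LE.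
      WP (- {i}) \<beta> \<epsilon> * cnj (WP (- {i}) \<beta>' \<epsilon>') * \<omega> (k, \<epsilon>) (k', \<epsilon>'))"
  have "(\<Sum>x<dE i. side_ket (k, \<beta>) x m * cnj (side_ket (k', \<beta>') x m')) = (if m = m' then c (k, \<beta>) (k', \<beta>') else 0)"
    if k: "k < n" "k' < n" and m: "m \<in> Q" "m' \<in> Q" for k k' \<beta> \<beta>' m m'
  proof -
    let ?y = "\<lambda>k \<epsilon> x m. Y k (override_on \<epsilon> (\<lambda>j\<in>{i}. x) {i}) m"
    have Y: "(\<Sum>x<dE i. ?y k \<epsilon> x m * cnj (?y k' \<epsilon>' x m')) = (if m = m' then \<omega> (k, \<epsilon>) (k', \<epsilon>') else 0)"
      if "\<epsilon> \<in> PiE (- {i}) LE" "\<epsilon>' \<in> PiE (- {i}) LE" for \<epsilon> \<epsilon>'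
      using decoupledD[OF \<omega>, of "(k, \<epsilon>)" "(k', \<epsilon>')" m m'] k m that
      unfolding sum_PiE_singleton by simp
    have "(\<Sum>x<dE i. side_ket (k, \<beta>) x m * cnj (side_ket (k', \<beta>') x m'))
       = (\<Sum>x<dE i. \<Sum>\<epsilon>\<in>PiE (- {i}) LE. \<Sum>\<epsilon>'\<in>PiE (- {i}) LE.
          WP (- {i}) \<beta> \<epsilon> * cnj (WP (- {i}) \<beta>' \<epsilon>') * (?y k \<epsilon> x m * cnj (?y k' \<epsilon>' x m')))"
      unfolding side_ket_def case_prod_conv by (simp only: cnj_sum sum_product) (simp only: complex_cnj_mult mult_ac)
    also have "\<dots> = (\<Sum>\<epsilon>\<in>PiE (- {i}) LE. \<Sum>\<epsilon>'\<in>PiE (- {i}) LE.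
        WP (- {i}) \<beta> \<epsilon> * cnj (WP (- {i}) \<beta>' \<epsilon>') * (\<Sum>x<dE i. ?y k \<epsilon> x m * cnj (?y k' \<epsilon>' x m')))"
      unfolding sum_distrib_left by (subst sum.swap, rule sum.cong[OF refl], rule sum.swap)
    also have "\<dots> = (\<Sum>\<epsilon>\<in>PiE (- {i}) LE. \<Sum>\<epsilon>'\<in>PiE (- {i}) LE.
        WP (- {i}) \<beta> \<epsilon> * cnj (WP (- {i}) \<beta>' \<epsilon>') * (if m = m' then \<omega> (k, \<epsilon>) (k', \<epsilon>') else 0))"
      by (intro sum.cong refl) (simp only: Y)
    also have "\<dots> = (if m = m' then c (k, \<beta>) (k', \<beta>') else 0)" by (simp add: c_def)
    finally show ?thesis .
  qed
  then show ?thesis by (intro exI[of _ c]) (auto simp: sides_def)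
qed

definition mix :: "'b set \<Rightarrow> ('b \<Rightarrow> 'i \<Rightarrow> nat) \<Rightarrow> ('b \<Rightarrow> 'i \<Rightarrow> nat) \<Rightarrow> 'i \<Rightarrow> 'b \<Rightarrow> nat" where
  "mix S b c = (\<lambda>j\<in>- {i}. \<lambda>k. if k \<in> S then b k j else c k j)"

definition own :: "'b set \<Rightarrow> ('b \<Rightarrow> 'i \<Rightarrow> nat) \<Rightarrow> 'b \<Rightarrow> nat" where
  "own S b = (\<lambda>k\<in>S. b k i)"

lemma bij_mix:
  "bij_betw (\<lambda>(b, k, c). ((k, mix S b c), own S b)) (PiE S LB \<times> ({..<n} \<times> PiE (- S) (others i))) (sides \<times> PiE S (Lsh i))"
proof (rule bij_betwI[where g = "\<lambda>((k, \<beta>), s). (\<lambda>l\<in>S. \<lambda>j. if j = i then s l else \<beta> j l, k, \<lambda>l\<in>- S. \<lambda>j\<in>- {i}. \<beta> j l)"])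
  show "(\<lambda>(b, k, c). ((k, mix S b c), own S b)) \<in> PiE S LB \<times> ({..<n} \<times> PiE (- S) (others i)) \<rightarrow> sides \<times> PiE S (Lsh i)"
    by (auto simp: mix_def own_def sides_def PiE_iff)
  show "(\<lambda>((k, \<beta>), s). (\<lambda>l\<in>S. \<lambda>j. if j = i then s l else \<beta> j l, k, \<lambda>l\<in>- S. \<lambda>j\<in>- {i}. \<beta> j l))
      \<in> sides \<times> PiE S (Lsh i) \<rightarrow> PiE S LB \<times> ({..<n} \<times> PiE (- S) (others i))"
    by (auto simp: sides_def PiE_iff split: if_split_asm)
next
  fix x assume x: "x \<in> PiE S LB \<times> ({..<n} \<times> PiE (- S) (others i))"
  obtain b k c where [simp]: "x = (b, k, c)" by (cases x)
  have "(\<lambda>l\<in>S. \<lambda>j. if j = i then own S b l else mix S b c j l) = b"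
    "(\<lambda>l\<in>- S. \<lambda>j\<in>- {i}. mix S b c j l) = c"
    using x by (auto simp: mix_def own_def PiE_iff extensional_def fun_eq_iff)
  then show "(\<lambda>((k, \<beta>), s). (\<lambda>l\<in>S. \<lambda>j. if j = i then s l else \<beta> j l, k, \<lambda>l\<in>- S. \<lambda>j\<in>- {i}. \<beta> j l))
      ((\<lambda>(b, k, c). ((k, mix S b c), own S b)) x) = x" by simp
next
  fix y assume y: "y \<in> sides \<times> PiE S (Lsh i)"
  obtain k \<beta> s where [simp]: "y = ((k, \<beta>), s)" by (cases y) auto
  have "mix S (\<lambda>l\<in>S. \<lambda>j. if j = i then s l else \<beta> j l) (\<lambda>l\<in>- S. \<lambda>j\<in>- {i}. \<beta> j l) = \<beta>"
    "own S (\<lambda>l\<in>S. \<lambda>j. if j = i then s l else \<beta> j l) = s"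
    using y by (auto simp: mix_def own_def sides_def PiE_iff extensional_def fun_eq_iff)
  then show "(\<lambda>(b, k, c). ((k, mix S b c), own S b))
      ((\<lambda>((k, \<beta>), s). (\<lambda>l\<in>S. \<lambda>j. if j = i then s l else \<beta> j l, k, \<lambda>l\<in>- S. \<lambda>j\<in>- {i}. \<beta> j l)) y) = y" by simp
qed

lemma sum_mix:
  "(\<Sum>r\<in>PiE (- S) LB. G (\<lambda>b. override_on r b S))
   = (\<Sum>c\<in>PiE (- S) (others i). \<Sum>h\<in>PiE (- S) (Lsh i). G (\<lambda>b. full i (mix S b c) (override_on h (own S b) S)))"
proof -
  have eq: "override_on (insert_share i (- S) h c) b S = full i (mix S b c) (override_on h (own S b) S)" for h c b
    by (auto simp: insert_share_def override_on_def full_def mix_def own_def fun_eq_iff)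
  have "(\<Sum>r\<in>PiE (- S) LB. G (\<lambda>b. override_on r b S))
     = (\<Sum>(h, c)\<in>PiE (- S) (Lsh i) \<times> PiE (- S) (others i). G (\<lambda>b. override_on (insert_share i (- S) h c) b S))"
    by (subst sum.reindex_bij_betw[OF bij_insert_share, symmetric]) (simp add: split_def)
  then show ?thesis
    unfolding eq sum.cartesian_product[symmetric] by (subst sum.swap) simp
qed

text \<open>The side system holds the purification of the measured branch together with the shares of all
  \<open>E\<^sub>j\<close> with \<open>j \<noteq> i\<close>.\<close>

theorem recover_Q_imp_can_extract:
  assumes "secret_recoverable Q (PiE S LB) (\<lambda>\<rho>. reduce LB S (Br i a \<rho>))"
  shows "can_extract Q {..<dE i} (Lsh i) (W i) S"
proof -
  obtain R0 where R0: "channel (PiE S LB) Q R0"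
    "\<And>\<rho>. state Q \<rho> \<Longrightarrow> R0 (reduce LB S (Br i a \<rho>)) = (\<lambda>m m'. p * \<rho> m m')"
    using assms unfolding recover_Q_iff by blast
  obtain t where t: "0 < t" "p = of_real t" using p_pos by auto
  define c where "c = 1 / complex_of_real (sqrt t)"
  have c: "c * cnj c = 1 / p" using t by (simp add: c_def flip: of_real_mult)
  \<comment> \<open>\<open>can_extract\<close> labels the side system by an initial segment of the
    naturals, hence an enumeration of \<open>sides\<close>.\<close>
  define r where "r = card sides"
  obtain enc where enc: "bij_betw enc sides {..<r}"
    using ex_bij_betw_finite_nat[OF finite_sides] by (auto simp: r_def atLeast0LessThan)
  define dec where "dec = the_inv_into sides enc"
  have dec: "bij_betw dec {..<r} sides" "\<And>z. z \<in> sides \<Longrightarrow> dec (enc z) = z"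
    using enc bij_betw_the_inv_into[OF enc] by (auto simp: dec_def bij_betw_def the_inv_into_f_f)
  have decs: "dec x \<in> sides" if "x < r" for x using dec(1) that by (auto dest: bij_betwE)
  have encr: "enc z < r" if "z \<in> sides" for z using enc that by (auto dest: bij_betwE)
  define J where "J = (\<lambda>(x, e) m. if x < r \<and> e < dE i \<and> m < q then c * side_ket (dec x) e m else 0)"
  have J: "isometry Q ({..<r} \<times> {..<dE i}) J"
    unfolding isometry_def
  proof (intro conjI allI impI ballI)
    fix m m' assume m: "m \<in> Q" "m' \<in> Q"
    have "(\<Sum>y\<in>{..<r} \<times> {..<dE i}. cnj (J y m) * J y m')
       = (\<Sum>x<r. \<Sum>e<dE i. (c * cnj c) * (side_ket (dec x) e m' * cnj (side_ket (dec x) e m)))"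
      unfolding sum.cartesian_product' using m by (simp add: J_def mult_ac)
    also have "\<dots> = (\<Sum>z\<in>sides. \<Sum>e<dE i. (c * cnj c) * (side_ket z e m' * cnj (side_ket z e m)))"
      by (rule sum.reindex_bij_betw[OF dec(1)])
    also have "\<dots> = (c * cnj c) * (if m' = m then p else 0)"
      unfolding sum_distrib_left[symmetric] side_ket_norm[OF m(2,1)] ..
    finally show "(\<Sum>y\<in>{..<r} \<times> {..<dE i}. cnj (J y m) * J y m') = (if m = m' then 1 else 0)"
      using c t by auto
  qed (auto simp: J_def split: if_split_asm)
  obtain C where C: "\<And>z z' m m'. z \<in> sides \<Longrightarrow> z' \<in> sides \<Longrightarrow> m \<in> Q \<Longrightarrow> m' \<in> Q \<Longrightarrow>
     (\<Sum>x<dE i. side_ket z x m * cnj (side_ket z' x m')) = (if m = m' then C z z' else 0)"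
    using side_ket_constant by blast
  have tr: "trace_snd {..<dE i} (conj_by Q J \<rho>) x x' = (if x < r \<and> x' < r
      then c * cnj c * C (dec x) (dec x') * trace_on Q \<rho> else 0)" for \<rho> x x'
  proof (cases "x < r \<and> x' < r")
    case True
    have "trace_snd {..<dE i} (conj_by Q J \<rho>) x x' = (\<Sum>e<dE i. \<Sum>m<q. \<Sum>m'<q.
        (c * cnj c * \<rho> m m') * (side_ket (dec x) e m * cnj (side_ket (dec x') e m')))"
      using True by (simp add: trace_snd_def conj_by_def J_def mult_ac)
    also have "\<dots> = (\<Sum>m<q. \<Sum>m'<q. (c * cnj c * \<rho> m m') *
        (\<Sum>e<dE i. side_ket (dec x) e m * cnj (side_ket (dec x') e m')))"
      unfolding sum_distrib_left by (subst sum.swap, rule sum.cong[OF refl], rule sum.swap)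
    also have "\<dots> = (\<Sum>m<q. \<Sum>m'<q. (c * cnj c * \<rho> m m') * (if m = m' then C (dec x) (dec x') else 0))"
      using True decs by (intro sum.cong refl) (simp add: C)
    also have "\<dots> = c * cnj c * C (dec x) (dec x') * trace_on Q \<rho>"
      by (simp add: sum_delta_mult) (simp add: trace_on_def sum_distrib_left mult_ac)
    finally show ?thesis using True by simp
  next
    case False
    then have "conj_by Q J \<rho> (x, e) (x', e) = 0" for e
      unfolding conj_by_def by (intro sum.neutral ballI) (auto simp: J_def)
    then show ?thesis unfolding trace_snd_def if_not_P[OF False] by simp
  qed
  have none: "no_information Q (\<lambda>\<rho>. trace_snd {..<dE i} (conj_by Q J \<rho>))"
    unfolding no_information_def fun_eq_iff tr by (auto simp: state_def)
  define \<Phi> where "\<Phi> \<rho> = id_tensor (\<lambda>\<sigma>. reduce (Lsh i) S (conj_by {..<dE i} (W i) \<sigma>)) (conj_by Q J \<rho>)" for \<rho>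
  define N where "N = (\<lambda>(x, y) m. \<Sum>e<dE i. W i y e * J (x, e) m)"
  have \<Phi>: "\<Phi> \<rho> (x, s) (x', s') = (if s \<in> PiE S (Lsh i) \<and> s' \<in> PiE S (Lsh i)
      then \<Sum>h\<in>PiE (- S) (Lsh i). conj_by Q N \<rho> (x, override_on h s S) (x', override_on h s' S) else 0)" for \<rho> x s x' s'
  proof -
    have "id_tensor (conj_by {..<dE i} (W i)) (conj_by Q J \<rho>) = conj_by Q N \<rho>"
      unfolding id_tensor_conj_by_conj_by N_def ..
    then have "conj_by {..<dE i} (W i) (\<lambda>y y'. conj_by Q J \<rho> (x, y) (x', y')) = (\<lambda>y y'. conj_by Q N \<rho> (x, y) (x', y'))"
      by (simp add: id_tensor_def fun_eq_iff)
    then show ?thesis by (simp add: \<Phi>_def id_tensor_def reduce_def)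
  qed
  have Nz: "N (enc (k, \<beta>), y) m = c * Z (full i \<beta> y) k m"
    if "k < n" "\<beta> \<in> PiE (- {i}) LG" "y \<in> LG i" "m < q" for k \<beta> y m
  proof -
    have "(k, \<beta>) \<in> sides" using that by (simp add: sides_def)
    then show ?thesis
      using encr dec(2) that by (simp add: N_def J_def Z_full sum_distrib_left mult_ac)
  qed
  have \<Phi>_op: "\<Phi> \<rho> \<in> opers ({..<r} \<times> PiE S (Lsh i))" for \<rho>
  proof (rule opersI, clarify)
    fix x s x' s' assume out: "(x, s) \<notin> {..<r} \<times> PiE S (Lsh i) \<or> (x', s') \<notin> {..<r} \<times> PiE S (Lsh i)"
    have "N (x, y) m = 0" if "\<not> x < r" for x y m using that by (simp add: N_def J_def)
    then have "\<not> x < r \<or> \<not> x' < r \<Longrightarrow> conj_by Q N \<rho> (x, y) (x', y') = 0" for y y'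
      by (auto simp: conj_by_def)
    then show "\<Phi> \<rho> (x, s) (x', s') = 0" using out unfolding \<Phi> by auto
  qed
  \<comment> \<open>The side system holds more than \<open>S\<close> does in the actual branch,
    namely the purifying index and the foreign shares of \<open>- S\<close>. Tracing these out
    leaves exactly the shares of \<open>S\<close>, to which the given recovery applies.\<close>
  define g where "g = (\<lambda>b (k, d). (enc (k, mix S b d), own S b))"
  let ?T = "ptr g (PiE S LB) ({..<n} \<times> PiE (- S) (others i))"
  have "bij_betw (\<lambda>(b, z). g b z) (PiE S LB \<times> ({..<n} \<times> PiE (- S) (others i))) ({..<r} \<times> PiE S (Lsh i))"
  proof -
    have "bij_betw (map_prod enc id) (sides \<times> PiE S (Lsh i)) ({..<r} \<times> PiE S (Lsh i))"
      by (intro bij_betw_map_prod enc bij_betw_id)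
    from bij_betw_trans[OF bij_mix this] show ?thesis
      by (rule back_subst[of "\<lambda>f. bij_betw f _ _"]) (auto simp: g_def fun_eq_iff)
  qed
  then have T: "channel ({..<r} \<times> PiE S (Lsh i)) (PiE S LB) ?T"
    by (rule channel_ptr) (auto intro: finsh fin_others)
  have T\<Phi>: "?T (\<Phi> \<rho>) = (\<lambda>b b'. (1 / p) * reduce LB S (Br i a \<rho>) b b')" for \<rho>
  proof (intro ext)
    fix b b'
    show "?T (\<Phi> \<rho>) b b' = (1 / p) * reduce LB S (Br i a \<rho>) b b'"
    proof (cases "b \<in> PiE S LB \<and> b' \<in> PiE S LB")
      case True
      have own: "own S b \<in> PiE S (Lsh i)" if "b \<in> PiE S LB" for b
        using that by (auto simp: own_def PiE_iff)
      have mix: "mix S b d \<in> PiE (- {i}) LG" if "b \<in> PiE S LB" "d \<in> PiE (- S) (others i)" for b d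
        using that by (auto simp: mix_def PiE_iff)
      have y: "override_on h s S \<in> LG i" if "s \<in> PiE S (Lsh i)" "h \<in> PiE (- S) (Lsh i)" for s h
      proof (rule PiE_I)
        fix k show "override_on h s S k \<in> {..<dB k i}"
          using PiE_mem[OF that(1), of k] PiE_mem[OF that(2), of k] by (cases "k \<in> S") auto
      qed simp
      have "?T (\<Phi> \<rho>) b b' = (\<Sum>k<n. \<Sum>d\<in>PiE (- S) (others i). \<Sum>h\<in>PiE (- S) (Lsh i).
          conj_by Q N \<rho> (enc (k, mix S b d), override_on h (own S b) S) (enc (k, mix S b' d), override_on h (own S b') S))"
        unfolding ptr_def sum.cartesian_product' using True own by (simp add: g_def \<Phi>)
      also have "\<dots> = (\<Sum>k<n. \<Sum>d\<in>PiE (- S) (others i). \<Sum>h\<in>PiE (- S) (Lsh i).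
          (1 / p) * conj_by Q (\<lambda>b m. Z b k m) \<rho> (full i (mix S b d) (override_on h (own S b) S))
            (full i (mix S b' d) (override_on h (own S b') S)))"
      proof (intro sum.cong refl)
        fix k d h assume k: "k \<in> {..<n}" and d: "d \<in> PiE (- S) (others i)" and h: "h \<in> PiE (- S) (Lsh i)"
        have N: "N (enc (k, mix S x d), override_on h (own S x) S) m = c * Z (full i (mix S x d) (override_on h (own S x) S)) k m"
          if "x \<in> PiE S LB" "m < q" for x m
          using k mix[OF that(1) d] y[OF own[OF that(1)] h] that(2) by (intro Nz) auto
        show "conj_by Q N \<rho> (enc (k, mix S b d), override_on h (own S b) S) (enc (k, mix S b' d), override_on h (own S b') S)
           = (1 / p) * conj_by Q (\<lambda>b m. Z b k m) \<rho> (full i (mix S b d) (override_on h (own S b) S))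
            (full i (mix S b' d) (override_on h (own S b') S))"
          unfolding conj_by_def c[symmetric] sum_distrib_left
          using True by (intro sum.cong refl) (simp add: N mult_ac)
      qed
      also have "\<dots> = (\<Sum>k<n. (1 / p) * (\<Sum>x\<in>PiE (- S) LB. conj_by Q (\<lambda>b m. Z b k m) \<rho> (override_on x b S) (override_on x b' S)))"
        unfolding sum_distrib_left[symmetric]
        using sum_mix[where G = "\<lambda>f. conj_by Q (\<lambda>b m. Z b k m) \<rho> (f b) (f b')" and S = S for k] by simp
      also have "\<dots> = (1 / p) * reduce LB S (Br i a \<rho>) b b'"
        unfolding Br_eq reduce_def sum_distrib_left[symmetric] if_P[OF True]
        by (rule arg_cong[where f = "times (1 / p)"], rule sum.swap)
      finally show ?thesis .
    next
      case False
      then show ?thesis unfolding ptr_def reduce_def by (simp only: if_False mult_zero_right)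
    qed
  qed
  have "R0 (?T (\<Phi> \<rho>)) = (\<lambda>m m'. trace_on ({..<r} \<times> PiE S (Lsh i)) (\<Phi> \<rho>) * \<rho> m m')" if \<rho>: "state Q \<rho>" for \<rho>
  proof -
    have "trace_on ({..<r} \<times> PiE S (Lsh i)) (\<Phi> \<rho>) = trace_on (PiE S LB) (?T (\<Phi> \<rho>))"
      using channel_trace[OF T \<Phi>_op] by simp
    also have "\<dots> = (1 / p) * trace_on (PiE S LB) (reduce LB S (Br i a \<rho>))"
      unfolding T\<Phi> trace_on_def sum_distrib_left ..
    also have "\<dots> = 1" using \<rho> t by (simp add: trace_reduce_branch state_def)
    finally have "trace_on ({..<r} \<times> PiE S (Lsh i)) (\<Phi> \<rho>) = 1" .
    moreover have "R0 (?T (\<Phi> \<rho>)) = \<rho>"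
      unfolding T\<Phi> channel_scale[OF R0(1) reduce_opers] R0(2)[OF \<rho>] using t by simp
    ultimately show ?thesis by simp
  qed
  then have "secret_recoverable Q ({..<r} \<times> PiE S (Lsh i)) \<Phi>"
    unfolding secret_recoverable_def using channel_comp[OF T R0(1)] by blast
  then show ?thesis
    unfolding can_extract_def \<Phi>_def[abs_def] using J none by blast
qed

end

section \<open>Assembly over all outcomes\<close>

context two_layers
begin

lemma branch_interpretation:
  assumes "a \<in> Oc i" "B i a (id_op Q) \<noteq> (\<lambda>_ _. 0)"
  obtains n Y p where "possible_two_layers q dA dE V Oc M dD \<psi> U dB W \<Gamma> i a n Y p"
proof -
  obtain n Y p where "possible_branch q dA dE V Oc M i a n Y p"
    using possible_branch_exists[OF assms] .
  then show ?thesis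
    using that possible_two_layers.intro[OF two_layers_axioms] by blast
qed

lemma branch_eq:
  "measured {..<dA} (M i a) (id_tensor (conj_by ({..<dD} \<times> Q) (U_tot dE W U))
     (\<lambda>(a, d, m) (a', d', m'). ket_bra \<psi> (a, d) (a', d') * \<rho> m m')) = Br i a \<rho>"
  unfolding tau_eq measured_eq ..

lemma possible_B: "Br i a (id_op Q) \<noteq> (\<lambda>_ _. 0) \<Longrightarrow> B i a (id_op Q) \<noteq> (\<lambda>_ _. 0)"
  by (auto simp: conj_by_def)

text \<open>Recovering the subspace implies recovering the secret from the state, which implies
  extraction, which tightness allows to authorized sets only. The converse holds for every second
  layer.\<close>

lemma tight_recover_Q:
  assumes "tight q dE dB W \<Gamma>" "a \<in> Oc i" "B i a (id_op Q) \<noteq> (\<lambda>_ _. 0)"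
  shows "secret_recoverable Q (PiE S LB) (\<lambda>\<rho>. reduce LB S (Br i a \<rho>)) \<longleftrightarrow> S \<in> \<Gamma> i"
    and "qss_code Q LB (support_of (PiE UNIV LB) (Br i a (id_op Q))) (\<Gamma> i)"
proof -
  obtain n Y p where "possible_two_layers q dA dE V Oc M dD \<psi> U dB W \<Gamma> i a n Y p"
    using branch_interpretation[OF assms(2,3)] .
  then interpret possible_two_layers q dA dE V Oc M dD \<psi> U dB W \<Gamma> i a n Y p .
  have iff: "secret_recoverable Q (PiE S LB) (\<lambda>\<rho>. reduce LB S (Br i a \<rho>)) \<longleftrightarrow> S \<in> \<Gamma> i" for S
    using recover_Q_imp_can_extract[of S] authorized_recover_Q[of S] assms(1) unfolding tight_def by blast
  then show "secret_recoverable Q (PiE S LB) (\<lambda>\<rho>. reduce LB S (Br i a \<rho>)) \<longleftrightarrow> S \<in> \<Gamma> i" .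
  show "qss_code Q LB (support_of (PiE UNIV LB) (Br i a (id_op Q))) (\<Gamma> i)"
    using branch_authorizing recovers_imp_recover_Q iff unfolding qss_code_def authorizing_code_def by blast
qed

theorem two_layer_properties:
  shows "programmable authorizing_code Q LB {..<dA} {..<dD} \<Gamma> (ket_bra \<psi>) (conj_by ({..<dD} \<times> Q) (U_tot dE W U)) Oc M"
    and "a \<in> Oc i \<Longrightarrow> B i a (id_op Q) \<noteq> (\<lambda>_ _. 0) \<Longrightarrow> S \<in> \<Gamma> i \<Longrightarrow>
      secret_recoverable Q (PiE S LB) (\<lambda>\<rho>. reduce LB S (Br i a \<rho>))"
    and "a \<in> Oc i \<Longrightarrow> B i a (id_op Q) \<noteq> (\<lambda>_ _. 0) \<Longrightarrow>
      no_information Q (\<lambda>\<rho>. reduce LG (- {i}) (group_by_system (Br i a \<rho>)))"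
    and "tight q dE dB W \<Gamma> \<Longrightarrow> programmable qss_code Q LB {..<dA} {..<dD} \<Gamma> (ket_bra \<psi>)
      (conj_by ({..<dD} \<times> Q) (U_tot dE W U)) Oc M"
proof -
  show "programmable authorizing_code Q LB {..<dA} {..<dD} \<Gamma> (ket_bra \<psi>) (conj_by ({..<dD} \<times> Q) (U_tot dE W U)) Oc M"
    by (rule programmableI) (metis branch_interpretation possible_two_layers.branch_authorizing)
  show "secret_recoverable Q (PiE S LB) (\<lambda>\<rho>. reduce LB S (Br i a \<rho>))"
    if "a \<in> Oc i" "B i a (id_op Q) \<noteq> (\<lambda>_ _. 0)" "S \<in> \<Gamma> i"
    using that by (metis branch_interpretation possible_two_layers.authorized_recover_Q)
  show "no_information Q (\<lambda>\<rho>. reduce LG (- {i}) (group_by_system (Br i a \<rho>)))"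
    if "a \<in> Oc i" "B i a (id_op Q) \<noteq> (\<lambda>_ _. 0)"
    using that by (metis branch_interpretation possible_two_layers.other_shares_no_information)
  show "programmable qss_code Q LB {..<dA} {..<dD} \<Gamma> (ket_bra \<psi>) (conj_by ({..<dD} \<times> Q) (U_tot dE W U)) Oc M"
    if "tight q dE dB W \<Gamma>"
    by (rule programmableI) (rule tight_recover_Q(2)[OF that])
qed

end

text \<open>The lower bound on \<open>dE i\<close> makes the tight codes, which exist in every
  dimension from 2 on, fit any first layer.\<close>

lemma (in first_layer_ctx) tight_second_layer_exists:
  fixes \<Gamma> :: "'i \<Rightarrow> 'b::finite set set"
  assumes "\<And>i. valid_access_structure (\<Gamma> i)"
  shows "\<exists>dB W. second_layer dE dB W \<Gamma> \<and> tight q dE dB W \<Gamma>"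
proof -
  have "\<exists>d W. isometry {..<dE i} (cfg d) W \<and> qss_code {..<dE i} (\<lambda>k. {..<d k}) (lin_range {..<dE i} W) (\<Gamma> i) \<and>
      (\<forall>S. S \<notin> \<Gamma> i \<longrightarrow> \<not> can_extract Q {..<dE i} (\<lambda>k. {..<d k}) W S)" for i
    using tight_code_exists[OF assms two_le_dE, of i i] q2 by metis
  then obtain d W where "\<forall>i. isometry {..<dE i} (cfg (d i)) (W i) \<and>
      qss_code {..<dE i} (\<lambda>k. {..<d i k}) (lin_range {..<dE i} (W i)) (\<Gamma> i) \<and>
      (\<forall>S. S \<notin> \<Gamma> i \<longrightarrow> \<not> can_extract Q {..<dE i} (\<lambda>k. {..<d i k}) (W i) S)"
    by metis
  then show ?thesis
    unfolding second_layer_def tight_def by (intro exI[of _ "\<lambda>k i. d i k"] exI[of _ W]) simp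
qed

theorem mainTheorem2:
  fixes \<Gamma> :: "'i::finite \<Rightarrow> 'b::finite set set" and q :: nat
  assumes "2 \<le> q" and "\<And>i. valid_access_structure (\<Gamma> i)"
  shows
    "(\<exists>dA (dE :: 'i \<Rightarrow> nat) V Oc M. first_layer q dA dE V Oc M) \<and>
     (\<forall>dA (dE :: 'i \<Rightarrow> nat) V Oc M. first_layer q dA dE V Oc M \<longrightarrow>
        (\<exists>dD \<psi> U. dealer_form q dA dE dD V \<psi> U \<and>
           (2 \<le> CARD('i) \<longrightarrow> entangled {..<dA} {..<dD} \<psi>)) \<and>
        (\<exists>dB W. second_layer dE dB W \<Gamma> \<and> tight q dE dB W \<Gamma>) \<and>
        (\<forall>dD \<psi> U dB W. dealer_form q dA dE dD V \<psi> U \<and> second_layer dE dB W \<Gamma> \<longrightarrow>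
          (let Q = {..<q}; A = {..<dA}; D = {..<dD};
               LE = (\<lambda>i. {..<dE i});
               LB = (\<lambda>k. cfg (dB k));
               \<E> = conj_by (D \<times> Q) (U_tot dE W U);
               branch = (\<lambda>i a \<rho>. measured A (M i a) (id_tensor \<E>
                  (\<lambda>(a, d, m) (a', d', m'). ket_bra \<psi> (a, d) (a', d') * \<rho> m m')));
               possible = (\<lambda>i a. a \<in> Oc i \<and> branch i a (id_op Q) \<noteq> (\<lambda>_ _. 0));
               can_recover_Q = (\<lambda>i a S.
                  secret_recoverable Q (PiE S LB) (\<lambda>\<rho>. reduce LB S (branch i a \<rho>)))
           in programmable authorizing_code Q LB A D \<Gamma> (ket_bra \<psi>) \<E> Oc M \<and>
              (\<forall>i. \<forall>S\<in>\<Gamma> i. \<exists>R. channel (PiE S LB) (PiE {i} LE) R \<and>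
                 (\<forall>\<sigma>\<in>opers (cfg dE).
                    R (reduce LB S (conj_by (cfg dE) (W_tot W) \<sigma>)) = reduce LE {i} \<sigma>)) \<and>
              (\<forall>i a. possible i a \<longrightarrow> (\<forall>S\<in>\<Gamma> i. can_recover_Q i a S)) \<and>
              (\<forall>i a. possible i a \<longrightarrow>
                 no_information Q (\<lambda>\<rho>. reduce (\<lambda>j. cfg (\<lambda>k. dB k j)) (- {i})
                    (group_by_system (branch i a \<rho>)))) \<and>
              (tight q dE dB W \<Gamma> \<longrightarrow>
                 programmable_access_structure Q LB A D \<Gamma> (ket_bra \<psi>) \<E> Oc M \<and>
                 (\<forall>i a. possible i a \<longrightarrow> {S. can_recover_Q i a S} = \<Gamma> i)))))"
proof (intro conjI allI impI, goal_cases)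
  case 1
  show ?case by (rule first_layer_exists[OF assms(1)])
next
  case (2 dA dE V Oc M)
  then interpret first_layer_ctx q dA dE V Oc M using assms(1) by unfold_locales
  show ?case using dealer_form_exists dealer_entangled by blast
next
  case (3 dA dE V Oc M)
  then interpret first_layer_ctx q dA dE V Oc M using assms(1) by unfold_locales
  show ?case by (rule tight_second_layer_exists[OF assms(2)])
next
  case (4 dA dE V Oc M dD \<psi> U dB W)
  then interpret two_layers q dA dE V Oc M dD \<psi> U dB W \<Gamma> using assms(1) by unfold_locales auto
  show ?case
    unfolding Let_def branch_eq
  proof (intro conjI allI impI ballI; (elim conjE)?)
    fix i a S assume *: "a \<in> Oc i" "Br i a (id_op Q) \<noteq> (\<lambda>_ _. 0)"
    note ** = *(1) possible_B[OF *(2)]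
    show "no_information Q (\<lambda>\<rho>. reduce LG (- {i}) (group_by_system (Br i a \<rho>)))"
      by (rule two_layer_properties(3)[OF **])
    show "secret_recoverable Q (PiE S LB) (\<lambda>\<rho>. reduce LB S (Br i a \<rho>))" if "S \<in> \<Gamma> i"
      by (rule two_layer_properties(2)[OF ** that])
    show "{S. secret_recoverable Q (PiE S LB) (\<lambda>\<rho>. reduce LB S (Br i a \<rho>))} = \<Gamma> i" if "tight q dE dB W \<Gamma>"
      using tight_recover_Q(1)[OF that **] by auto
  next
    fix i S assume "S \<in> \<Gamma> i"
    then show "\<exists>R. channel (PiE S LB) (PiE {i} LE) R \<and>
       (\<forall>\<sigma>\<in>opers (cfg dE). R (reduce LB S (conj_by (cfg dE) WT \<sigma>)) = reduce LE {i} \<sigma>)"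
      by (rule share_decoder)
  qed (intro two_layer_properties)+
qed

end
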